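(* Let $d\ge2$ and let $T$ be a centered, isotropic Gaussian random field on $\mathbb S^{d-1}$ with angular power spectrum $(A_\ell,\ell\in\mathbb N_0)$. If $\sum_{\ell=0}^\infty A_\ell\,\ell^{d-2+\beta}<+\infty$ for some $\beta>0$, then there exists a $C^\gamma(\mathbb S^{d-1})$-valued modification of $T$ for all $\gamma<\beta/2$; that is, the modification is $k$-times continuously differentiable for $k=\lceil\beta/2\rceil-1$, and the $k$th derivatives are Hölder continuous with exponent $\gamma-k$ (for $k<\gamma<\beta/2$).
   Context: $\mathbb S^{d-1}$ is the unit sphere in $\mathbb R^d$ with geodesic metric $d(x,y)=\arccos\langle x,y\rangle_{\mathbb R^d}$. A centered isotropic Gaussian random field on $\mathbb S^{d-1}$ is a jointly measurable, mean-zero, square-integrable Gaussian field $T:\Omega\times\mathbb S^{d-1}\to\mathbb R$ whose covariance $\mathbb E(T(x)T(y))$ depends only on the geodesic distance of $x$ and $y$. Let $(S_{\ell m},\ \ell\in\mathbb N_0,\ m=1,\dots,h(\ell,d))$ be the real orthonormal spherical harmonics on $\mathbb S^{d-1}$, with $h(\ell,d)=(2\ell+d-2)\frac{(\ell+d-3)!}{(d-2)!\,\ell!}$ (and $h(0,2)=1$). Such a field has the Karhunen–Loève expansion $T=\sum_{\ell=0}^\infty\sum_{m=1}^{h(\ell,d)}a_{\ell m}S_{\ell m}$ with $\mathbb E(a_{\ell m})=0$ and $\mathbb E(a_{\ell m}a_{\ell'm'})=A_\ell\delta_{\ell\ell'}\delta_{mm'}$; the sequence $(A_\ell)$ of nonnegative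 reals, which satisfies $\sum_\ell A_\ell h(\ell,d)<\infty$, is the angular power spectrum. A modification of $T$ is a random field $\tilde T$ with $\mathbb P(\tilde T(x)=T(x))=1$ for every $x$; regularity refers to its sample paths. $C^\gamma(\mathbb S^{d-1})$ denotes the Hölder space of order $\gamma$. *)

theory Defs
  imports "HOL-Probability.Probability"
begin

text \<open>
  Throughout, the unit sphere of \<open>\<real>\<^sup>d\<close> is \<open>sphere 0 1 :: 'a set\<close> for a Euclidean space
  \<open>'a\<close> with \<open>DIM('a) = d\<close>. Fields and functions on the sphere are functions on \<open>'a\<close> whose
  values off the sphere are never looked at.
\<close>

abbreviation S_unit :: "'a::euclidean_space set" where
  "S_unit \<equiv> sphere 0 1"

definition geodist :: "'a::euclidean_space \<Rightarrow> 'a \<Rightarrow> real" where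
  "geodist x y = arccos (x \<bullet> y)"

text \<open>
  Surface measure, by integration in polar coordinates: \<open>\<sigma>(B)\<close> is \<open>d\<close> times the volume of the
  cone \<open>{r x | x \<in> B, 0 < r \<le> 1}\<close>. Here \<open>sgn x = x /\<^sub>R norm x\<close>.
\<close>

definition sphere_measure :: "'a::euclidean_space measure" where
  "sphere_measure =
     scale_measure (of_nat DIM('a))
       (distr (restrict_space lborel (cball 0 1 - {0})) (restrict_space borel S_unit) sgn)"

text \<open>Iterated partial derivatives; \<open>partials [i\<^sub>1,\<dots>,i\<^sub>n] f = \<partial>\<^bsub>i\<^sub>1\<^esub> \<dots> \<partial>\<^bsub>i\<^sub>n\<^esub> f\<close>.\<close>

primrec partials :: "'a::euclidean_space list \<Rightarrow> ('a \<Rightarrow> real) \<Rightarrow> 'a \<Rightarrow> real" where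
  "partials [] f = f"
| "partials (i # js) f = (\<lambda>x. frechet_derivative (partials js f) (at x) i)"

subsection \<open>Spherical harmonics\<close>

definition laplacian :: "('a::euclidean_space \<Rightarrow> real) \<Rightarrow> 'a \<Rightarrow> real" where
  "laplacian p x = (\<Sum>i\<in>Basis. partials [i, i] p x)"

text \<open>Spherical harmonics of degree \<open>l\<close> are the restrictions to the sphere of the harmonic
  homogeneous polynomials of degree \<open>l\<close>.\<close>

definition spherical_harmonic :: "nat \<Rightarrow> ('a::euclidean_space \<Rightarrow> real) \<Rightarrow> bool" where
  "spherical_harmonic l Y \<longleftrightarrow>
     (\<exists>p. real_polynomial_function p \<and>
          (\<forall>c x. p (c *\<^sub>R x) = c ^ l * p x) \<and>
          (\<forall>x. laplacian p x = 0) \<and>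
          (\<forall>x\<in>S_unit. Y x = p x))"

text \<open>For \<open>d \<ge> 2\<close> the division is exact. The only case in which the natural number \<open>l + d - 3\<close>
  would be truncated is the one singled out by the convention \<open>h(0,2) = 1\<close>.\<close>

definition harm_dim :: "nat \<Rightarrow> nat \<Rightarrow> nat" where
  "harm_dim l d =
     (if l = 0 \<and> d = 2 then 1
      else ((2 * l + d - 2) * fact (l + d - 3)) div (fact (d - 2) * fact l))"

definition orthonormal_spherical_harmonics ::
  "(nat \<Rightarrow> nat \<Rightarrow> 'a::euclidean_space \<Rightarrow> real) \<Rightarrow> bool" where
  "orthonormal_spherical_harmonics S \<longleftrightarrow>
     (\<forall>l. (\<forall>m\<in>{1..harm_dim l DIM('a)}. spherical_harmonic l (S l m)) \<and>
          (\<forall>m\<in>{1..harm_dim l DIM('a)}. \<forall>m'\<in>{1..harm_dim l DIM('a)}.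
             (LINT x|sphere_measure. S l m x * S l m' x) = (if m = m' then 1 else 0)) \<and>
          (\<forall>Y. spherical_harmonic l Y \<longrightarrow>
             (\<exists>c. \<forall>x\<in>S_unit. Y x = (\<Sum>m=1..harm_dim l DIM('a). c m * S l m x))))"

subsection \<open>Random fields on the sphere\<close>

definition random_field :: "'w measure \<Rightarrow> ('w \<Rightarrow> 'a::euclidean_space \<Rightarrow> real) \<Rightarrow> bool" where
  "random_field M T \<longleftrightarrow>
     (\<lambda>(\<omega>, x). T \<omega> x) \<in> borel_measurable (M \<Otimes>\<^sub>M restrict_space borel S_unit)"

text \<open>Normal laws, including the degenerate ones of variance zero.\<close>

definition gaussian_rv :: "'w measure \<Rightarrow> ('w \<Rightarrow> real) \<Rightarrow> bool" where
  "gaussian_rv M X \<longleftrightarrow>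
     X \<in> borel_measurable M \<and>
     (\<exists>\<mu> s. 0 \<le> s \<and>
        distr M borel X =
          (if s = 0 then return borel \<mu> else density lborel (\<lambda>x. ennreal (normal_density \<mu> s x))))"

definition gaussian_field :: "'w measure \<Rightarrow> ('w \<Rightarrow> 'a::euclidean_space \<Rightarrow> real) \<Rightarrow> bool" where
  "gaussian_field M T \<longleftrightarrow>
     (\<forall>I c. finite I \<and> I \<subseteq> S_unit \<longrightarrow> gaussian_rv M (\<lambda>\<omega>. \<Sum>x\<in>I. c x * T \<omega> x))"

definition centered_isotropic_gaussian_field ::
  "'w measure \<Rightarrow> ('w \<Rightarrow> 'a::euclidean_space \<Rightarrow> real) \<Rightarrow> bool" where
  "centered_isotropic_gaussian_field M T \<longleftrightarrow>
     random_field M T \<and>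
     gaussian_field M T \<and>
     (\<forall>x\<in>S_unit. integrable M (\<lambda>\<omega>. (T \<omega> x)\<^sup>2)) \<and>
     (\<forall>x\<in>S_unit. (LINT \<omega>|M. T \<omega> x) = 0) \<and>
     (\<exists>\<phi>. \<forall>x\<in>S_unit. \<forall>y\<in>S_unit. (LINT \<omega>|M. T \<omega> x * T \<omega> y) = \<phi> (geodist x y))"

text \<open>
  \<open>A\<close> is the sequence of variances in the Karhunen-Loeve expansion of \<open>T\<close> with respect to \<open>S\<close>.
  The expansion converges in \<open>L\<^sup>2(\<Omega> \<times> S\<^bsup>d-1\<^esup>)\<close>; the nonnegative integral is used so that the
  error cannot vanish merely because its square fails to be integrable.
\<close>

definition angular_power_spectrum ::
  "'w measure \<Rightarrow> ('w \<Rightarrow> 'a::euclidean_space \<Rightarrow> real) \<Rightarrow> (nat \<Rightarrow> nat \<Rightarrow> 'a \<Rightarrow> real)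
     \<Rightarrow> (nat \<Rightarrow> real) \<Rightarrow> bool" where
  "angular_power_spectrum M T S A \<longleftrightarrow>
     (\<forall>l. 0 \<le> A l) \<and>
     summable (\<lambda>l. A l * real (harm_dim l DIM('a))) \<and>
     (\<exists>a :: nat \<Rightarrow> nat \<Rightarrow> 'w \<Rightarrow> real.
        (\<forall>l. \<forall>m\<in>{1..harm_dim l DIM('a)}.
           a l m \<in> borel_measurable M \<and> integrable M (\<lambda>\<omega>. (a l m \<omega>)\<^sup>2) \<and>
           (LINT \<omega>|M. a l m \<omega>) = 0) \<and>
        (\<forall>l l'. \<forall>m\<in>{1..harm_dim l DIM('a)}. \<forall>m'\<in>{1..harm_dim l' DIM('a)}.
           (LINT \<omega>|M. a l m \<omega> * a l' m' \<omega>) = (if l = l' \<and> m = m' then A l else 0)) \<and>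
        (\<lambda>L. \<integral>\<^sup>+ (\<omega>, x).
               ennreal ((T \<omega> x -
                 (\<Sum>l\<le>L. \<Sum>m=1..harm_dim l DIM('a). a l m \<omega> * S l m x))\<^sup>2)
             \<partial>(M \<Otimes>\<^sub>M sphere_measure)) \<longlonglongrightarrow> 0)"

definition is_modification ::
  "'w measure \<Rightarrow> ('w \<Rightarrow> 'a::euclidean_space \<Rightarrow> real) \<Rightarrow> ('w \<Rightarrow> 'a \<Rightarrow> real) \<Rightarrow> bool" where
  "is_modification M T T' \<longleftrightarrow>
     random_field M T' \<and> (\<forall>x\<in>S_unit. \<P>(\<omega> in M. T' \<omega> x = T \<omega> x) = 1)"

subsection \<open>Differentiability and Hoelder spaces on the sphere\<close>

text \<open>
  The derivatives of a function on the sphere are those of its extension that is homogeneous of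
  degree 0, \<open>x \<mapsto> f (x / |x|)\<close> on \<open>\<real>\<^sup>d - {0}\<close>. As the extension and the restriction to the sphere
  are both smooth operations, this yields the same classes of functions as local charts do.
\<close>

definition hom_ext :: "('a::euclidean_space \<Rightarrow> real) \<Rightarrow> 'a \<Rightarrow> real" where
  "hom_ext f = (\<lambda>x. f (sgn x))"

definition Ck_sphere :: "nat \<Rightarrow> ('a::euclidean_space \<Rightarrow> real) \<Rightarrow> bool" where
  "Ck_sphere k f \<longleftrightarrow>
     (\<forall>js. set js \<subseteq> Basis \<and> length js < k \<longrightarrow>
        partials js (hom_ext f) differentiable_on (- {0})) \<and>
     (\<forall>js. set js \<subseteq> Basis \<and> length js \<le> k \<longrightarrow>
        continuous_on (- {0}) (partials js (hom_ext f)))"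

definition derivs_Hoelder :: "nat \<Rightarrow> real \<Rightarrow> ('a::euclidean_space \<Rightarrow> real) \<Rightarrow> bool" where
  "derivs_Hoelder k \<alpha> f \<longleftrightarrow>
     (\<forall>js. set js \<subseteq> Basis \<and> length js = k \<longrightarrow>
        (\<exists>C. \<forall>x\<in>S_unit. \<forall>y\<in>S_unit.
           \<bar>partials js (hom_ext f) x - partials js (hom_ext f) y\<bar> \<le> C * geodist x y powr \<alpha>))"

text \<open>For integer \<open>\<gamma>\<close> the Hoelder condition has exponent 0 and is automatic by compactness, so
  that this is the space of \<open>\<gamma>\<close> times continuously differentiable functions. (At \<open>x = y\<close> it reads
  \<open>0 \<le> 0\<close>, as \<open>0 powr 0 = 0\<close>.)\<close>

definition Hoelder_space :: "real \<Rightarrow> ('a::euclidean_space \<Rightarrow> real) set" where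
  "Hoelder_space \<gamma> =
     {f. Ck_sphere (nat \<lfloor>\<gamma>\<rfloor>) f \<and> derivs_Hoelder (nat \<lfloor>\<gamma>\<rfloor>) (\<gamma> - real (nat \<lfloor>\<gamma>\<rfloor>)) f}"

end

theory Submission
  imports Defs "HOL-Complex_Analysis.Complex_Analysis"
begin

text \<open>
  The proof decomposes the field into dyadic frequency blocks, in the manner of Littlewood and
  Paley. Block number \<open>j\<close> collects the degrees \<open>l\<close> of order \<open>2 ^ j\<close>, and its sample paths are
  polynomials of degree at most \<open>2 ^ (j + 1)\<close>, restricted to the sphere. Everything that concerns
  derivatives is a statement about such polynomials, and probability enters only through moments
  at single points.

  Probability. By the invariance of the reproducing kernel (\<open>zonal_diagonal\<close>) the variance of
  block \<open>j\<close> is the same at each point of the sphere, and the summability assumption bounds it by a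
  multiple of \<open>2 ^ (- \<beta> j)\<close> (\<open>block_variance\<close>). The block is an average of values of \<open>T\<close> over the
  sphere and thus has the moments of a Gaussian variable, up to constants (\<open>band_moment\<close>). So the
  expected integral of its power \<open>2 q\<close> is at most of order \<open>2 ^ (- \<beta> q j)\<close>.

  From integrals to maxima. Nikolskii's inequality (\<open>nikolskii\<close>) bounds the power \<open>2 q\<close> of the
  maximum of a polynomial of degree \<open>N\<close> by a multiple of \<open>N ^ d\<close> times the integral of that power.
  As \<open>q\<close> is arbitrary, the loss is negligible: almost surely the maximum of block \<open>j\<close> is
  at most a random constant times \<open>2 ^ (- \<gamma> j)\<close>, for all \<open>\<gamma> < \<beta> / 2\<close> (\<open>block_poly_decay\<close>).

  Regularity. By Bernstein's inequality (\<open>bernstein_trig\<close>) each derivative of block \<open>j\<close> costs at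
  most a factor of order \<open>2 ^ j\<close>. So the series of blocks can be differentiated term by term
  fewer than \<open>\<beta> / 2\<close> times, and interpolation between the bounds on a block and on its derivative
  yields Hoelder continuity (\<open>derivs_Hoelder_series\<close>).

  The sum of the blocks is a modification of \<open>T\<close> because the expansion converges in mean square at
  every point (\<open>expansion_pointwise\<close>), and not only on average over the sphere: by isotropy the
  error is the same at all points. The invariance arguments rest on the invariance of the
  surface measure under orthogonal maps and on the orthogonality of harmonics of different
  degrees (\<open>harmonic_orthogonal\<close>).
\<close>

section \<open>Polynomials of bounded degree\<close>

text \<open>
  Polynomials of degree at most \<open>n\<close> in several variables. The inductive form gives closure under
  derivatives and bounds on restrictions to great circles by induction, without coefficients.
\<close>

inductive degree_le :: "nat \<Rightarrow> ('a::euclidean_space \<Rightarrow> real) \<Rightarrow> bool" where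
  degree_le_const: "degree_le n (\<lambda>x. c)"
| degree_le_add: "degree_le n f \<Longrightarrow> degree_le n g \<Longrightarrow> degree_le n (\<lambda>x. f x + g x)"
| degree_le_inner_mult: "degree_le n f \<Longrightarrow> degree_le (Suc n) (\<lambda>x. (x \<bullet> b) * f x)"

lemma degree_le_Suc: "degree_le n f \<Longrightarrow> degree_le (Suc n) f"
  by (induction rule: degree_le.induct) (auto intro: degree_le.intros)

lemma degree_le_mono: "degree_le m f \<Longrightarrow> m \<le> n \<Longrightarrow> degree_le n f"
  by (rule dec_induct[of m n]) (auto intro: degree_le_Suc)

lemma degree_le_inner: "degree_le (Suc n) (\<lambda>x. x \<bullet> b)"
  using degree_le_inner_mult[OF degree_le_const[of n 1]] by simp

lemma degree_le_cmult:
  assumes "degree_le n f"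
  shows "degree_le n (\<lambda>x. c * f x)"
  using assms
proof (induction rule: degree_le.induct)
  case (degree_le_const n c')
  then show ?case by (rule degree_le.degree_le_const)
next
  case (degree_le_add n f g)
  then show ?case using degree_le.degree_le_add by (simp add: distrib_left)
next
  case (degree_le_inner_mult n f b)
  from degree_le.degree_le_inner_mult[OF this(2), of b] show ?case by (simp add: mult.left_commute)
qed

lemma degree_le_diff: "degree_le n f \<Longrightarrow> degree_le n g \<Longrightarrow> degree_le n (\<lambda>x. f x - g x)"
  using degree_le_add[OF _ degree_le_cmult[of n g "-1"], of f] by simp

lemma degree_le_mult:
  assumes "degree_le m f" "degree_le n g"
  shows "degree_le (m + n) (\<lambda>x. f x * g x)"
  using assms(1)
proof (induction rule: degree_le.induct)
  case (degree_le_const m c)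
  then show ?case using degree_le_mono[OF degree_le_cmult[OF assms(2)]] by simp
next
  case (degree_le_add m f h)
  then show ?case using degree_le.degree_le_add by (simp add: distrib_right)
next
  case (degree_le_inner_mult m f b)
  from degree_le.degree_le_inner_mult[OF this(2), of b] show ?case by (simp add: mult.assoc)
qed

lemma degree_le_sum: "(\<And>i. i \<in> I \<Longrightarrow> degree_le n (f i)) \<Longrightarrow> degree_le n (\<lambda>x. \<Sum>i\<in>I. f i x)"
  by (induction I rule: infinite_finite_induct) (auto intro: degree_le.intros)

lemma degree_le_continuous_on: "degree_le n f \<Longrightarrow> continuous_on A f"
  by (induction rule: degree_le.induct) (auto intro!: continuous_intros)

lemma degree_le_borel [measurable]: "degree_le n f \<Longrightarrow> f \<in> borel_measurable borel"
  by (rule borel_measurable_continuous_onI) (rule degree_le_continuous_on)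

abbreviation dir_deriv :: "'a::euclidean_space \<Rightarrow> ('a \<Rightarrow> real) \<Rightarrow> 'a \<Rightarrow> real" where
  "dir_deriv v f \<equiv> (\<lambda>x. frechet_derivative f (at x) v)"

lemma dir_deriv_eqI: "(f has_derivative f') (at x) \<Longrightarrow> dir_deriv v f x = f' v"
  using frechet_derivative_at by force

lemma degree_le_differentiable: "degree_le n f \<Longrightarrow> f differentiable (at x)"
  by (induction rule: degree_le.induct)
     (auto intro: differentiable_add differentiable_mult bounded_linear_imp_differentiable
        bounded_linear_inner_left)

lemma degree_le_has_derivative:
  "degree_le n f \<Longrightarrow> (f has_derivative (\<lambda>v. dir_deriv v f x)) (at x)"
  using frechet_derivative_works degree_le_differentiable by blast

lemma degree_le_dir_deriv:
  assumes "degree_le n f"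
  shows "degree_le n (dir_deriv v f)"
  using assms
proof (induction rule: degree_le.induct)
  case (degree_le_const n c)
  then show ?case by (simp add: frechet_derivative_const degree_le.degree_le_const)
next
  case (degree_le_add n f g)
  have "dir_deriv v (\<lambda>x. f x + g x) = (\<lambda>x. dir_deriv v f x + dir_deriv v g x)"
    by (rule ext, rule dir_deriv_eqI)
       (intro derivative_intros degree_le_has_derivative[OF degree_le_add(1)] degree_le_has_derivative[OF degree_le_add(2)])
  with degree_le_add show ?case by (simp add: degree_le.degree_le_add)
next
  case (degree_le_inner_mult n f b)
  have "dir_deriv v (\<lambda>x. (x \<bullet> b) * f x) = (\<lambda>x. (x \<bullet> b) * dir_deriv v f x + (v \<bullet> b) * f x)"
    by (rule ext, rule dir_deriv_eqI)
       (auto intro!: derivative_eq_intros degree_le_has_derivative[OF degree_le_inner_mult(1)])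
  moreover have "degree_le (Suc n) (\<lambda>x. (x \<bullet> b) * dir_deriv v f x + (v \<bullet> b) * f x)"
    using degree_le_inner_mult by (intro degree_le.degree_le_add degree_le.degree_le_inner_mult degree_le_cmult degree_le_Suc) auto
  ultimately show ?case by simp
qed

lemma dir_deriv_linear: "degree_le n f \<Longrightarrow> linear (\<lambda>v. dir_deriv v f x)"
  using has_derivative_linear degree_le_has_derivative by blast

lemma dir_deriv_Basis_sum:
  assumes "degree_le n f"
  shows "dir_deriv v f x = (\<Sum>b\<in>Basis. (v \<bullet> b) * dir_deriv b f x)"
proof -
  have "dir_deriv v f x = dir_deriv (\<Sum>b\<in>Basis. (v \<bullet> b) *\<^sub>R b) f x"
    by (simp add: euclidean_representation)
  also have "\<dots> = (\<Sum>b\<in>Basis. (v \<bullet> b) * dir_deriv b f x)"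
    using dir_deriv_linear[OF assms, of x] by (simp add: linear_sum linear_cmul)
  finally show ?thesis .
qed

text \<open>
  A homogeneous polynomial function of degree \<open>l\<close> need not be presented as a sum of terms of degree
  at most \<open>l\<close>. Along every ray it is a one-variable polynomial whose \<open>k\<close>-th coefficient has degree
  at most \<open>k\<close>, and homogeneity leaves only the coefficient number \<open>l\<close>.
\<close>

lemma polynomial_on_rays:
  assumes "real_polynomial_function p"
  shows "\<exists>q. (\<forall>k. degree_le k (\<lambda>x. coeff (q x) k)) \<and> (\<forall>c x. p (c *\<^sub>R x) = poly (q x) c)"
  using assms
proof (induction rule: real_polynomial_function.induct)
  case (linear f)
  interpret bounded_linear f by fact
  have f: "f = (\<lambda>x. \<Sum>b\<in>Basis. f b * (x \<bullet> b))"
  proof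
    fix x
    have "f x = f (\<Sum>b\<in>Basis. (x \<bullet> b) *\<^sub>R b)" by (simp add: euclidean_representation)
    also have "\<dots> = (\<Sum>b\<in>Basis. f b * (x \<bullet> b))" by (simp add: sum scale mult.commute)
    finally show "f x = (\<Sum>b\<in>Basis. f b * (x \<bullet> b))" .
  qed
  have "degree_le (Suc 0) f"
    by (subst f) (intro degree_le_sum degree_le_cmult degree_le_inner)
  then have "degree_le k (\<lambda>x. coeff [:0, f x:] k)" for k
    by (cases k; cases "k - 1") (auto simp: coeff_pCons intro: degree_le_const)
  then show ?case
    by (intro exI[of _ "\<lambda>x. [:0, f x:]"]) (auto simp: scale)
next
  case (const c)
  then show ?case
    by (intro exI[of _ "\<lambda>x. [:c:]"]) (auto intro: degree_le_const)
next
  case (add f g)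
  then obtain q r where "\<forall>k. degree_le k (\<lambda>x. coeff (q x) k)" "\<forall>c x. f (c *\<^sub>R x) = poly (q x) c"
     "\<forall>k. degree_le k (\<lambda>x. coeff (r x) k)" "\<forall>c x. g (c *\<^sub>R x) = poly (r x) c" by blast
  then show ?case
    by (intro exI[of _ "\<lambda>x. q x + r x"]) (auto intro: degree_le_add)
next
  case (mult f g)
  then obtain q r where *: "\<forall>k. degree_le k (\<lambda>x. coeff (q x) k)" "\<forall>c x. f (c *\<^sub>R x) = poly (q x) c"
     "\<forall>k. degree_le k (\<lambda>x. coeff (r x) k)" "\<forall>c x. g (c *\<^sub>R x) = poly (r x) c" by blast
  have "degree_le k (\<lambda>x. coeff (q x * r x) k)" for k
    unfolding coeff_mult
  proof (rule degree_le_sum)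
    fix i assume "i \<in> {..k}"
    then have "i + (k - i) = k" by simp
    then show "degree_le k (\<lambda>x. coeff (q x) i * coeff (r x) (k - i))"
      using degree_le_mult[of i "\<lambda>x. coeff (q x) i" "k - i" "\<lambda>x. coeff (r x) (k - i)"] * by simp
  qed
  with * show ?case
    by (intro exI[of _ "\<lambda>x. q x * r x"]) auto
qed

lemma homogeneous_degree_le:
  assumes "real_polynomial_function p" "\<And>c x. p (c *\<^sub>R x) = c ^ l * p x"
  shows "degree_le l p"
proof -
  obtain q where q: "\<And>k. degree_le k (\<lambda>x. coeff (q x) k)" "\<And>c x. p (c *\<^sub>R x) = poly (q x) c"
    using polynomial_on_rays[OF assms(1)] by blast
  have "q x = monom (p x) l" for x
  proof -
    have "poly (q x) = poly (monom (p x) l)"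
      using q(2)[of _ x] assms(2)[of _ x] by (auto simp: poly_monom mult.commute)
    then show ?thesis by (simp add: poly_eq_poly_eq_iff)
  qed
  then have "(\<lambda>x. coeff (q x) l) = p" by auto
  then show ?thesis using q(1)[of l] by simp
qed

section \<open>Bernstein's inequality on great circles\<close>

text \<open>
  Trigonometric polynomials of degree \<open>N\<close>: after multiplication by \<open>z\<^sup>N\<close> they are algebraic
  polynomials in \<open>z = cis t\<close>, to which complex function theory applies.
\<close>

definition trig_poly :: "nat \<Rightarrow> (real \<Rightarrow> real) \<Rightarrow> bool" where
  "trig_poly N g \<longleftrightarrow> (\<exists>q :: complex poly. degree q \<le> 2 * N \<and>
     (\<forall>t. of_real (g t) = cis (- (real N * t)) * poly q (cis t)))"

lemma trig_poly_great_circle: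
  assumes "degree_le N f"
  shows "trig_poly N (\<lambda>t. f (cos t *\<^sub>R x + sin t *\<^sub>R v))"
  using assms
proof (induction rule: degree_le.induct)
  case (degree_le_const n c)
  have "cis (- (real n * t)) * cis t ^ n = 1" for t
    unfolding Complex.DeMoivre cis_mult by simp
  then have "complex_of_real c = cis (- (real n * t)) * poly (monom (of_real c) n) (cis t)" for t
    by (simp add: poly_monom mult.left_commute)
  moreover have "degree (monom (complex_of_real c) n) \<le> 2 * n"
    by (rule order.trans[OF degree_monom_le]) simp
  ultimately show ?case unfolding trig_poly_def by blast
next
  case (degree_le_add n f g)
  then obtain q r where
    "degree q \<le> 2 * n" "\<forall>t. of_real (f (cos t *\<^sub>R x + sin t *\<^sub>R v)) = cis (- (real n * t)) * poly q (cis t)"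
    "degree r \<le> 2 * n" "\<forall>t. of_real (g (cos t *\<^sub>R x + sin t *\<^sub>R v)) = cis (- (real n * t)) * poly r (cis t)"
    unfolding trig_poly_def by blast
  then show ?case unfolding trig_poly_def
    by (intro exI[of _ "q + r"]) (auto simp: degree_add_le algebra_simps)
next
  case (degree_le_inner_mult n f b)
  then obtain q where q:
    "degree q \<le> 2 * n" "\<And>t. of_real (f (cos t *\<^sub>R x + sin t *\<^sub>R v)) = cis (- (real n * t)) * poly q (cis t)"
    unfolding trig_poly_def by blast
  define A B where "A = of_real (x \<bullet> b) / (2::complex)" and "B = - \<i> * of_real (v \<bullet> b) / 2"
  \<comment> \<open>multiplying \<open>(x \<bullet> b) cos t + (v \<bullet> b) sin t\<close> by \<open>z = cis t\<close> gives \<open>A (z\<^sup>2 + 1) + B (z\<^sup>2 - 1)\<close>\<close>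
  define r where "r = [:A - B, 0, A + B:]"
  have r: "of_real ((cos t *\<^sub>R x + sin t *\<^sub>R v) \<bullet> b) = cis (- t) * poly r (cis t)" for t
  proof -
    have "cis (- t) * poly r (cis t) = cis (-t) * (A - B) + cis (-t) * cis t * cis t * (A + B)"
      by (simp add: r_def algebra_simps)
    also have "\<dots> = cis (-t) * (A - B) + cis t * (A + B)" by (simp add: cis_mult)
    also have "\<dots> = of_real (cos t) * of_real (x \<bullet> b) + of_real (sin t) * of_real (v \<bullet> b)"
      by (simp add: A_def B_def complex_eq_iff algebra_simps)
    finally show ?thesis by (simp add: inner_simps)
  qed
  have "degree r \<le> 2" by (simp add: r_def)
  then have "degree (r * q) \<le> 2 * Suc n"
    using degree_mult_le[of r q] q(1) by simp
  moreover have "of_real (((cos t *\<^sub>R x + sin t *\<^sub>R v) \<bullet> b) * f (cos t *\<^sub>R x + sin t *\<^sub>R v))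
      = cis (- (real (Suc n) * t)) * poly (r * q) (cis t)" for t
  proof -
    have "cis (- (real (Suc n) * t)) = cis (- t) * cis (- (real n * t))"
      by (simp add: cis_mult algebra_simps)
    then show ?thesis unfolding of_real_mult q(2) r by simp
  qed
  ultimately show ?case unfolding trig_poly_def by blast
qed

text \<open>
  Inside the disc this is the maximum modulus principle. Outside, the principle is applied to the
  reversed polynomial \<open>z ^ n * q (1 / z)\<close>.
\<close>

lemma poly_growth_off_unit_disc:
  fixes q :: "complex poly"
  assumes deg: "degree q \<le> n" and B: "\<And>z. norm z = 1 \<Longrightarrow> norm (poly q z) \<le> B"
    and w: "norm w \<le> R" "1 \<le> R"
  shows "norm (poly q w) \<le> B * R ^ n"
proof -
  have B0: "0 \<le> B" using order_trans[OF norm_ge_zero B[of 1]] by simp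
  have q_sum: "poly q z = (\<Sum>i\<le>n. coeff q i * z ^ i)" for z
    unfolding poly_altdef
    by (rule sum.mono_neutral_left) (use deg in \<open>auto simp: coeff_eq_0\<close>)
  show ?thesis
  proof (cases "norm w \<le> 1")
    case True
    have "norm (poly q w) \<le> B"
    proof (rule maximum_modulus_frontier[of "poly q" "cball 0 1"])
      show "poly q holomorphic_on interior (cball 0 1)" by (intro holomorphic_intros)
      show "continuous_on (closure (cball 0 1)) (poly q)" by (intro continuous_intros)
    qed (use True B in auto)
    also have "B \<le> B * R ^ n" using B0 one_le_power[OF w(2), of n] by (simp add: mult_le_cancel_left1)
    finally show ?thesis .
  next
    case False
    then have w0: "w \<noteq> 0" by auto
    define r where "r = (\<lambda>z. \<Sum>i\<le>n. coeff q i * z ^ (n - i))"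
    have r: "r z = z ^ n * poly q (inverse z)" if "z \<noteq> 0" for z
      unfolding r_def q_sum sum_distrib_left
      by (rule sum.cong) (use that in \<open>simp_all add: power_diff power_inverse divide_inverse\<close>)
    have "norm (r (inverse w)) \<le> B"
    proof (rule maximum_modulus_frontier[of r "cball 0 1"])
      show "r holomorphic_on interior (cball 0 1)" unfolding r_def by (intro holomorphic_intros)
      show "continuous_on (closure (cball 0 1)) r" unfolding r_def by (intro continuous_intros)
      show "norm (r z) \<le> B" if "z \<in> frontier (cball 0 1)" for z
      proof -
        have "norm z = 1" using that by simp
        moreover from this have "z \<noteq> 0" by auto
        ultimately show ?thesis using B[of "inverse z"] r[of z]
          by (simp add: norm_mult norm_power norm_inverse)
      qed
    qed (use False in \<open>auto simp: norm_inverse inverse_le_1_iff\<close>)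
    moreover have "poly q w = w ^ n * r (inverse w)"
      using r[of "inverse w"] w0 by (simp add: power_inverse)
    ultimately have "norm (poly q w) \<le> norm w ^ n * B"
      by (simp add: norm_mult norm_power mult_left_mono)
    also have "\<dots> \<le> R ^ n * B" using w B0 by (intro mult_right_mono power_mono) auto
    finally show ?thesis by (simp add: mult.commute)
  qed
qed

text \<open>
  Bernstein's inequality, up to the constant 7: \<open>z\<^sup>N\<close> times the trigonometric polynomial is an
  algebraic polynomial of degree \<open>2N\<close>, which grows by at most the factor
  \<open>(1 + 1 / 2N)\<^bsup>2N\<^esup> \<le> 3\<close> when one moves the distance \<open>1 / 2N\<close> away from the unit circle, so that
  Cauchy's estimate on circles of this radius bounds its derivative.
\<close>

lemma bernstein_trig:
  assumes "trig_poly N g" and N: "N \<ge> 1" and B: "\<And>t. \<bar>g t\<bar> \<le> B"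
  shows "\<exists>g'. (g has_real_derivative g') (at t) \<and> \<bar>g'\<bar> \<le> 7 * real N * B"
proof -
  obtain q where q: "degree q \<le> 2 * N"
    "\<And>t. of_real (g t) = cis (- (real N * t)) * poly q (cis t)"
    using assms(1) unfolding trig_poly_def by blast
  have qB: "norm (poly q z) \<le> B" if z: "norm z = 1" for z
  proof -
    have "z = cis (Arg z)"
      using cis_Arg[of z] z by (metis norm_zero sgn_div_norm inverse_1 scaleR_one zero_neq_one)
    then have "norm (poly q z) = norm (of_real (g (Arg z)) :: complex)"
      using q(2)[of "Arg z"] by (simp add: norm_mult)
    then show ?thesis using B by simp
  qed
  define z where "z = cis t"
  have B0: "0 \<le> B" using B[of 0] by linarith
  have "norm ((deriv ^^ 1) (poly q) z) \<le> fact 1 * (B * 3) / (1 / (2 * real N)) ^ 1"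
  proof (rule Cauchy_inequality)
    show "poly q holomorphic_on ball z (1 / (2 * real N))" by (intro holomorphic_intros)
    show "continuous_on (cball z (1 / (2 * real N))) (poly q)" by (intro continuous_intros)
    show "0 < 1 / (2 * real N)" using N by simp
    fix w assume "norm (z - w) = 1 / (2 * real N)"
    then have "norm w \<le> norm z + 1 / (2 * real N)"
      by (metis norm_minus_commute norm_triangle_sub)
    then have "norm w \<le> 1 + 1 / real (2 * N)" by (simp add: z_def)
    then have "norm (poly q w) \<le> B * (1 + 1 / real (2 * N)) ^ (2 * N)"
      by (intro poly_growth_off_unit_disc q qB) auto
    also have "(1 + 1 / real (2 * N)) ^ (2 * N) \<le> exp 1"
      using exp_ge_one_plus_x_over_n_power_n[of "2 * N" 1] N by simp
    also have "exp 1 \<le> (3::real)" by (rule exp_le)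
    finally show "norm (poly q w) \<le> B * 3" using B0 by (simp add: mult_left_mono)
  qed
  then have qd: "norm (poly (pderiv q) z) \<le> 6 * N * B"
    by (simp add: field_simps DERIV_imp_deriv[OF poly_DERIV])
  define G where "G = (\<lambda>s::real. cis (- (real N * s)) * poly q (cis s))"
  define G' where "G' = (- \<i> * real N) * cis (- (real N * t)) * poly q z
      + cis (- (real N * t)) * (poly (pderiv q) z * (\<i> * cis t))"
  have cis_d: "((\<lambda>s. cis (a * s)) has_vector_derivative (\<i> * a * cis (a * t))) (at t)" for a
  proof -
    have "((\<lambda>s. exp (\<i> * (a * s))) has_field_derivative (\<i> * a * exp (\<i> * (a * t))))
        (at (complex_of_real t))"
      by (auto intro!: derivative_eq_intros)
    from has_vector_derivative_real_field[OF this] show ?thesis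
      by (simp add: cis_conv_exp o_def)
  qed
  have "(G has_vector_derivative G') (at t)"
  proof -
    have 1: "((\<lambda>s. poly q (cis s)) has_vector_derivative (\<i> * cis t * poly (pderiv q) z)) (at t)"
      using field_vector_diff_chain_at[of cis "\<i> * cis t" t "poly q" "poly (pderiv q) (cis t)"]
        cis_d[of 1] poly_DERIV by (auto simp: o_def z_def)
    have 2: "((\<lambda>s. cis (- (real N * s))) has_vector_derivative (- \<i> * real N * cis (- (real N * t)))) (at t)"
      using cis_d[of "- real N"] by simp
    show ?thesis unfolding G_def G'_def
      using has_vector_derivative_mult[OF 2 1] by (simp add: z_def algebra_simps)
  qed
  moreover have "g = (\<lambda>s. Re (G s))" using q(2) unfolding G_def by (metis Re_complex_of_real)
  ultimately have "(g has_real_derivative Re G') (at t)"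
    unfolding has_real_derivative_iff_has_vector_derivative
    using bounded_linear.has_vector_derivative[OF bounded_linear_Re] by simp
  moreover have "\<bar>Re G'\<bar> \<le> 7 * real N * B"
  proof -
    have "norm G' \<le> real N * norm (poly q z) + norm (poly (pderiv q) z)"
      unfolding G'_def by (rule norm_triangle_le) (simp add: norm_mult)
    also have "\<dots> \<le> real N * B + 6 * N * B"
      using qd qB[of z] by (intro add_mono mult_left_mono) (auto simp: z_def)
    finally show ?thesis using abs_Re_le_cmod[of G'] by (simp add: mult.assoc mult.commute[of B])
  qed
  ultimately show ?thesis by blast
qed

lemma great_circle_unit:
  assumes "norm x = 1" "norm v = 1" "x \<bullet> v = 0"
  shows "norm (cos t *\<^sub>R x + sin t *\<^sub>R v) = 1"
proof -
  have "(cos t *\<^sub>R x + sin t *\<^sub>R v) \<bullet> (cos t *\<^sub>R x + sin t *\<^sub>R v) = (cos t)\<^sup>2 * (x \<bullet> x) + (sin t)\<^sup>2 * (v \<bullet> v)"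
    using assms(3) by (simp add: inner_simps inner_commute[of v x] power2_eq_square)
  also have "\<dots> = 1" using assms by (simp add: dot_square_norm)
  finally show ?thesis by (simp add: norm_eq_sqrt_inner)
qed

lemma great_circle_through:
  fixes x y :: "'a::euclidean_space"
  assumes dim: "DIM('a) \<ge> 2" and x: "norm x = 1" and y: "norm y = 1"
  obtains v where "norm v = 1" "x \<bullet> v = 0"
    "y = cos (geodist x y) *\<^sub>R x + sin (geodist x y) *\<^sub>R v"
proof -
  define c where "c = x \<bullet> y"
  have c: "\<bar>c\<bar> \<le> 1" using Cauchy_Schwarz_ineq2[of x y] x y by (simp add: c_def)
  have cos: "cos (geodist x y) = c" using c by (simp add: geodist_def c_def)
  have sin: "sin (geodist x y) = sqrt (1 - c\<^sup>2)"
    using c by (simp add: geodist_def c_def sin_arccos)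
  define w where "w = y - c *\<^sub>R x"
  have xx: "x \<bullet> x = 1" and yy: "y \<bullet> y = 1" using x y by (simp_all add: dot_square_norm)
  have xw: "x \<bullet> w = 0" using xx by (simp add: w_def inner_simps c_def)
  have ww: "w \<bullet> w = 1 - c\<^sup>2"
    using xx yy by (simp add: w_def inner_simps c_def[symmetric] inner_commute[of y x] power2_eq_square)
  then have nw: "norm w = sqrt (1 - c\<^sup>2)" by (simp add: norm_eq_sqrt_inner)
  show thesis
  proof (cases "w = 0")
    case True
    \<comment> \<open>if the points are equal or antipodal, every direction orthogonal to \<open>x\<close> will do,
        and one exists because \<open>d \<ge> 2\<close>\<close>
    obtain u where u: "u \<noteq> 0" "orthogonal x u"
      using orthogonal_to_vector_exists[OF dim, of x] by blast
    have "y = c *\<^sub>R x" using True by (simp add: w_def)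
    moreover have "sin (geodist x y) = 0" using True nw sin by simp
    ultimately have "y = cos (geodist x y) *\<^sub>R x + sin (geodist x y) *\<^sub>R (u /\<^sub>R norm u)"
      unfolding cos by simp
    with u show thesis
      by (intro that[of "u /\<^sub>R norm u"]) (auto simp: orthogonal_def)
  next
    case False
    show thesis
      by (rule that[of "w /\<^sub>R norm w"])
         (use False xw in \<open>auto simp: cos sin nw[symmetric] w_def\<close>)
  qed
qed

lemma geodist_nonneg: "norm x = 1 \<Longrightarrow> norm y = 1 \<Longrightarrow> 0 \<le> geodist x y"
  unfolding geodist_def using Cauchy_Schwarz_ineq2[of x y] by (intro arccos_lbound) auto

text \<open>Bernstein's inequality, integrated along a great circle through the two points.\<close>

lemma degree_le_lipschitz:
  fixes f :: "'a::euclidean_space \<Rightarrow> real"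
  assumes dim: "DIM('a) \<ge> 2" and f: "degree_le N f" "N \<ge> 1"
    and B: "\<And>x. norm x = 1 \<Longrightarrow> \<bar>f x\<bar> \<le> B" and x: "norm x = 1" and y: "norm y = 1"
  shows "\<bar>f x - f y\<bar> \<le> 7 * real N * B * geodist x y"
proof -
  obtain v where v: "norm v = 1" "x \<bullet> v = 0"
    "y = cos (geodist x y) *\<^sub>R x + sin (geodist x y) *\<^sub>R v"
    using great_circle_through[OF dim x y] .
  define g where "g = (\<lambda>t. f (cos t *\<^sub>R x + sin t *\<^sub>R v))"
  have "\<exists>g'. (g has_real_derivative g') (at t) \<and> \<bar>g'\<bar> \<le> 7 * real N * B" for t
    unfolding g_def
    by (rule bernstein_trig[OF trig_poly_great_circle[OF f(1)] f(2)])
       (use B great_circle_unit[OF x v(1,2)] in auto)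
  then obtain g' where g': "\<And>t. (g has_real_derivative g' t) (at t)" "\<And>t. \<bar>g' t\<bar> \<le> 7 * real N * B"
    by metis
  have "norm (g (geodist x y) - g 0) \<le> 7 * real N * B * norm (geodist x y - 0)"
    by (rule field_differentiable_bound[of UNIV g g'])
       (use g' in \<open>auto intro: has_field_derivative_at_within\<close>)
  moreover have "g 0 = f x" "g (geodist x y) = f y" using v(3) by (auto simp: g_def)
  ultimately show ?thesis using geodist_nonneg[OF x y] by (simp add: abs_minus_commute)
qed

text \<open>
  Only tangential derivatives can be bounded by values on the sphere, as the polynomial may vanish
  there without vanishing nearby.
\<close>

lemma degree_le_tangential_bound:
  fixes f :: "'a::euclidean_space \<Rightarrow> real"
  assumes f: "degree_le N f" "N \<ge> 1" and B: "\<And>x. norm x = 1 \<Longrightarrow> \<bar>f x\<bar> \<le> B"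
    and x: "norm x = 1" and v: "x \<bullet> v = 0"
  shows "\<bar>dir_deriv v f x\<bar> \<le> 7 * real N * B * norm v"
proof (cases "v = 0")
  case True
  then show ?thesis using linear_0[OF dir_deriv_linear[OF f(1), of x]] by simp
next
  case False
  define u where "u = v /\<^sub>R norm v"
  have u: "norm u = 1" "x \<bullet> u = 0" using False v by (auto simp: u_def)
  define g where "g = (\<lambda>t. f (cos t *\<^sub>R x + sin t *\<^sub>R u))"
  obtain g' where g': "(g has_real_derivative g') (at 0)" "\<bar>g'\<bar> \<le> 7 * real N * B"
    unfolding g_def
    using bernstein_trig[OF trig_poly_great_circle[OF f(1)] f(2), of x u B 0] B great_circle_unit[OF x u]
    by auto
  have c: "((\<lambda>t. cos t *\<^sub>R x + sin t *\<^sub>R u) has_derivative (\<lambda>s. s *\<^sub>R u)) (at 0)"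
    by (auto intro!: derivative_eq_intros)
  have "(g has_derivative (\<lambda>s. dir_deriv (s *\<^sub>R u) f x)) (at 0)"
    unfolding g_def using has_derivative_compose[OF c, of f "\<lambda>v. dir_deriv v f x"] degree_le_has_derivative[OF f(1), of x]
    by simp
  moreover have "(\<lambda>s. dir_deriv (s *\<^sub>R u) f x) = (*) (dir_deriv u f x)"
    using linear_cmul[OF dir_deriv_linear[OF f(1), of x]] by (auto simp: mult.commute)
  ultimately have "(g has_real_derivative (dir_deriv u f x)) (at 0)"
    by (simp add: has_field_derivative_def)
  then have "g' = dir_deriv u f x" using g'(1) DERIV_unique by blast
  moreover have "dir_deriv v f x = norm v * dir_deriv u f x"
    using linear_cmul[OF dir_deriv_linear[OF f(1), of x], of "norm v" u] False by (simp add: u_def)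
  ultimately show ?thesis
    using g'(2) mult_left_mono[OF g'(2), of "norm v"] by (simp add: abs_mult mult.commute)
qed

section \<open>Derivatives of the homogeneous extension of a polynomial\<close>

text \<open>
  The polynomial that agrees on the sphere with the derivative in direction \<open>i\<close> of the function
  \<open>x \<mapsto> Q (sgn x) / norm x ^ k\<close>. It is the tangential part of the derivative of \<open>Q\<close>, corrected by the
  derivative of the factor \<open>norm x ^ (-k)\<close>.
\<close>

definition sph_deriv :: "nat \<Rightarrow> 'a::euclidean_space \<Rightarrow> ('a \<Rightarrow> real) \<Rightarrow> 'a \<Rightarrow> real" where
  "sph_deriv k i Q = (\<lambda>x. dir_deriv i Q x - (x \<bullet> i) * (\<Sum>b\<in>Basis. (x \<bullet> b) * dir_deriv b Q x)
     - real k * ((x \<bullet> i) * Q x))"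

lemma degree_le_sph_deriv:
  assumes "degree_le N Q"
  shows "degree_le (N + 2) (sph_deriv k i Q)"
proof -
  have "degree_le (Suc (Suc N)) (\<lambda>x. (x \<bullet> i) * (\<Sum>b\<in>Basis. (x \<bullet> b) * dir_deriv b Q x))"
    by (intro degree_le_inner_mult degree_le_sum degree_le_dir_deriv assms)
  moreover have "degree_le (Suc (Suc N)) (\<lambda>x. (x \<bullet> i) * Q x)"
    by (intro degree_le_inner_mult degree_le_Suc assms)
  moreover have "degree_le (Suc (Suc N)) (dir_deriv i Q)" by (intro degree_le_Suc degree_le_dir_deriv assms)
  ultimately show ?thesis unfolding sph_deriv_def
    by (auto intro!: degree_le_diff degree_le_cmult)
qed

lemma sph_deriv_alt:
  assumes "degree_le N Q"
  shows "sph_deriv k i Q x = dir_deriv (i - (x \<bullet> i) *\<^sub>R x) Q x - real k * ((x \<bullet> i) * Q x)"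
  using dir_deriv_Basis_sum[OF assms, of x x] linear_diff[OF dir_deriv_linear[OF assms, of x]]
    linear_cmul[OF dir_deriv_linear[OF assms, of x]] by (simp add: sph_deriv_def)

lemma sph_deriv_bound:
  assumes "degree_le N Q" "N \<ge> 1" and B: "\<And>x. norm x = 1 \<Longrightarrow> \<bar>Q x\<bar> \<le> B"
    and x: "norm x = 1" and i: "i \<in> Basis"
  shows "\<bar>sph_deriv k i Q x\<bar> \<le> (7 * real N + real k) * B"
proof -
  define v where "v = i - (x \<bullet> i) *\<^sub>R x"
  have B0: "0 \<le> B" using B[OF x] by linarith
  have ii: "i \<bullet> i = 1" "x \<bullet> x = 1" using x i by (auto simp: dot_square_norm)
  have "x \<bullet> v = 0" using ii by (simp add: v_def inner_simps)
  have "v \<bullet> v = 1 - (x \<bullet> i)\<^sup>2"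
    using ii by (simp add: v_def inner_simps power2_eq_square inner_commute[of i x])
  then have nv: "norm v \<le> 1" by (simp add: norm_eq_sqrt_inner)
  have xi: "\<bar>x \<bullet> i\<bar> \<le> 1" using Basis_le_norm[OF i, of x] x by simp
  have "\<bar>dir_deriv v Q x\<bar> \<le> 7 * real N * B * norm v"
    by (rule degree_le_tangential_bound[OF assms(1,2) B x \<open>x \<bullet> v = 0\<close>])
  also have "\<dots> \<le> 7 * real N * B * 1" using nv B0 by (intro mult_left_mono) auto
  finally have 1: "\<bar>dir_deriv v Q x\<bar> \<le> 7 * real N * B" by simp
  have "\<bar>(x \<bullet> i) * Q x\<bar> \<le> 1 * B"
    unfolding abs_mult by (intro mult_mono xi B x) auto
  then have "\<bar>real k * ((x \<bullet> i) * Q x)\<bar> \<le> real k * B" by (simp add: abs_mult mult_left_mono)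
  with 1 show ?thesis
    unfolding sph_deriv_alt[OF assms(1)] v_def[symmetric] by (simp add: algebra_simps)
qed

lemma sgn_has_derivative:
  fixes x :: "'a::euclidean_space"
  assumes "x \<noteq> 0"
  shows "(sgn has_derivative (\<lambda>h. (h - (sgn x \<bullet> h) *\<^sub>R sgn x) /\<^sub>R norm x)) (at x)"
proof -
  have "((\<lambda>x. x /\<^sub>R norm x) has_derivative (\<lambda>h. (h - (sgn x \<bullet> h) *\<^sub>R sgn x) /\<^sub>R norm x)) (at x)"
    using assms
    by (auto intro!: derivative_eq_intros has_derivative_norm
        simp: sgn_div_norm algebra_simps inner_commute power2_eq_square)
  then show ?thesis by (simp add: sgn_div_norm[abs_def])
qed

text \<open>
  Differentiating the extension of \<open>Q\<close> that is homogeneous of degree \<open>-k\<close> gives extensions that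
  are homogeneous of degree \<open>-(k+1)\<close>, of polynomials again. Thus bounds on polynomials on the
  sphere are all that is needed to control derivatives of any order.
\<close>

lemma hom_ext_poly_has_derivative:
  fixes Q :: "'a::euclidean_space \<Rightarrow> real"
  assumes Q: "degree_le N Q" and x: "x \<noteq> 0"
  shows "((\<lambda>x. Q (sgn x) / norm x ^ k) has_derivative
     (\<lambda>h. \<Sum>i\<in>Basis. (h \<bullet> i) * (sph_deriv k i Q (sgn x) / norm x ^ Suc k))) (at x)"
proof -
  define s where "s = sgn x"
  let ?n = "norm x"
  have n0: "?n \<noteq> 0" using x by simp
  have 1: "((\<lambda>x. Q (sgn x)) has_derivative (\<lambda>h. dir_deriv ((h - (s \<bullet> h) *\<^sub>R s) /\<^sub>R ?n) Q s)) (at x)"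
    using has_derivative_compose[OF sgn_has_derivative[OF x] degree_le_has_derivative[OF Q]]
    by (simp add: s_def)
  have 2: "((\<lambda>x. inverse (norm x) ^ k) has_derivative
      (\<lambda>h. - real k * (s \<bullet> h) * inverse ?n ^ Suc k)) (at x)"
  proof -
    have "((\<lambda>x. inverse (norm x)) has_derivative (\<lambda>h. - (s \<bullet> h) * inverse ?n ^ 2)) (at x)"
      using Deriv.has_derivative_inverse[OF n0 has_derivative_norm[OF x]]
      by (simp add: s_def power2_eq_square inner_commute mult_ac)
    from has_derivative_power[OF this, of k] show ?thesis
      by (rule has_derivative_eq_rhs) (cases k; simp add: fun_eq_iff power2_eq_square algebra_simps)
  qed
  have "((\<lambda>x. Q (sgn x) * inverse (norm x) ^ k) has_derivative
      (\<lambda>h. Q s * (- real k * (s \<bullet> h) * inverse ?n ^ Suc k)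
          + dir_deriv ((h - (s \<bullet> h) *\<^sub>R s) /\<^sub>R ?n) Q s * inverse ?n ^ k)) (at x)"
    using has_derivative_mult[OF 1 2] by (simp add: s_def)
  moreover have "Q s * (- real k * (s \<bullet> h) * inverse ?n ^ Suc k)
          + dir_deriv ((h - (s \<bullet> h) *\<^sub>R s) /\<^sub>R ?n) Q s * inverse ?n ^ k
      = (\<Sum>i\<in>Basis. (h \<bullet> i) * (sph_deriv k i Q s / ?n ^ Suc k))" for h
  proof -
    define E where "E = (\<Sum>b\<in>Basis. (s \<bullet> b) * dir_deriv b Q s)"
    have sh: "s \<bullet> h = (\<Sum>i\<in>Basis. (h \<bullet> i) * (s \<bullet> i))"
      by (subst euclidean_inner) (simp add: mult.commute)
    have "(\<Sum>i\<in>Basis. (h \<bullet> i) * (sph_deriv k i Q s / ?n ^ Suc k))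
      = (\<Sum>i\<in>Basis. (h \<bullet> i) * dir_deriv i Q s - (h \<bullet> i) * (s \<bullet> i) * (E + real k * Q s)) / ?n ^ Suc k"
      unfolding sum_divide_distrib
      by (rule sum.cong) (auto simp: sph_deriv_def E_def algebra_simps diff_divide_distrib)
    also have "\<dots> = (dir_deriv h Q s - (s \<bullet> h) * (E + real k * Q s)) / ?n ^ Suc k"
      unfolding dir_deriv_Basis_sum[OF Q, of s h] sh sum_distrib_right sum_subtractf ..
    also have "\<dots> = Q s * (- real k * (s \<bullet> h) * inverse ?n ^ Suc k)
          + dir_deriv ((h - (s \<bullet> h) *\<^sub>R s) /\<^sub>R ?n) Q s * inverse ?n ^ k"
    proof -
      have "dir_deriv ((h - (s \<bullet> h) *\<^sub>R s) /\<^sub>R ?n) Q s = (dir_deriv h Q s - (s \<bullet> h) * E) / ?n"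
        using linear_cmul[OF dir_deriv_linear[OF Q, of s]] linear_diff[OF dir_deriv_linear[OF Q, of s]]
          dir_deriv_Basis_sum[OF Q, of s s] by (simp add: E_def divide_inverse mult.commute)
      then show ?thesis
        unfolding power_inverse divide_inverse power_Suc inverse_mult_distrib by algebra
    qed
    finally show ?thesis by simp
  qed
  ultimately show ?thesis by (simp add: s_def divide_inverse power_inverse)
qed

primrec sph_derivs :: "'a::euclidean_space list \<Rightarrow> ('a \<Rightarrow> real) \<Rightarrow> 'a \<Rightarrow> real" where
  "sph_derivs [] Q = Q"
| "sph_derivs (i # js) Q = sph_deriv (length js) i (sph_derivs js Q)"

lemma degree_le_sph_derivs: "degree_le N Q \<Longrightarrow> degree_le (N + 2 * length js) (sph_derivs js Q)"
proof (induction js)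
  case (Cons i js)
  then show ?case using degree_le_sph_deriv[OF Cons(1)[OF Cons(2)]] by (simp add: add.commute add.left_commute)
qed simp

text \<open>
  \<open>k\<close> derivatives of a polynomial of degree \<open>N\<close> cost a factor of order \<open>N ^ k\<close>. Since each derivative
  raises the degree by 2, the constant depends on \<open>k\<close>.
\<close>

lemma sph_derivs_bound:
  assumes Q: "degree_le N Q" "N \<ge> 1" and B: "\<And>x. norm x = 1 \<Longrightarrow> \<bar>Q x\<bar> \<le> B"
    and js: "set js \<subseteq> Basis" "length js \<le> k" and x: "norm x = 1"
  shows "\<bar>sph_derivs js Q x\<bar> \<le> ((7 + 15 * real k) * real N) ^ length js * B"
  using js x
proof (induction js arbitrary: x)
  case Nil
  then show ?case using B by simp
next
  case (Cons i js)
  have B0: "0 \<le> B" using B[OF Cons(4)] by linarith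
  let ?n = "length js" and ?A = "(7 + 15 * real k) * real N"
  have "\<bar>sph_deriv ?n i (sph_derivs js Q) x\<bar> \<le> (7 * real (N + 2 * ?n) + real ?n) * (?A ^ ?n * B)"
    using Cons Q(2) by (intro sph_deriv_bound degree_le_sph_derivs[OF Q(1)]) auto
  also have "\<dots> \<le> ?A * (?A ^ ?n * B)"
  proof (rule mult_right_mono)
    have "real ?n \<le> real k" using Cons(3) by simp
    also have "\<dots> \<le> real k * real N" using Q(2) by (simp add: mult_le_cancel_left1)
    finally show "7 * real (N + 2 * ?n) + real ?n \<le> ?A" by (simp add: algebra_simps)
  qed (use B0 in simp)
  finally show ?case by simp
qed

section \<open>Regularity of sums of dyadic blocks\<close>

text \<open>
  Block number \<open>j\<close> has degree at most \<open>2 ^ (j + 1)\<close> and decays like \<open>2 ^ (- \<gamma> j)\<close> for each \<open>\<gamma> < s\<close>. By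
  Bernstein's inequality each derivative costs a factor \<open>2 ^ j\<close>, so that the series may be
  differentiated term by term as long as the order stays below \<open>s\<close>.
\<close>

locale dyadic_series =
  fixes P :: "nat \<Rightarrow> 'a::euclidean_space \<Rightarrow> real" and s :: real
  assumes deg: "degree_le (2 ^ Suc j) (P j)"
    and decay: "\<gamma> < s \<Longrightarrow> \<exists>C. \<forall>j x. norm x = 1 \<longrightarrow> \<bar>P j x\<bar> \<le> C * 2 powr (- (\<gamma> * real j))"
begin

text \<open>The iterated partial derivative along \<open>js\<close> of the homogeneous extension of block \<open>j\<close>.\<close>

definition deriv_term :: "'a list \<Rightarrow> nat \<Rightarrow> 'a \<Rightarrow> real" where
  "deriv_term js j x = sph_derivs js (P j) (sgn x) / norm x ^ length js"

definition deriv_series :: "'a list \<Rightarrow> 'a \<Rightarrow> real" where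
  "deriv_series js x = (\<Sum>j. deriv_term js j x)"

lemma sph_derivs_decay:
  assumes js: "set js \<subseteq> Basis" and g: "\<gamma> < s"
  shows "\<exists>C\<ge>0. \<forall>j x. norm x = 1 \<longrightarrow>
    \<bar>sph_derivs js (P j) x\<bar> \<le> C * 2 powr ((real (length js) - \<gamma>) * real j)"
proof -
  obtain C where C: "\<And>j x. norm x = 1 \<Longrightarrow> \<bar>P j x\<bar> \<le> C * 2 powr (- (\<gamma> * real j))"
    using decay[OF g] by blast
  let ?n = "length js"
  define K where "K = (2 * (7 + 15 * real ?n)) ^ ?n * \<bar>C\<bar>"
  have "\<bar>sph_derivs js (P j) x\<bar> \<le> K * 2 powr ((real ?n - \<gamma>) * real j)" if x: "norm x = 1" for j x
  proof -
    have "\<bar>sph_derivs js (P j) x\<bar>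
        \<le> ((7 + 15 * real ?n) * real (2 ^ Suc j)) ^ ?n * (\<bar>C\<bar> * 2 powr (- (\<gamma> * real j)))"
    proof (rule sph_derivs_bound[OF deg _ _ js _ x])
      show "\<bar>P j y\<bar> \<le> \<bar>C\<bar> * 2 powr (- (\<gamma> * real j))" if "norm y = 1" for y
        using C[OF that, of j] by (rule order_trans) (simp add: mult_right_mono)
    qed auto
    also have "(7 + 15 * real ?n) * real (2 ^ Suc j) = (2 * (7 + 15 * real ?n)) * 2 ^ j" by simp
    also have "\<dots> ^ ?n * (\<bar>C\<bar> * 2 powr (- (\<gamma> * real j))) = K * (2 ^ j) ^ ?n * 2 powr (- (\<gamma> * real j))"
      unfolding K_def power_mult_distrib[of _ "2 ^ j"] by (simp only: mult_ac)
    also have "(2 ^ j) ^ ?n = (2::real) powr (real ?n * real j)"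
      by (simp add: powr_realpow[symmetric] powr_powr mult.commute power_mult[symmetric])
    finally show ?thesis
      by (simp add: mult.assoc powr_add[symmetric] left_diff_distrib)
  qed
  moreover have "0 \<le> K" by (simp add: K_def)
  ultimately show ?thesis by blast
qed

lemma summable_geometric_powr:
  assumes "a < 0"
  shows "summable (\<lambda>j. C * 2 powr (a * real j))"
proof -
  have "2 powr (a * real j) = (2 powr a) ^ j" for j
    by (simp add: powr_powr[symmetric] powr_realpow)
  moreover have "2 powr a < 1" using assms by (simp add: powr_less_one)
  ultimately show ?thesis by (simp add: summable_geometric summable_mult)
qed

lemma sph_derivs_summable_bound:
  assumes js: "set js \<subseteq> Basis" "real (length js) < s"
  obtains M where "summable M" "\<And>j x. norm x = 1 \<Longrightarrow> \<bar>sph_derivs js (P j) x\<bar> \<le> M j"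
proof -
  obtain \<gamma> where \<gamma>: "real (length js) < \<gamma>" "\<gamma> < s" using dense js(2) by blast
  obtain C where C: "\<And>j x. norm x = 1 \<Longrightarrow>
      \<bar>sph_derivs js (P j) x\<bar> \<le> C * 2 powr ((real (length js) - \<gamma>) * real j)"
    using sph_derivs_decay[OF js(1) \<gamma>(2)] by blast
  show thesis
    by (rule that[OF summable_geometric_powr C]) (use \<gamma> in auto)
qed

lemma norm_sgn_unit: "x \<noteq> 0 \<Longrightarrow> norm (sgn x) = 1" for x :: 'a
  by (simp add: norm_sgn)

lemma deriv_term_summable_bound:
  assumes js: "set js \<subseteq> Basis" "real (length js) < s" and r: "0 < r"
  obtains M where "summable M" "\<And>j x. r \<le> norm x \<Longrightarrow> norm (deriv_term js j x) \<le> M j"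
proof -
  obtain M where M: "summable M" "\<And>j x. norm x = 1 \<Longrightarrow> \<bar>sph_derivs js (P j) x\<bar> \<le> M j"
    using sph_derivs_summable_bound[OF js] by blast
  have "norm (deriv_term js j x) \<le> M j / r ^ length js" if "r \<le> norm x" for j x
  proof -
    have "norm (sgn x) = 1" using r that by (intro norm_sgn_unit) auto
    then have "\<bar>sph_derivs js (P j) (sgn x)\<bar> / norm x ^ length js \<le> M j / r ^ length js"
      using M(2)[of "sgn x" j] r that abs_ge_zero[of "sph_derivs js (P j) (sgn x)"]
      by (intro frac_le power_mono) auto
    then show ?thesis by (simp add: deriv_term_def)
  qed
  with M(1) show thesis by (intro that[of "\<lambda>j. M j / r ^ length js"] summable_divide)
qed

lemma deriv_series_uniform:
  assumes js: "set js \<subseteq> Basis" "real (length js) < s" and r: "0 < r" "\<And>x. x \<in> A \<Longrightarrow> r \<le> norm x"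
  shows "uniform_limit A (\<lambda>n x. \<Sum>j<n. deriv_term js j x) (deriv_series js) sequentially"
proof -
  obtain M where M: "summable M" "\<And>j x. r \<le> norm x \<Longrightarrow> norm (deriv_term js j x) \<le> M j"
    using deriv_term_summable_bound[OF js r(1)] by blast
  show ?thesis
    unfolding deriv_series_def by (rule Weierstrass_m_test[OF _ M(1)]) (use M(2) r(2) in auto)
qed

lemma deriv_series_sums:
  assumes js: "set js \<subseteq> Basis" "real (length js) < s" and x: "x \<noteq> 0"
  shows "(\<lambda>j. deriv_term js j x) sums deriv_series js x"
  using tendsto_uniform_limitI[OF deriv_series_uniform[OF js, of "norm x" "{x}"]] x
  by (simp add: sums_def)

lemma deriv_term_has_derivative:
  "x \<noteq> 0 \<Longrightarrow> (deriv_term js j has_derivative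
     (\<lambda>h. \<Sum>i\<in>Basis. (h \<bullet> i) * deriv_term (i # js) j x)) (at x)"
  using hom_ext_poly_has_derivative[OF degree_le_sph_derivs[OF deg], where x = x and k = "length js"]
  unfolding deriv_term_def[abs_def] by (simp add: length_Cons)

lemma half_ball_norm: "norm x / 2 \<le> norm y" if "y \<in> ball x (norm x / 2)" for x y :: 'a
  using that norm_triangle_ineq2[of x y] by (simp add: dist_norm)

lemma deriv_series_continuous:
  assumes js: "set js \<subseteq> Basis" "real (length js) < s"
  shows "continuous_on (- {0}) (deriv_series js)"
proof -
  have "isCont (deriv_series js) x" if x: "x \<noteq> 0" for x
  proof -
    let ?B = "ball x (norm x / 2)"
    have "continuous_on ?B (deriv_series js)"
    proof (rule uniform_limit_theorem)
      show "uniform_limit ?B (\<lambda>n x. \<Sum>j<n. deriv_term js j x) (deriv_series js) sequentially"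
        by (rule deriv_series_uniform[OF js, of "norm x / 2"]) (use x half_ball_norm in auto)
      have "isCont (deriv_term js j) y" if "y \<in> ?B" for j y
        using half_ball_norm[OF that] x
        by (intro has_derivative_continuous[OF deriv_term_has_derivative]) auto
      then show "\<forall>\<^sub>F n in sequentially. continuous_on ?B (\<lambda>x. \<Sum>j<n. deriv_term js j x)"
        by (intro always_eventually allI continuous_on_sum) (simp add: continuous_at_imp_continuous_on)
    qed simp
    then show ?thesis using x by (simp add: continuous_on_eq_continuous_at)
  qed
  then show ?thesis by (simp add: continuous_at_imp_continuous_on)
qed

lemma deriv_series_has_derivative:
  assumes js: "set js \<subseteq> Basis" "real (Suc (length js)) < s" and x: "x \<noteq> 0"
  shows "(deriv_series js has_derivative
     (\<lambda>h. \<Sum>i\<in>Basis. (h \<bullet> i) * deriv_series (i # js) x)) (at x)"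
proof -
  let ?B = "ball x (norm x / 2)"
  have B0: "y \<noteq> 0" if "y \<in> ?B" for y using half_ball_norm[OF that] x by auto
  have js': "real (length js) < s" using js(2) by simp
  have lim: "\<forall>\<^sub>F n in sequentially. \<forall>y\<in>?B. \<forall>h.
      norm (sum (\<lambda>j. \<Sum>i\<in>Basis. (h \<bullet> i) * deriv_term (i # js) j y) {..<n}
        - (\<Sum>i\<in>Basis. (h \<bullet> i) * deriv_series (i # js) y)) \<le> e * norm h" if e: "e > 0" for e
  proof -
    let ?e = "e / real DIM('a)"
    have "\<forall>\<^sub>F n in sequentially. \<forall>y\<in>?B.
        dist (\<Sum>j<n. deriv_term (i # js) j y) (deriv_series (i # js) y) < ?e" if "i \<in> Basis" for i
      by (rule uniform_limitD[OF deriv_series_uniform[of "i # js" "norm x / 2"]])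
         (use that js x e half_ball_norm in auto)
    then have "\<forall>\<^sub>F n in sequentially. \<forall>i\<in>Basis. \<forall>y\<in>?B.
        dist (\<Sum>j<n. deriv_term (i # js) j y) (deriv_series (i # js) y) < ?e"
      by (intro eventually_ball_finite) auto
    then show ?thesis
    proof (rule eventually_mono, intro ballI allI)
      fix n y h
      assume *: "\<forall>i\<in>Basis. \<forall>y\<in>?B.
        dist (\<Sum>j<n. deriv_term (i # js) j y) (deriv_series (i # js) y) < ?e" and y: "y \<in> ?B"
      have "sum (\<lambda>j. \<Sum>i\<in>Basis. (h \<bullet> i) * deriv_term (i # js) j y) {..<n}
          - (\<Sum>i\<in>Basis. (h \<bullet> i) * deriv_series (i # js) y)
        = (\<Sum>i\<in>Basis. (h \<bullet> i) * ((\<Sum>j<n. deriv_term (i # js) j y) - deriv_series (i # js) y))"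
        by (subst sum.swap) (simp add: sum_subtractf right_diff_distrib sum_distrib_left)
      also have "norm \<dots> \<le> (\<Sum>i\<in>(Basis::'a set). norm h * ?e)"
        unfolding real_norm_def
      proof (rule order_trans[OF sum_abs sum_mono])
        fix i :: 'a assume i: "i \<in> Basis"
        show "\<bar>(h \<bullet> i) * ((\<Sum>j<n. deriv_term (i # js) j y) - deriv_series (i # js) y)\<bar> \<le> norm h * ?e"
          unfolding abs_mult using * i y Basis_le_norm[OF i, of h]
          by (intro mult_mono) (auto simp: dist_real_def less_imp_le)
      qed
      also have "\<dots> = e * norm h" by simp
      finally show "norm (sum (\<lambda>j. \<Sum>i\<in>Basis. (h \<bullet> i) * deriv_term (i # js) j y) {..<n}
        - (\<Sum>i\<in>Basis. (h \<bullet> i) * deriv_series (i # js) y)) \<le> e * norm h" .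
    qed
  qed
  have "\<exists>g. \<forall>y\<in>?B. (\<lambda>j. deriv_term js j y) sums g y \<and>
      (g has_derivative (\<lambda>h. \<Sum>i\<in>Basis. (h \<bullet> i) * deriv_series (i # js) y)) (at y within ?B)"
  proof (rule has_derivative_series[OF _ _ lim])
    show "convex ?B" by simp
    show "(deriv_term js n has_derivative (\<lambda>h. \<Sum>i\<in>Basis. (h \<bullet> i) * deriv_term (i # js) n y)) (at y within ?B)"
      if "y \<in> ?B" for n y
      by (rule has_derivative_at_withinI[OF deriv_term_has_derivative[OF B0[OF that]]])
    show "x \<in> ?B" using x by simp
    show "(\<lambda>j. deriv_term js j x) sums deriv_series js x"
      by (rule deriv_series_sums[OF js(1) js' x])
  qed
  then obtain g where g: "\<And>y. y \<in> ?B \<Longrightarrow> (\<lambda>j. deriv_term js j y) sums g y"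
    "\<And>y. y \<in> ?B \<Longrightarrow> (g has_derivative (\<lambda>h. \<Sum>i\<in>Basis. (h \<bullet> i) * deriv_series (i # js) y)) (at y within ?B)"
    by blast
  have "g y = deriv_series js y" if "y \<in> ?B" for y
    using sums_unique2[OF g(1)[OF that] deriv_series_sums[OF js(1) js' B0[OF that]]] .
  moreover have "(g has_derivative (\<lambda>h. \<Sum>i\<in>Basis. (h \<bullet> i) * deriv_series (i # js) x)) (at x)"
    using g(2)[of x] x by (simp add: at_within_open[of x ?B])
  ultimately show ?thesis
    using has_derivative_transform_within_open[of g _ x UNIV ?B "deriv_series js"] x by simp
qed

context
  fixes f :: "'a \<Rightarrow> real"
  assumes f: "\<And>x. norm x = 1 \<Longrightarrow> f x = (\<Sum>j. P j x)"
begin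

lemma partials_hom_ext:
  assumes "set js \<subseteq> Basis" "real (length js) < s" "x \<noteq> 0"
  shows "partials js (hom_ext f) x = deriv_series js x"
  using assms
proof (induction js arbitrary: x)
  case Nil
  then show ?case
    using f[OF norm_sgn_unit] by (simp add: hom_ext_def deriv_series_def deriv_term_def)
next
  case (Cons i js)
  have "(partials js (hom_ext f) has_derivative
      (\<lambda>h. \<Sum>i\<in>Basis. (h \<bullet> i) * deriv_series (i # js) x)) (at x)"
    by (rule has_derivative_transform_within_open[OF deriv_series_has_derivative, of _ _ "- {0}"])
       (use Cons in auto)
  then have "partials (i # js) (hom_ext f) x = (\<Sum>b\<in>Basis. (i \<bullet> b) * deriv_series (b # js) x)"
    using dir_deriv_eqI by simp
  also have "\<dots> = (\<Sum>b\<in>Basis. if b = i then deriv_series (b # js) x else 0)"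
    using Cons(2) by (intro sum.cong) (auto simp: inner_Basis)
  also have "\<dots> = deriv_series (i # js) x" using Cons(2) by simp
  finally show ?case .
qed

lemma Ck_sphere_series:
  assumes k: "real k < s"
  shows "Ck_sphere k f"
  unfolding Ck_sphere_def
proof (intro conjI allI impI)
  fix js :: "'a list"
  assume js: "set js \<subseteq> Basis \<and> length js < k"
  show "partials js (hom_ext f) differentiable_on - {0}"
    unfolding differentiable_on_def
  proof
    fix x :: 'a assume x: "x \<in> - {0}"
    have "(partials js (hom_ext f) has_derivative
      (\<lambda>h. \<Sum>i\<in>Basis. (h \<bullet> i) * deriv_series (i # js) x)) (at x)"
      by (rule has_derivative_transform_within_open[OF deriv_series_has_derivative, of _ _ "- {0}"])
         (use js k x partials_hom_ext[of js] in auto)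
    then show "partials js (hom_ext f) differentiable at x within - {0}"
      using has_derivative_at_withinI unfolding differentiable_def by blast
  qed
next
  fix js :: "'a list"
  assume js: "set js \<subseteq> Basis \<and> length js \<le> k"
  then have "continuous_on (- {0}) (deriv_series js)"
    using k by (intro deriv_series_continuous) auto
  then show "continuous_on (- {0}) (partials js (hom_ext f))"
    by (rule continuous_on_eq) (use js k partials_hom_ext[of js] in auto)
qed

text \<open>
  Each block contributes to a difference of derivatives at distance \<open>t\<close> at most a constant times
  \<open>B\<^sub>j min (1, 2\<^sup>j t)\<close>, where \<open>B\<^sub>j\<close> is the maximum of its derivative. As \<open>min (1, u) \<le> u\<^sup>\<alpha>\<close> for
  \<open>0 \<le> \<alpha> \<le> 1\<close>, the Hoelder exponent can be paid for with the exponential decay of \<open>B\<^sub>j\<close>.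
\<close>

lemma derivs_Hoelder_series:
  assumes dim: "DIM('a) \<ge> 2" and k: "real k \<le> \<gamma>" "\<gamma> \<le> real k + 1" and \<gamma>: "\<gamma> < s"
  shows "derivs_Hoelder k (\<gamma> - real k) f"
  unfolding derivs_Hoelder_def
proof (intro allI impI)
  fix js :: "'a list"
  assume js: "set js \<subseteq> Basis \<and> length js = k"
  define \<alpha> where "\<alpha> = \<gamma> - real k"
  have \<alpha>: "0 \<le> \<alpha>" "\<alpha> \<le> 1" using k by (auto simp: \<alpha>_def)
  obtain \<delta> where \<delta>: "\<gamma> < \<delta>" "\<delta> < s" using dense[OF \<gamma>] by blast
  obtain C where C: "C \<ge> 0" "\<And>j x. norm x = 1 \<Longrightarrow>
      \<bar>sph_derivs js (P j) x\<bar> \<le> C * 2 powr ((real k - \<delta>) * real j)"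
    using sph_derivs_decay[OF _ \<delta>(2), of js] js by blast
  \<comment> \<open>the derivatives of block \<open>j\<close> have degree \<open>2 * 2 ^ j + 2 * k\<close>, at most \<open>(2 + 2 * k) * 2 ^ j\<close>,
      and 7 is the constant in Bernstein's inequality\<close>
  define K where "K = 7 * (2 + 2 * real k)"
  have K: "2 \<le> K" by (simp add: K_def)
  define m where "m = (\<lambda>j. K * C * 2 powr ((\<gamma> - \<delta>) * real j))"
  have m: "summable m" unfolding m_def by (rule summable_geometric_powr) (use \<delta> in simp)
  have diff: "\<bar>sph_derivs js (P j) x - sph_derivs js (P j) y\<bar> \<le> m j * geodist x y powr \<alpha>"
    if xy: "norm x = 1" "norm y = 1" for j x y
  proof -
    define B where "B = C * 2 powr ((real k - \<delta>) * real j)"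
    define t where "t = geodist x y"
    have t: "0 \<le> t" unfolding t_def by (rule geodist_nonneg[OF xy])
    have B: "\<bar>sph_derivs js (P j) z\<bar> \<le> B" if "norm z = 1" for z
      using C(2)[OF that] by (simp add: B_def)
    have B0: "0 \<le> B" using C(1) by (simp add: B_def)
    have deg': "degree_le (2 ^ Suc j + 2 * k) (sph_derivs js (P j))"
      using degree_le_sph_derivs[OF deg[of j], of js] js by simp
    have "\<bar>sph_derivs js (P j) x - sph_derivs js (P j) y\<bar> \<le> K * B * (2 ^ j * t) powr \<alpha>"
    proof (cases "1 \<le> 2 ^ j * t")
      case True
      have "\<bar>sph_derivs js (P j) x - sph_derivs js (P j) y\<bar> \<le> 2 * B"
        using B[OF xy(1)] B[OF xy(2)] by linarith
      also have "\<dots> \<le> K * B" using K B0 by (rule mult_right_mono)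
      also have "\<dots> \<le> K * B * (2 ^ j * t) powr \<alpha>"
        using mult_left_mono[OF ge_one_powr_ge_zero[OF True \<alpha>(1)], of "K * B"] K B0 by simp
      finally show ?thesis .
    next
      case False
      have "\<bar>sph_derivs js (P j) x - sph_derivs js (P j) y\<bar> \<le> 7 * real (2 ^ Suc j + 2 * k) * B * t"
        unfolding t_def by (rule degree_le_lipschitz[OF dim deg' _ B xy]) (simp_all add: Suc_le_eq)
      also have "\<dots> \<le> K * 2 ^ j * B * t"
      proof (intro mult_right_mono B0 t)
        have "real k \<le> real k * 2 ^ j" by (simp add: mult_le_cancel_left1)
        then show "7 * real (2 ^ Suc j + 2 * k) \<le> K * 2 ^ j" by (simp add: K_def algebra_simps)
      qed
      also have "\<dots> = K * B * (2 ^ j * t)" by simp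
      also have "\<dots> \<le> K * B * (2 ^ j * t) powr \<alpha>"
      proof (rule mult_left_mono)
        show "2 ^ j * t \<le> (2 ^ j * t) powr \<alpha>"
        proof (cases "t = 0")
          case False
          then have "(2 ^ j * t) powr 1 \<le> (2 ^ j * t) powr \<alpha>"
            using \<open>\<not> 1 \<le> 2 ^ j * t\<close> t \<alpha> by (intro powr_mono') auto
          then show ?thesis using t by simp
        qed simp
      qed (use K B0 in simp)
      finally show ?thesis .
    qed
    also have "(2 ^ j * t) powr \<alpha> = 2 powr (\<alpha> * real j) * t powr \<alpha>"
      using t by (simp add: powr_mult powr_realpow[symmetric] powr_powr mult.commute)
    also have "K * B * (2 powr (\<alpha> * real j) * t powr \<alpha>) = m j * t powr \<alpha>"
      by (simp add: m_def B_def \<alpha>_def powr_add[symmetric] algebra_simps)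
    finally show ?thesis by (simp add: t_def)
  qed
  have "\<bar>partials js (hom_ext f) x - partials js (hom_ext f) y\<bar> \<le> suminf m * geodist x y powr \<alpha>"
    if xy: "x \<in> S_unit" "y \<in> S_unit" for x y
  proof -
    have n: "norm x = 1" "norm y = 1" using xy by auto
    then have nz: "x \<noteq> 0" "y \<noteq> 0" by auto
    have sgn: "sgn x = x" "sgn y = y" using n by (auto simp: sgn_div_norm)
    have ks: "real (length js) < s" using js k \<gamma> by simp
    have "(\<lambda>j. deriv_term js j x - deriv_term js j y) sums
        (partials js (hom_ext f) x - partials js (hom_ext f) y)"
      using js ks nz by (auto intro!: sums_diff deriv_series_sums simp: partials_hom_ext)
    moreover have "norm (deriv_term js j x - deriv_term js j y) \<le> m j * geodist x y powr \<alpha>" for j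
      using diff[OF n, of j] n by (simp add: deriv_term_def sgn)
    ultimately show ?thesis
      using norm_suminf_le[of "\<lambda>j. deriv_term js j x - deriv_term js j y" "\<lambda>j. m j * geodist x y powr \<alpha>"]
        m by (simp add: sums_iff suminf_mult2 summable_mult2)
  qed
  then show "\<exists>C. \<forall>x\<in>S_unit. \<forall>y\<in>S_unit.
     \<bar>partials js (hom_ext f) x - partials js (hom_ext f) y\<bar> \<le> C * geodist x y powr (\<gamma> - real k)"
    unfolding \<alpha>_def by blast
qed

lemma Hoelder_space_series:
  assumes dim: "DIM('a) \<ge> 2" and \<gamma>: "0 \<le> \<gamma>" "\<gamma> < s"
  shows "f \<in> Hoelder_space \<gamma>"
proof -
  have "real (nat \<lfloor>\<gamma>\<rfloor>) = of_int \<lfloor>\<gamma>\<rfloor>" using \<gamma> by simp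
  then have "real (nat \<lfloor>\<gamma>\<rfloor>) \<le> \<gamma>" "\<gamma> \<le> real (nat \<lfloor>\<gamma>\<rfloor>) + 1"
    using \<gamma>(1) by linarith+
  then show ?thesis
    unfolding Hoelder_space_def
    using derivs_Hoelder_series[OF dim _ _ \<gamma>(2), of "nat \<lfloor>\<gamma>\<rfloor>"] Ck_sphere_series[of "nat \<lfloor>\<gamma>\<rfloor>"] \<gamma>(2)
    by (metis (mono_tags, lifting) mem_Collect_eq order_le_less_trans)
qed

end

end

section \<open>Surface measure on the sphere\<close>

lemma nn_integral_lborel_translate:
  fixes a :: "'a::euclidean_space"
  assumes [measurable]: "f \<in> borel_measurable borel"
  shows "(\<integral>\<^sup>+ x. f (x + a) \<partial>lborel) = (\<integral>\<^sup>+ x. f x \<partial>lborel)"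
proof -
  have "(\<integral>\<^sup>+ x. f x \<partial>lborel) = (\<integral>\<^sup>+ x. f x \<partial>distr lborel borel ((+) a))"
    by (simp add: lborel_distr_plus)
  also have "\<dots> = (\<integral>\<^sup>+ x. f (x + a) \<partial>lborel)"
    by (subst nn_integral_distr) (auto simp: add.commute)
  finally show ?thesis by simp
qed

text \<open>
  Uniqueness of Haar measure on the additive group, in the special case at hand. By translation
  invariance and Tonelli, the double integral of \<open>(x, y) \<mapsto> 1\<^sub>B y * 1\<^sub>A (R x + y)\<close>, where \<open>B\<close> is the
  unit ball, is \<open>vol B * vol (R\<^sup>-\<^sup>1 A)\<close> when \<open>x\<close> is integrated first. When \<open>y\<close> is integrated first
  it is \<open>vol B * vol A\<close>, because \<open>B\<close> is invariant under \<open>R\<close> and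
  under point reflection.
\<close>

lemma lborel_distr_orthogonal:
  fixes R :: "'a::euclidean_space \<Rightarrow> 'a"
  assumes R: "orthogonal_transformation R"
  shows "distr lborel borel R = lborel"
proof (rule measure_eqI)
  have lin: "linear R" using R by (rule orthogonal_transformation_linear)
  have nR: "norm (R x) = norm x" for x using R by (rule orthogonal_transformation_norm)
  have [measurable]: "R \<in> borel_measurable borel"
    using lin by (intro borel_measurable_continuous_onI linear_continuous_on linear_conv_bounded_linear[THEN iffD1])
  fix A assume "A \<in> sets (distr lborel borel R)"
  then have A [measurable]: "A \<in> sets borel" by simp
  define B :: "'a set" where "B = ball 0 1"
  have B [measurable]: "B \<in> sets borel" by (simp add: B_def)
  have vB: "emeasure lborel B \<noteq> 0" "emeasure lborel B \<noteq> \<infinity>"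
    using emeasure_lborel_ball_finite[of "0::'a" 1]
    by (auto simp: B_def emeasure_ball unit_ball_vol_pos less_imp_neq[symmetric])
  have 1: "(\<integral>\<^sup>+ x. indicator A (R x + y) \<partial>lborel) = (\<integral>\<^sup>+ x. indicator A (R x) \<partial>lborel)" for y
  proof -
    obtain y' where y': "y = R y'" using orthogonal_transformation_surj[OF R] by (metis surjD)
    show ?thesis
      using nn_integral_lborel_translate[of "\<lambda>x. indicator A (R x)" y'] by (simp add: y' linear_add[OF lin])
  qed
  have 2: "(\<integral>\<^sup>+ x. indicator B (y - R x) \<partial>lborel) = emeasure lborel B" for y
  proof -
    obtain y' where y': "y = R y'" using orthogonal_transformation_surj[OF R] by (metis surjD)
    have "(\<lambda>x. indicator B (y - R x) :: ennreal) = (\<lambda>x. indicator B (x + - y'))"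
    proof
      fix x
      have "norm (y - R x) = norm (x + - y')"
        using nR[of "y' - x"] by (simp add: y' linear_diff[OF lin] norm_minus_commute)
      then show "(indicator B (y - R x) :: ennreal) = indicator B (x + - y')"
        by (simp add: B_def indicator_def)
    qed
    then show ?thesis using nn_integral_lborel_translate[of "indicator B" "- y'"] by simp
  qed
  have "emeasure lborel B * (\<integral>\<^sup>+ x. indicator A (R x) \<partial>lborel)
      = (\<integral>\<^sup>+ y. \<integral>\<^sup>+ x. indicator B y * indicator A (R x + y) \<partial>lborel \<partial>lborel)"
    by (simp add: nn_integral_cmult nn_integral_multc 1)
  also have "\<dots> = (\<integral>\<^sup>+ x. \<integral>\<^sup>+ y. indicator B y * indicator A (R x + y) \<partial>lborel \<partial>lborel)"
    by (rule lborel_pair.Fubini') measurable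
  also have "\<dots> = (\<integral>\<^sup>+ x. \<integral>\<^sup>+ y. indicator B (y - R x) * indicator A y \<partial>lborel \<partial>lborel)"
  proof (rule nn_integral_cong)
    fix x
    show "(\<integral>\<^sup>+ y. indicator B y * indicator A (R x + y) \<partial>lborel)
        = (\<integral>\<^sup>+ y. indicator B (y - R x) * (indicator A y :: ennreal) \<partial>lborel)"
      using nn_integral_lborel_translate[of "\<lambda>y. indicator B (y - R x) * indicator A y" "R x"]
      by (simp add: add.commute)
  qed
  also have "\<dots> = (\<integral>\<^sup>+ y. \<integral>\<^sup>+ x. indicator B (y - R x) * indicator A y \<partial>lborel \<partial>lborel)"
    by (rule lborel_pair.Fubini'[symmetric]) measurable
  also have "\<dots> = emeasure lborel B * emeasure lborel A"
    by (simp add: nn_integral_multc nn_integral_cmult 2)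
  finally have "(\<integral>\<^sup>+ x. indicator A (R x) \<partial>lborel) = emeasure lborel A"
    using vB by (simp add: ennreal_mult_cancel_left)
  moreover have "(\<integral>\<^sup>+ x. indicator A (R x) \<partial>lborel) = emeasure (distr lborel borel R) A"
    by (subst nn_integral_indicator[symmetric], simp, subst nn_integral_distr) auto
  ultimately show "emeasure (distr lborel borel R) A = emeasure lborel A" by simp
qed simp

lemma sets_sphere_measure [measurable_cong]: "sets sphere_measure = sets (restrict_space borel S_unit)"
  by (simp add: sphere_measure_def)

lemma space_sphere_measure [simp]: "space sphere_measure = S_unit"
  using sets_eq_imp_space_eq[OF sets_sphere_measure] by (simp add: space_restrict_space)

lemma measurable_sgn_sphere:
  "sgn \<in> restrict_space lborel (cball 0 1 - {0}) \<rightarrow>\<^sub>M restrict_space borel (S_unit :: 'a::euclidean_space set)"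
proof (rule measurable_restrict_space2)
  show "sgn \<in> space (restrict_space lborel (cball 0 1 - {0})) \<rightarrow> (S_unit :: 'a set)"
    by (auto simp: space_restrict_space norm_sgn)
  have "(\<lambda>x :: 'a. x /\<^sub>R norm x) \<in> borel_measurable borel" by measurable
  then have "sgn \<in> borel_measurable (borel :: 'a measure)" by (simp add: sgn_div_norm[abs_def])
  then show "sgn \<in> restrict_space lborel (cball 0 1 - {0 :: 'a}) \<rightarrow>\<^sub>M borel"
    by (intro measurable_restrict_space1) simp
qed

lemma emeasure_sphere_measure:
  fixes A :: "'a::euclidean_space set"
  assumes A: "A \<in> sets (restrict_space borel S_unit)"
  shows "emeasure sphere_measure A
    = of_nat DIM('a) * emeasure lborel {x \<in> cball 0 1 - {0}. sgn x \<in> A}"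
proof -
  let ?C = "cball 0 1 - {0} :: 'a set"
  have "emeasure sphere_measure A
      = of_nat DIM('a) * emeasure (restrict_space lborel ?C) (sgn -` A \<inter> space (restrict_space lborel ?C))"
    unfolding sphere_measure_def using A by (simp add: emeasure_distr measurable_sgn_sphere)
  also have "sgn -` A \<inter> space (restrict_space lborel ?C) = {x \<in> ?C. sgn x \<in> A}"
    by (auto simp: space_restrict_space)
  also have "emeasure (restrict_space lborel ?C) {x \<in> ?C. sgn x \<in> A} = emeasure lborel {x \<in> ?C. sgn x \<in> A}"
    by (rule emeasure_restrict_space) auto
  finally show ?thesis .
qed

lemma finite_measure_sphere: "finite_measure (sphere_measure :: 'a::euclidean_space measure)"
proof
  have "emeasure lborel {x \<in> cball 0 1 - {0}. sgn x \<in> (S_unit :: 'a set)} \<le> emeasure lborel (cball (0::'a) 1)"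
    by (rule emeasure_mono) auto
  also have "\<dots> < \<infinity>" by (rule emeasure_lborel_cball_finite)
  finally show "emeasure (sphere_measure :: 'a measure) (space sphere_measure) \<noteq> \<infinity>"
    using emeasure_sphere_measure[of "S_unit :: 'a set"]
    by (simp add: sets_restrict_space_iff ennreal_mult_eq_top_iff)
qed

interpretation sphere: finite_measure "sphere_measure :: 'a::euclidean_space measure"
  by (rule finite_measure_sphere)

lemma orthogonal_sphere_measurable:
  assumes R: "orthogonal_transformation (R :: 'a::euclidean_space \<Rightarrow> 'a)"
  shows "R \<in> sphere_measure \<rightarrow>\<^sub>M sphere_measure"
proof -
  have "R \<in> borel_measurable borel"
    using orthogonal_transformation_linear[OF R]
    by (intro borel_measurable_continuous_onI linear_continuous_on linear_conv_bounded_linear[THEN iffD1])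
  then have "R \<in> restrict_space borel S_unit \<rightarrow>\<^sub>M restrict_space borel S_unit"
    by (intro measurable_restrict_space2 measurable_restrict_space1)
       (auto simp: space_restrict_space orthogonal_transformation_norm[OF R])
  then show ?thesis by (simp cong: measurable_cong_sets add: sets_sphere_measure)
qed

lemma distr_sphere_orthogonal:
  assumes R: "orthogonal_transformation (R :: 'a::euclidean_space \<Rightarrow> 'a)"
  shows "distr sphere_measure sphere_measure R = sphere_measure"
proof (rule measure_eqI)
  note lin = orthogonal_transformation_linear[OF R] and nR = orthogonal_transformation_norm[OF R]
  have [measurable]: "R \<in> borel_measurable borel"
    using lin by (intro borel_measurable_continuous_onI linear_continuous_on linear_conv_bounded_linear[THEN iffD1])
  fix A assume "A \<in> sets (distr sphere_measure sphere_measure R)"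
  then have A: "A \<in> sets (restrict_space borel S_unit)" by (simp add: sets_sphere_measure)
  let ?C = "cball 0 1 - {0} :: 'a set"
  have RA: "R -` A \<inter> S_unit \<in> sets (restrict_space borel S_unit)"
    using measurable_sets[OF orthogonal_sphere_measurable[OF R], of A] A by (simp add: sets_sphere_measure)
  have R0: "R x = 0 \<longleftrightarrow> x = 0" for x using nR[of x] by (metis norm_eq_zero)
  have sgnR: "sgn (R x) = R (sgn x)" for x
    by (simp add: sgn_div_norm nR linear_cmul[OF lin])
  have meas: "{x \<in> ?C. sgn x \<in> A} \<in> sets borel"
    using measurable_sets[OF measurable_sgn_sphere A]
    by (simp add: space_restrict_space sets_restrict_space_iff vimage_def Int_def conj_commute)
  have "emeasure (distr sphere_measure sphere_measure R) A = emeasure sphere_measure (R -` A \<inter> S_unit)"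
    using A by (subst emeasure_distr) (auto simp: sets_sphere_measure orthogonal_sphere_measurable[OF R])
  also have "\<dots> = of_nat DIM('a) * emeasure lborel {x \<in> ?C. sgn x \<in> R -` A \<inter> S_unit}"
    by (rule emeasure_sphere_measure[OF RA])
  also have "{x \<in> ?C. sgn x \<in> R -` A \<inter> S_unit} = R -` {x \<in> ?C. sgn x \<in> A} \<inter> space lborel"
    using nR by (auto simp: sgnR norm_sgn R0)
  also have "emeasure lborel \<dots> = emeasure (distr lborel borel R) {x \<in> ?C. sgn x \<in> A}"
    using meas by (subst emeasure_distr) auto
  also have "of_nat DIM('a) * \<dots> = emeasure sphere_measure A"
    by (simp add: lborel_distr_orthogonal[OF R] emeasure_sphere_measure[OF A])
  finally show "emeasure (distr sphere_measure sphere_measure R) A = emeasure sphere_measure A" .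
qed simp

lemma sphere_integral_orthogonal:
  fixes f :: "'a::euclidean_space \<Rightarrow> real" and R :: "'a \<Rightarrow> 'a"
  assumes R: "orthogonal_transformation R" and f: "f \<in> borel_measurable sphere_measure"
  shows "(LINT x|sphere_measure. f (R x)) = (LINT x|sphere_measure. f x)"
  using integral_distr[OF orthogonal_sphere_measurable[OF R] f] by (simp add: distr_sphere_orthogonal[OF R])

lemma sphere_continuous_bounded:
  fixes f :: "'a::euclidean_space \<Rightarrow> real"
  assumes "continuous_on S_unit f"
  obtains B where "0 < B" "\<And>x. x \<in> S_unit \<Longrightarrow> \<bar>f x\<bar> \<le> B"
proof -
  have "bounded (f ` S_unit)"
    by (intro compact_imp_bounded compact_continuous_image assms compact_sphere)
  then show thesis using that unfolding bounded_pos by auto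
qed

lemma sphere_measurable_continuous:
  fixes f :: "'a::euclidean_space \<Rightarrow> real"
  shows "continuous_on S_unit f \<Longrightarrow> f \<in> borel_measurable sphere_measure"
  using borel_measurable_continuous_on_restrict[of S_unit f]
  by (simp cong: measurable_cong_sets add: sets_sphere_measure)

lemma sphere_integrable_continuous:
  fixes f :: "'a::euclidean_space \<Rightarrow> real"
  assumes "continuous_on S_unit f"
  shows "integrable sphere_measure f"
proof -
  obtain B where "\<And>x. x \<in> S_unit \<Longrightarrow> \<bar>f x\<bar> \<le> B" using sphere_continuous_bounded[OF assms] by metis
  then show ?thesis
    by (intro sphere.integrable_const_bound[of _ B] sphere_measurable_continuous assms) auto
qed

section \<open>Nikolskii's inequality\<close>

lemma cos_le_parabola:
  assumes "0 \<le> t" "t \<le> (1::real)"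
  shows "cos t \<le> 1 - t\<^sup>2 / 4"
proof -
  have cos: "1 / 2 \<le> cos u" if "0 \<le> u" "u \<le> 1" for u :: real
    using cos_monotone_0_pi_le[of u "pi / 3"] that pi_gt3 by (simp add: cos_60)
  have "sin 0 - 0 / 2 \<le> sin u - u / 2" if "0 \<le> u" "u \<le> 1" for u :: real
    by (rule DERIV_nonneg_imp_nondecreasing[OF that(1)])
       (use that cos in \<open>force intro!: exI derivative_eq_intros\<close>)
  then have sin: "u / 2 \<le> sin u" if "0 \<le> u" "u \<le> 1" for u :: real using that by force
  have "1 - 0\<^sup>2 / 4 - cos 0 \<le> 1 - t\<^sup>2 / 4 - cos t"
    by (rule DERIV_nonneg_imp_nondecreasing[OF assms(1)])
       (use assms sin in \<open>force intro!: exI derivative_eq_intros\<close>)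
  then show ?thesis by simp
qed

text \<open>For lower bounds on the surface measure of caps, which is defined by the volume of cones.\<close>

lemma geodist_sgn_le:
  fixes x z :: "'a::euclidean_space"
  assumes x: "norm x = 1" and t: "0 \<le> t" "t \<le> 1" and z: "norm (z - x /\<^sub>R 2) \<le> t / 8"
  shows "z \<noteq> 0" "norm z \<le> 1" "geodist x (sgn z) \<le> t"
proof -
  have "norm (x /\<^sub>R 2) = 1 / 2" using x by simp
  then show z0: "z \<noteq> 0" and "norm z \<le> 1"
    using z t norm_triangle_ineq2[of z "x /\<^sub>R 2"] by auto
  define w where "w = 2 *\<^sub>R z"
  have w0: "w \<noteq> 0" and sw: "sgn w = sgn z" using z0 by (auto simp: w_def sgn_div_norm)
  have nz: "norm (sgn z) = 1" using z0 by (simp add: norm_sgn)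
  have "w - x = 2 *\<^sub>R (z - x /\<^sub>R 2)" by (simp add: w_def algebra_simps)
  then have wx: "norm (w - x) \<le> t / 4" using z by simp
  have "sgn w - w = (1 - norm w) *\<^sub>R sgn w"
    using w0 by (simp add: sgn_div_norm algebra_simps)
  then have "norm (sgn w - w) = \<bar>norm x - norm w\<bar>" using w0 x by (simp add: norm_sgn)
  also have "\<dots> \<le> norm (w - x)" by (metis norm_minus_commute norm_triangle_ineq3)
  finally have "norm (sgn z - x) \<le> t / 2"
    using norm_triangle_ineq[of "sgn w - w" "w - x"] wx by (simp add: sw)
  then have "(norm (sgn z - x))\<^sup>2 \<le> (t / 2)\<^sup>2" by (intro power_mono) auto
  moreover have "(norm (sgn z - x))\<^sup>2 = 2 - 2 * (x \<bullet> sgn z)"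
  proof -
    have "x \<bullet> x = 1" "sgn z \<bullet> sgn z = 1" using x nz by (simp_all add: dot_square_norm)
    then show ?thesis
      unfolding power2_norm_eq_inner by (simp add: inner_diff_left inner_diff_right inner_commute)
  qed
  ultimately have "1 - t\<^sup>2 / 8 \<le> x \<bullet> sgn z" by (simp add: power2_eq_square)
  then have "cos t \<le> x \<bullet> sgn z" using cos_le_parabola[OF t] zero_le_power2[of t] by linarith
  moreover have "\<bar>x \<bullet> sgn z\<bar> \<le> 1" using Cauchy_Schwarz_ineq2[of x "sgn z"] x nz by simp
  ultimately have "arccos (x \<bullet> sgn z) \<le> arccos (cos t)"
    using cos_ge_minus_one[of t] by (intro arccos_le_mono[THEN iffD2]) auto
  then show "geodist x (sgn z) \<le> t"
    using t pi_gt3 by (simp add: geodist_def arccos_cos)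
qed

text \<open>
  By Bernstein's inequality a polynomial of degree \<open>N\<close> stays above half of its maximum on a cap
  of radius of order \<open>1 / N\<close>, and the cone over that cap contains a ball of such a radius. The
  factor \<open>N ^ d\<close> does not depend on \<open>p\<close>, so that its \<open>p\<close>-th root is negligible for large \<open>p\<close>.
\<close>

lemma nikolskii:
  assumes dim: "DIM('a::euclidean_space) \<ge> 2"
  obtains c where "c > 0"
    "\<And>N (f :: 'a \<Rightarrow> real) p x. degree_le N f \<Longrightarrow> N \<ge> 1 \<Longrightarrow> norm x = 1 \<Longrightarrow>
       ennreal (c * \<bar>f x\<bar> ^ p)
         \<le> ennreal (2 ^ p * real N ^ DIM('a)) * (\<integral>\<^sup>+ y. ennreal (\<bar>f y\<bar> ^ p) \<partial>sphere_measure)"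
proof -
  \<comment> \<open>the cap has radius \<open>1 / (14 * N)\<close>, hence the ball in the cone radius \<open>1 / (112 * N)\<close>\<close>
  define c where "c = unit_ball_vol DIM('a) / 112 ^ DIM('a)"
  have c: "c > 0" by (simp add: c_def unit_ball_vol_pos)
  show thesis
  proof (rule that[OF c])
    fix N p :: nat and f :: "'a \<Rightarrow> real" and x :: 'a
    assume f: "degree_le N f" and N: "N \<ge> 1" and x: "norm x = 1"
    have cont: "continuous_on S_unit (\<lambda>x. \<bar>f x\<bar>)" by (intro continuous_intros degree_le_continuous_on[OF f])
    obtain x0 where x0: "norm x0 = 1" "\<And>y. norm y = 1 \<Longrightarrow> \<bar>f y\<bar> \<le> \<bar>f x0\<bar>"
      using continuous_attains_sup[OF compact_sphere _ cont] x by auto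
    define B where "B = \<bar>f x0\<bar>"
    define D where "D = {y \<in> S_unit. B / 2 \<le> \<bar>f y\<bar>}"
    have [measurable]: "f \<in> borel_measurable borel" using f by (rule degree_le_borel)
    have "{y. B / 2 \<le> \<bar>f y\<bar>} \<in> sets borel" by measurable
    then have D: "D \<in> sets (restrict_space borel S_unit)"
      by (auto simp: sets_restrict_space D_def)
    define t where "t = 1 / (14 * real N)"
    have t: "0 < t" "t \<le> 1" using N by (auto simp: t_def field_simps)
    have ball: "ball (x0 /\<^sub>R 2) (t / 8) \<subseteq> {z \<in> cball 0 1 - {0}. sgn z \<in> D}"
    proof
      fix z assume "z \<in> ball (x0 /\<^sub>R 2) (t / 8)"
      then have "norm (z - x0 /\<^sub>R 2) \<le> t / 8" by (simp add: dist_norm norm_minus_commute)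
      note z = geodist_sgn_le[OF x0(1) _ t(2) this]
      have z0: "z \<noteq> 0" "norm z \<le> 1" "geodist x0 (sgn z) \<le> t" using z t by auto
      then have sz: "norm (sgn z) = 1" by (simp add: norm_sgn)
      have "\<bar>f x0 - f (sgn z)\<bar> \<le> 7 * real N * B * geodist x0 (sgn z)"
        by (rule degree_le_lipschitz[OF dim f N _ x0(1) sz]) (use x0 in \<open>simp add: B_def\<close>)
      also have "\<dots> \<le> 7 * real N * B * t" using z0 by (intro mult_left_mono) (auto simp: B_def)
      also have "\<dots> = B / 2" using N by (simp add: t_def)
      finally have "B / 2 \<le> \<bar>f (sgn z)\<bar>" unfolding B_def by linarith
      with z0 sz show "z \<in> {z \<in> cball 0 1 - {0}. sgn z \<in> D}" by (simp add: D_def)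
    qed
    have "ennreal (c / real N ^ DIM('a)) = emeasure lborel (ball (x0 /\<^sub>R 2) (t / 8))"
    proof -
      have "t / 8 = 1 / (112 * real N)" by (simp add: t_def)
      then have "unit_ball_vol DIM('a) * (t / 8) ^ DIM('a) = c / real N ^ DIM('a)"
        by (simp add: c_def power_divide power_mult_distrib)
      then show ?thesis using t by (simp add: emeasure_ball)
    qed
    also have "\<dots> \<le> emeasure lborel {z \<in> cball 0 1 - {0}. sgn z \<in> D}"
    proof (rule emeasure_mono[OF ball])
      show "{z \<in> cball 0 1 - {0}. sgn z \<in> D} \<in> sets lborel"
        using measurable_sets[OF measurable_sgn_sphere D]
        by (simp add: space_restrict_space sets_restrict_space_iff vimage_def Int_def conj_commute)
    qed
    also have "\<dots> = 1 * \<dots>" by simp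
    also have "\<dots> \<le> emeasure sphere_measure D"
    proof -
      have "(1::ennreal) \<le> of_nat DIM('a)" using DIM_positive[where 'a = 'a]
        by (metis One_nat_def Suc_leI of_nat_1 of_nat_le_iff)
      then show ?thesis unfolding emeasure_sphere_measure[OF D] by (rule mult_right_mono) simp
    qed
    finally have D_ge: "ennreal (c / real N ^ DIM('a)) \<le> emeasure sphere_measure D" .
    have "ennreal (c * \<bar>f x\<bar> ^ p) \<le> ennreal (c * B ^ p)"
      using c x0(2)[OF x] by (intro ennreal_leI mult_left_mono power_mono) (auto simp: B_def)
    also have "c * B ^ p = 2 ^ p * real N ^ DIM('a) * ((B / 2) ^ p * (c / real N ^ DIM('a)))"
      using N by (simp add: power_divide)
    also have "ennreal \<dots> = ennreal (2 ^ p * real N ^ DIM('a)) *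
        (ennreal ((B / 2) ^ p) * ennreal (c / real N ^ DIM('a)))"
      using c by (simp add: ennreal_mult[symmetric] B_def)
    also have "\<dots> \<le> ennreal (2 ^ p * real N ^ DIM('a)) * (ennreal ((B / 2) ^ p) * emeasure sphere_measure D)"
      by (intro mult_left_mono D_ge) auto
    also have "ennreal ((B / 2) ^ p) * emeasure sphere_measure D
        = (\<integral>\<^sup>+ y. ennreal ((B / 2) ^ p) * indicator D y \<partial>sphere_measure)"
      using D by (subst nn_integral_cmult_indicator) (auto simp: sets_sphere_measure)
    also have "\<dots> \<le> (\<integral>\<^sup>+ y. ennreal (\<bar>f y\<bar> ^ p) \<partial>sphere_measure)"
      by (intro nn_integral_mono)
         (auto simp: D_def B_def indicator_def intro!: ennreal_leI power_mono)
    finally show "ennreal (c * \<bar>f x\<bar> ^ p)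
         \<le> ennreal (2 ^ p * real N ^ DIM('a)) * (\<integral>\<^sup>+ y. ennreal (\<bar>f y\<bar> ^ p) \<partial>sphere_measure)"
      by (simp add: mult_left_mono)
  qed
qed

text \<open>Nikolskii's inequality for the constant 1 and the exponent 0.\<close>

lemma sphere_measure_pos:
  assumes dim: "DIM('a::euclidean_space) \<ge> 2"
  shows "0 < measure (sphere_measure :: 'a measure) S_unit"
proof -
  obtain x :: 'a where x: "norm x = 1" using vector_choose_size[of 1] by auto
  obtain c where c: "c > 0"
    "\<And>N (f :: 'a \<Rightarrow> real) p x. degree_le N f \<Longrightarrow> N \<ge> 1 \<Longrightarrow> norm x = 1 \<Longrightarrow>
       ennreal (c * \<bar>f x\<bar> ^ p)
         \<le> ennreal (2 ^ p * real N ^ DIM('a)) * (\<integral>\<^sup>+ y. ennreal (\<bar>f y\<bar> ^ p) \<partial>sphere_measure)"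
    using nikolskii[OF dim] by metis
  have "ennreal c \<le> emeasure (sphere_measure :: 'a measure) S_unit"
    using c(2)[OF degree_le_const[of 1 1] _ x, of 0] by simp
  then have "0 < emeasure (sphere_measure :: 'a measure) S_unit" using c(1)
    by (metis ennreal_eq_0_iff ennreal_less_zero_iff not_le order_less_le_trans zero_less_iff_neq_zero)
  then show ?thesis by (simp add: sphere.emeasure_eq_measure)
qed

section \<open>Orthogonality of spherical harmonics of different degrees\<close>

lemma homogeneous_dir_deriv:
  assumes p: "degree_le n p" "\<And>c x. p (c *\<^sub>R x) = c ^ l * p x"
  shows "c * dir_deriv v p (c *\<^sub>R x) = c ^ l * dir_deriv v p x"
proof -
  have 1: "((\<lambda>x. c *\<^sub>R x) has_derivative (\<lambda>h. c *\<^sub>R h)) (at x)" by (auto intro!: derivative_eq_intros)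
  have "((\<lambda>x. p (c *\<^sub>R x)) has_derivative (\<lambda>h. dir_deriv (c *\<^sub>R h) p (c *\<^sub>R x))) (at x)"
    by (rule has_derivative_compose[OF 1 degree_le_has_derivative[OF p(1)]])
  moreover have "((\<lambda>x. p (c *\<^sub>R x)) has_derivative (\<lambda>h. c ^ l * dir_deriv h p x)) (at x)"
    unfolding p(2) by (intro has_derivative_mult_right degree_le_has_derivative[OF p(1)])
  ultimately have "dir_deriv (c *\<^sub>R v) p (c *\<^sub>R x) = c ^ l * dir_deriv v p x"
    by (metis has_derivative_unique)
  then show ?thesis using linear_cmul[OF dir_deriv_linear[OF p(1), of "c *\<^sub>R x"], of c v] by simp
qed

text \<open>Euler's identity. The factor \<open>c ^ a\<close> admits functions of degree \<open>m - a\<close>, possibly negative.\<close>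

lemma euler_identity:
  assumes G: "degree_le n G" "\<And>c. c ^ a * G (c *\<^sub>R x) = c ^ m * G x"
  shows "dir_deriv x G x = (real m - real a) * G x"
proof -
  have 1: "((\<lambda>c. c *\<^sub>R x) has_derivative (\<lambda>h. h *\<^sub>R x)) (at (1::real))"
    by (auto intro!: derivative_eq_intros)
  have "((\<lambda>c. G (c *\<^sub>R x)) has_derivative (\<lambda>h. dir_deriv (h *\<^sub>R x) G (1 *\<^sub>R x))) (at 1)"
    by (rule has_derivative_compose[OF 1 degree_le_has_derivative[OF G(1)]])
  then have "((\<lambda>c. G (c *\<^sub>R x)) has_real_derivative dir_deriv x G x) (at 1)"
    using linear_cmul[OF dir_deriv_linear[OF G(1), of x]]
    by (simp add: has_field_derivative_def mult_commute_abs)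
  then have "((\<lambda>c. c ^ a * G (c *\<^sub>R x)) has_real_derivative (real a * G x + dir_deriv x G x)) (at 1)"
    by (auto intro!: derivative_eq_intros)
  moreover have "((\<lambda>c. c ^ a * G (c *\<^sub>R x)) has_real_derivative (real m * G x)) (at 1)"
    unfolding G(2) by (auto intro!: derivative_eq_intros)
  ultimately have "real a * G x + dir_deriv x G x = real m * G x" by (rule DERIV_unique)
  then show ?thesis by (simp add: algebra_simps)
qed

text \<open>Rotation by the angle \<open>t\<close> in the plane of the coordinate vectors \<open>i\<close> and \<open>j\<close>.\<close>

definition plane_rotation :: "'a::euclidean_space \<Rightarrow> 'a \<Rightarrow> real \<Rightarrow> 'a \<Rightarrow> 'a" where
  "plane_rotation i j t x = x + ((cos t - 1) * (x \<bullet> i) - sin t * (x \<bullet> j)) *\<^sub>R i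
     + (sin t * (x \<bullet> i) + (cos t - 1) * (x \<bullet> j)) *\<^sub>R j"

lemma plane_rotation_orthogonal:
  assumes ij: "i \<in> Basis" "j \<in> Basis" "i \<noteq> j"
  shows "orthogonal_transformation (plane_rotation i j t)"
  unfolding orthogonal_transformation_def
proof (intro conjI allI)
  show "linear (plane_rotation i j t)"
    by (rule linearI) (auto simp: plane_rotation_def algebra_simps)
  fix v w :: 'a
  define a b where "a = v \<bullet> i" and "b = v \<bullet> j"
  define c e where "c = w \<bullet> i" and "e = w \<bullet> j"
  have d: "i \<bullet> i = 1" "j \<bullet> j = 1" "i \<bullet> j = 0" "j \<bullet> i = 0" using ij by (auto simp: inner_Basis)
  have ab: "v \<bullet> i = a" "i \<bullet> v = a" "v \<bullet> j = b" "j \<bullet> v = b" "w \<bullet> i = c" "i \<bullet> w = c" "w \<bullet> j = e" "j \<bullet> w = e"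
    by (auto simp: a_def b_def c_def e_def inner_commute)
  define C D where "C = cos t" and "D = sin t"
  have "C * C + D * D = 1" by (simp add: C_def D_def sin_cos_squared_add3)
  moreover have "plane_rotation i j t v \<bullet> plane_rotation i j t w = v \<bullet> w
      + ((C - 1) * a - D * b) * c + (D * a + (C - 1) * b) * e
      + ((C - 1) * c - D * e) * (a + ((C - 1) * a - D * b))
      + (D * c + (C - 1) * e) * (b + (D * a + (C - 1) * b))"
    unfolding plane_rotation_def ab C_def[symmetric] D_def[symmetric]
    by (simp add: inner_add_left inner_add_right d ab)
  ultimately show "plane_rotation i j t v \<bullet> plane_rotation i j t w = v \<bullet> w" by algebra
qed

text \<open>
  The integral of \<open>f\<close> over the rotated sphere does not depend on the angle, by invariance of the
  surface measure. Its derivative at the angle 0 is the integral in question.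
\<close>

lemma integral_rotation_generator:
  fixes f :: "'a::euclidean_space \<Rightarrow> real"
  assumes f: "degree_le n f" and ij: "i \<in> Basis" "j \<in> Basis"
  shows "(LINT x|sphere_measure. (x \<bullet> i) * dir_deriv j f x - (x \<bullet> j) * dir_deriv i f x) = 0"
proof (cases "i = j")
  case True
  then show ?thesis by simp
next
  case False
  define X where "X = (\<lambda>x. (x \<bullet> i) * dir_deriv j f x - (x \<bullet> j) * dir_deriv i f x)"
  have pX: "degree_le (Suc n) X"
    unfolding X_def by (intro degree_le_diff degree_le_inner_mult degree_le_dir_deriv f)
  note orth = plane_rotation_orthogonal[OF ij False]
  have d: "i \<bullet> i = 1" "j \<bullet> j = 1" "i \<bullet> j = 0" "j \<bullet> i = 0" using ij False by (auto simp: inner_Basis)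
  have deriv: "((\<lambda>t. f (plane_rotation i j t x)) has_real_derivative X (plane_rotation i j t x)) (at t)"
    for x t
  proof -
    let ?y = "plane_rotation i j t x"
    have y: "?y \<bullet> i = cos t * (x \<bullet> i) - sin t * (x \<bullet> j)" "?y \<bullet> j = sin t * (x \<bullet> i) + cos t * (x \<bullet> j)"
      by (auto simp: plane_rotation_def inner_simps d algebra_simps)
    have "((\<lambda>t. plane_rotation i j t x) has_derivative
        (\<lambda>h. h *\<^sub>R ((?y \<bullet> i) *\<^sub>R j - (?y \<bullet> j) *\<^sub>R i))) (at t)"
      unfolding y unfolding plane_rotation_def
      by (auto intro!: derivative_eq_intros simp: algebra_simps)
    from has_derivative_compose[OF this degree_le_has_derivative[OF f]]
    have "((\<lambda>t. f (plane_rotation i j t x)) has_derivative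
        (\<lambda>h. dir_deriv (h *\<^sub>R ((?y \<bullet> i) *\<^sub>R j - (?y \<bullet> j) *\<^sub>R i)) f ?y)) (at t)" .
    moreover have "dir_deriv (h *\<^sub>R ((?y \<bullet> i) *\<^sub>R j - (?y \<bullet> j) *\<^sub>R i)) f ?y = X ?y * h" for h
      using linear_cmul[OF dir_deriv_linear[OF f, of ?y]] linear_diff[OF dir_deriv_linear[OF f, of ?y]]
      by (simp add: X_def mult.commute)
    ultimately show ?thesis by (simp add: has_field_derivative_def)
  qed
  obtain B where B: "0 < B" "\<And>x. x \<in> S_unit \<Longrightarrow> \<bar>X x\<bar> \<le> B"
    using sphere_continuous_bounded[OF degree_le_continuous_on[OF pX]] by metis
  define u where "u = (\<lambda>k x. (f (plane_rotation i j (1 / real (Suc k)) x) - f x) / (1 / real (Suc k)))"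
  have rot0: "plane_rotation i j 0 x = x" for x by (simp add: plane_rotation_def)
  have fm: "f \<in> borel_measurable sphere_measure"
    by (rule sphere_measurable_continuous[OF degree_le_continuous_on[OF f]])
  have um: "u k \<in> borel_measurable sphere_measure" for k
    unfolding u_def
    using measurable_compose[OF orthogonal_sphere_measurable[OF orth] fm] fm
    by (intro borel_measurable_divide borel_measurable_diff) auto
  have int0: "integral\<^sup>L sphere_measure (u k) = 0" for k
  proof -
    have i1: "integrable sphere_measure f"
      by (rule sphere_integrable_continuous[OF degree_le_continuous_on[OF f]])
    have i2: "integrable sphere_measure (\<lambda>x. f (plane_rotation i j t x))" for t
      using integrable_distr[OF orthogonal_sphere_measurable[OF orth], where f = f] i1
      by (simp add: distr_sphere_orthogonal[OF orth])
    have "(LINT x|sphere_measure. (f (plane_rotation i j t x) - f x) / t) = 0" for t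
      by (simp add: i1 i2 sphere_integral_orthogonal[OF orth fm])
    then show ?thesis unfolding u_def .
  qed
  have "(\<lambda>k. integral\<^sup>L sphere_measure (u k)) \<longlonglongrightarrow> integral\<^sup>L sphere_measure X"
  proof (rule integral_dominated_convergence[where w = "\<lambda>_. B"])
    show "X \<in> borel_measurable sphere_measure"
      by (rule sphere_measurable_continuous[OF degree_le_continuous_on[OF pX]])
    show "AE x in sphere_measure. (\<lambda>k. u k x) \<longlonglongrightarrow> X x"
    proof (rule AE_I2)
      fix x :: 'a
      have "((\<lambda>h. (f (plane_rotation i j (0 + h) x) - f (plane_rotation i j 0 x)) / h) \<longlongrightarrow> X x) (at 0)"
        using deriv[of x 0] by (simp add: DERIV_def rot0)
      then have "((\<lambda>h. (f (plane_rotation i j h x) - f x) / h) \<longlongrightarrow> X x) (at 0)"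
        by (simp add: rot0)
      moreover have "filterlim (\<lambda>k. 1 / real (Suc k)) (at 0) sequentially"
        unfolding filterlim_at using LIMSEQ_inverse_real_of_nat by (simp add: inverse_eq_divide)
      ultimately show "(\<lambda>k. u k x) \<longlonglongrightarrow> X x"
        unfolding u_def by (rule filterlim_compose)
    qed
    show "AE x in sphere_measure. norm (u k x) \<le> B" for k
    proof (rule AE_I2)
      fix x :: 'a assume "x \<in> space sphere_measure"
      then have x: "norm x = 1" by simp
      let ?t = "1 / real (Suc k)"
      have "norm (f (plane_rotation i j ?t x) - f (plane_rotation i j 0 x)) \<le> B * norm (?t - 0)"
        by (rule field_differentiable_bound[of UNIV _ "\<lambda>t. X (plane_rotation i j t x)"])
           (use deriv B(2) orthogonal_transformation_norm[OF orth] x in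
             \<open>auto intro: has_field_derivative_at_within\<close>)
      then have "\<bar>f (plane_rotation i j ?t x) - f x\<bar> \<le> B * ?t" by (simp add: rot0)
      then have "\<bar>f (plane_rotation i j ?t x) - f x\<bar> / ?t \<le> B" by (subst pos_divide_le_eq) auto
      then show "norm (u k x) \<le> B" by (simp only: u_def real_norm_def abs_divide)
    qed
  qed (auto intro: um)
  then have "integral\<^sup>L sphere_measure X = 0" using int0 LIMSEQ_unique[OF _ tendsto_const] by simp
  then show ?thesis by (simp add: X_def)
qed

lemma laplacian_dir_deriv: "laplacian p x = (\<Sum>i\<in>Basis. dir_deriv i (dir_deriv i p) x)"
  by (simp add: laplacian_def)

text \<open>
  Green's formula is replaced by a sum of the preceding identity over all coordinate planes. For
  \<open>G\<^sub>i = p \<partial>\<^sub>i q - q \<partial>\<^sub>i p\<close>, a field without divergence and homogeneous of degree \<open>l + l' - 1\<close>, Euler's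
  identity shows that applying the generator of the plane \<open>(i, j)\<close> to \<open>x\<^sub>j G\<^sub>i\<close> and summing yields
  \<open>(2 - d - l - l') (l' - l) p q\<close>.
\<close>

lemma harmonic_orthogonal:
  fixes p q :: "'a::euclidean_space \<Rightarrow> real"
  assumes dim: "DIM('a) \<ge> 2" and ll: "l \<noteq> l'"
    and p: "degree_le n p" "\<And>c x. p (c *\<^sub>R x) = c ^ l * p x" "\<And>x. laplacian p x = 0"
    and q: "degree_le n' q" "\<And>c x. q (c *\<^sub>R x) = c ^ l' * q x" "\<And>x. laplacian q x = 0"
  shows "(LINT x|sphere_measure. p x * q x) = 0"
proof -
  define G where "G = (\<lambda>i x. p x * dir_deriv i q x - q x * dir_deriv i p x)"
  have pG: "degree_le (n + n') (G i)" for i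
  proof -
    have "degree_le (n + n') (\<lambda>x. q x * dir_deriv i p x)"
      using degree_le_mult[OF q(1) degree_le_dir_deriv[OF p(1)]] by (simp add: add.commute)
    then show ?thesis unfolding G_def by (rule degree_le_diff[OF degree_le_mult[OF p(1) degree_le_dir_deriv[OF q(1)]]])
  qed
  have dG: "dir_deriv v (G i) x = dir_deriv v p x * dir_deriv i q x + p x * dir_deriv v (dir_deriv i q) x
      - (dir_deriv v q x * dir_deriv i p x + q x * dir_deriv v (dir_deriv i p) x)" for v i x
    unfolding G_def
    by (rule dir_deriv_eqI)
       (auto intro!: derivative_eq_intros degree_le_has_derivative[OF p(1)] degree_le_has_derivative[OF q(1)]
          degree_le_has_derivative[OF degree_le_dir_deriv[OF p(1)]] degree_le_has_derivative[OF degree_le_dir_deriv[OF q(1)]])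
  have div: "(\<Sum>i\<in>Basis. dir_deriv i (G i) x) = 0" for x
  proof -
    have "(\<Sum>i\<in>Basis. dir_deriv i (G i) x) = p x * laplacian q x - q x * laplacian p x"
      unfolding dG laplacian_dir_deriv sum_distrib_left sum_subtractf[symmetric]
      by (rule sum.cong) auto
    then show ?thesis using p(3) q(3) by simp
  qed
  have eulerG: "(\<Sum>j\<in>Basis. (x \<bullet> j) * dir_deriv j (G i) x) = (real (l + l') - 1) * G i x" for i x
  proof -
    have "c ^ 1 * G i (c *\<^sub>R x) = c ^ (l + l') * G i x" for c
    proof -
      have "c ^ 1 * G i (c *\<^sub>R x)
          = p (c *\<^sub>R x) * (c * dir_deriv i q (c *\<^sub>R x)) - q (c *\<^sub>R x) * (c * dir_deriv i p (c *\<^sub>R x))"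
        by (simp add: G_def algebra_simps)
      also have "\<dots> = c ^ (l + l') * G i x"
        unfolding homogeneous_dir_deriv[OF p(1,2)] homogeneous_dir_deriv[OF q(1,2)] p(2) q(2)
        by (simp add: G_def power_add algebra_simps)
      finally show ?thesis .
    qed
    from euler_identity[OF pG this] show ?thesis
      unfolding dir_deriv_Basis_sum[OF pG[of i], of x x] by simp
  qed
  have xG: "(\<Sum>i\<in>Basis. (x \<bullet> i) * G i x) = (real l' - real l) * (p x * q x)" for x
  proof -
    have "(\<Sum>i\<in>Basis. (x \<bullet> i) * G i x) = p x * dir_deriv x q x - q x * dir_deriv x p x"
      unfolding dir_deriv_Basis_sum[OF p(1), of x x] dir_deriv_Basis_sum[OF q(1), of x x]
        sum_distrib_left sum_subtractf[symmetric]
      by (rule sum.cong) (auto simp: G_def algebra_simps)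
    moreover have "dir_deriv x q x = real l' * q x" "dir_deriv x p x = real l * p x"
      using euler_identity[OF p(1), of 0 x l] euler_identity[OF q(1), of 0 x l'] p(2) q(2) by auto
    ultimately show ?thesis by (simp add: algebra_simps)
  qed
  define F where "F = (\<lambda>i j x. (x \<bullet> j) * G i x)"
  have pF: "degree_le (Suc (n + n')) (F i j)" for i j unfolding F_def by (intro degree_le_inner_mult pG)
  have dF: "dir_deriv v (F i j) x = (x \<bullet> j) * dir_deriv v (G i) x + (v \<bullet> j) * G i x" for v i j x
    unfolding F_def
    by (rule dir_deriv_eqI) (auto intro!: derivative_eq_intros degree_le_has_derivative[OF pG])
  define W where "W = (\<lambda>i j x. (x \<bullet> j) * dir_deriv i (F i j) x - (x \<bullet> i) * dir_deriv j (F i j) x)"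
  have intW: "integrable sphere_measure (W i j)" for i j
    unfolding W_def
    by (intro sphere_integrable_continuous degree_le_continuous_on[of "Suc (Suc (n + n'))"]
        degree_le_diff degree_le_inner_mult degree_le_dir_deriv pF)
  have W0: "integral\<^sup>L sphere_measure (W i j) = 0" if "i \<in> Basis" "j \<in> Basis" for i j
    unfolding W_def by (rule integral_rotation_generator[OF pF that(2,1)])
  define K where "K = (2 - real DIM('a) - real (l + l')) * (real l' - real l)"
  have "(\<Sum>i\<in>Basis. \<Sum>j\<in>Basis. W i j x) = K * (p x * q x)" if x: "norm x = 1" for x
  proof -
    have xx: "(\<Sum>j\<in>Basis. (x \<bullet> j) * (x \<bullet> j)) = 1"
      using x by (simp add: euclidean_inner[symmetric] dot_square_norm)
    have "(\<Sum>j\<in>Basis. W i j x) = (x \<bullet> i) * G i x + dir_deriv i (G i) x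
        - real DIM('a) * ((x \<bullet> i) * G i x) - (x \<bullet> i) * ((real (l + l') - 1) * G i x)"
      if i: "i \<in> Basis" for i
    proof -
      have "(\<Sum>j\<in>Basis. W i j x) = (\<Sum>j\<in>Basis. (x \<bullet> j) * (x \<bullet> j)) * dir_deriv i (G i) x
          + (\<Sum>j\<in>Basis. (x \<bullet> j) * ((i \<bullet> j) * G i x)) - (\<Sum>j\<in>(Basis :: 'a set). (x \<bullet> i) * G i x)
          - (x \<bullet> i) * (\<Sum>j\<in>Basis. (x \<bullet> j) * dir_deriv j (G i) x)"
        unfolding W_def dF sum_distrib_left sum_distrib_right sum_subtractf[symmetric] sum.distrib[symmetric]
        by (rule sum.cong) (auto simp: algebra_simps)
      also have "(\<Sum>j\<in>Basis. (x \<bullet> j) * ((i \<bullet> j) * G i x)) = (\<Sum>j\<in>Basis. if j = i then (x \<bullet> i) * G i x else 0)"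
        using i by (intro sum.cong) (auto simp: inner_Basis)
      finally show ?thesis unfolding xx eulerG using i by simp
    qed
    then have "(\<Sum>i\<in>Basis. \<Sum>j\<in>Basis. W i j x)
      = (\<Sum>i\<in>Basis. (2 - real DIM('a) - real (l + l')) * ((x \<bullet> i) * G i x) + dir_deriv i (G i) x)"
      by (intro sum.cong) (auto simp: algebra_simps)
    also have "\<dots> = K * (p x * q x)"
      by (simp add: sum.distrib sum_distrib_left[symmetric] xG div K_def)
    finally show ?thesis .
  qed
  then have "K * (LINT x|sphere_measure. p x * q x)
      = (LINT x|sphere_measure. (\<Sum>i\<in>Basis. \<Sum>j\<in>Basis. W i j x))"
    by (simp only: integral_mult_right_zero[symmetric], intro Bochner_Integration.integral_cong) auto
  also have "\<dots> = 0" by (simp add: intW W0)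
  finally show ?thesis using dim ll by (auto simp: K_def)
qed

section \<open>Rotation invariance of the spaces of spherical harmonics\<close>

lemma dir_deriv_compose_linear:
  assumes f: "degree_le n f" and R: "linear (R :: 'a::euclidean_space \<Rightarrow> 'a)"
  shows "dir_deriv v (\<lambda>x. f (R x)) = (\<lambda>x. dir_deriv (R v) f (R x))"
proof
  fix x
  show "dir_deriv v (\<lambda>x. f (R x)) x = dir_deriv (R v) f (R x)"
    by (rule dir_deriv_eqI, rule has_derivative_compose[OF linear_imp_has_derivative[OF R] degree_le_has_derivative[OF f]])
qed

text \<open>The Laplacian is the trace of the Hessian, and so does not depend on the orthonormal basis.\<close>

lemma laplacian_orthogonal:
  assumes p: "degree_le n p" and R: "orthogonal_transformation (R :: 'a::euclidean_space \<Rightarrow> 'a)"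
  shows "laplacian (\<lambda>x. p (R x)) x = laplacian p (R x)"
proof -
  note lin = orthogonal_transformation_linear[OF R]
  let ?H = "\<lambda>a b. dir_deriv a (dir_deriv b p) (R x)"
  have second: "dir_deriv u (dir_deriv u p) y = (\<Sum>b\<in>Basis. \<Sum>a\<in>Basis. (u \<bullet> b) * (u \<bullet> a) * dir_deriv a (dir_deriv b p) y)" for u y
  proof -
    have "dir_deriv u (dir_deriv u p) y = dir_deriv u (\<lambda>x. \<Sum>b\<in>Basis. (u \<bullet> b) * dir_deriv b p x) y"
    proof -
      have "dir_deriv u p = (\<lambda>x. \<Sum>b\<in>Basis. (u \<bullet> b) * dir_deriv b p x)" by (rule ext) (rule dir_deriv_Basis_sum[OF p])
      then show ?thesis by simp
    qed
    also have "\<dots> = (\<Sum>b\<in>Basis. (u \<bullet> b) * dir_deriv u (dir_deriv b p) y)"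
      by (rule dir_deriv_eqI)
         (intro has_derivative_sum has_derivative_mult_right degree_le_has_derivative[OF degree_le_dir_deriv[OF p]])
    also have "\<dots> = (\<Sum>b\<in>Basis. \<Sum>a\<in>Basis. (u \<bullet> b) * (u \<bullet> a) * dir_deriv a (dir_deriv b p) y)"
      by (rule sum.cong[OF refl], subst dir_deriv_Basis_sum[OF degree_le_dir_deriv[OF p]])
         (simp add: sum_distrib_left mult.assoc)
    finally show ?thesis .
  qed
  have trace: "(\<Sum>i\<in>Basis. (R i \<bullet> b) * (R i \<bullet> a)) = a \<bullet> b" for a b
  proof -
    obtain a' b' where ab: "a = R a'" "b = R b'" using orthogonal_transformation_surj[OF R] by (metis surjD)
    have RR: "R u \<bullet> R v = u \<bullet> v" for u v using R by (simp add: orthogonal_transformation_def)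
    show ?thesis unfolding ab RR by (subst (3) euclidean_inner) (simp add: inner_commute mult.commute)
  qed
  have "laplacian (\<lambda>x. p (R x)) x = (\<Sum>i\<in>Basis. dir_deriv (R i) (dir_deriv (R i) p) (R x))"
    unfolding laplacian_dir_deriv dir_deriv_compose_linear[OF p lin]
      fun_cong[OF dir_deriv_compose_linear[OF degree_le_dir_deriv[OF p] lin]] ..
  also have "\<dots> = (\<Sum>i\<in>Basis. \<Sum>b\<in>Basis. \<Sum>a\<in>Basis. (R i \<bullet> b) * (R i \<bullet> a) * ?H a b)"
    unfolding second ..
  also have "\<dots> = (\<Sum>b\<in>Basis. \<Sum>a\<in>Basis. \<Sum>i\<in>Basis. (R i \<bullet> b) * (R i \<bullet> a) * ?H a b)"
    by (subst sum.swap, rule sum.cong[OF refl], subst sum.swap, rule refl)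
  also have "\<dots> = (\<Sum>b\<in>Basis. \<Sum>a\<in>Basis. (a \<bullet> b) * ?H a b)"
    unfolding sum_distrib_right[symmetric] trace ..
  also have "\<dots> = (\<Sum>b\<in>Basis. \<Sum>a\<in>Basis. if a = b then ?H a b else 0)"
    by (intro sum.cong) (auto simp: inner_Basis)
  also have "\<dots> = laplacian p (R x)" by (simp add: laplacian_dir_deriv)
  finally show ?thesis .
qed

lemma spherical_harmonic_orthogonal:
  assumes Y: "spherical_harmonic l Y" and R: "orthogonal_transformation (R :: 'a::euclidean_space \<Rightarrow> 'a)"
  shows "spherical_harmonic l (\<lambda>x. Y (R x))"
proof -
  note lin = orthogonal_transformation_linear[OF R]
  obtain p where p: "real_polynomial_function p" "\<And>c x. p (c *\<^sub>R x) = c ^ l * p x"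
    "\<And>x. laplacian p x = 0" "\<And>x. x \<in> S_unit \<Longrightarrow> Y x = p x"
    using Y unfolding spherical_harmonic_def by blast
  have "polynomial_function R"
    using lin by (intro polynomial_function_bounded_linear) (simp add: linear_conv_bounded_linear)
  then have "real_polynomial_function (\<lambda>x. p (R x))"
    using real_polynomial_function_compose[of R p] p(1) by (simp add: o_def)
  moreover have "laplacian (\<lambda>x. p (R x)) x = 0" for x
    using laplacian_orthogonal[OF homogeneous_degree_le[OF p(1,2)] R] p(3) by simp
  ultimately show ?thesis
    unfolding spherical_harmonic_def
    using p(2,4) by (intro exI[of _ "\<lambda>x. p (R x)"])
      (auto simp: linear_cmul[OF lin] orthogonal_transformation_norm[OF R])
qed

lemma spherical_harmonic_combination:
  assumes "spherical_harmonic l Y" "spherical_harmonic l Y'"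
  shows "spherical_harmonic l (\<lambda>x. a * Y x + b * Y' x)"
proof -
  obtain p where p: "real_polynomial_function p" "\<And>c x. p (c *\<^sub>R x) = c ^ l * p x"
    "\<And>x. laplacian p x = 0" "\<And>x. x \<in> S_unit \<Longrightarrow> Y x = p x"
    using assms(1) unfolding spherical_harmonic_def by blast
  obtain q where q: "real_polynomial_function q" "\<And>c x. q (c *\<^sub>R x) = c ^ l * q x"
    "\<And>x. laplacian q x = 0" "\<And>x. x \<in> S_unit \<Longrightarrow> Y' x = q x"
    using assms(2) unfolding spherical_harmonic_def by blast
  note pp = homogeneous_degree_le[OF p(1,2)] and pq = homogeneous_degree_le[OF q(1,2)]
  have d: "dir_deriv v (\<lambda>x. a * f x + b * g x) = (\<lambda>x. a * dir_deriv v f x + b * dir_deriv v g x)"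
    if "degree_le l f" "degree_le l g" for v :: 'a and f g
    by (rule ext, rule dir_deriv_eqI)
       (intro has_derivative_add has_derivative_mult_right degree_le_has_derivative[OF that(1)]
          degree_le_has_derivative[OF that(2)])
  have "laplacian (\<lambda>x. a * p x + b * q x) x = a * laplacian p x + b * laplacian q x" for x
    unfolding laplacian_dir_deriv d[OF pp pq] fun_cong[OF d[OF degree_le_dir_deriv[OF pp] degree_le_dir_deriv[OF pq]]]
    by (simp add: sum.distrib sum_distrib_left)
  moreover have "real_polynomial_function (\<lambda>x. a * p x + b * q x)"
    by (intro real_polynomial_function.intros(2-) p(1) q(1))
  ultimately show ?thesis
    unfolding spherical_harmonic_def using p q
    by (intro exI[of _ "\<lambda>x. a * p x + b * q x"]) (auto simp: algebra_simps)
qed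

lemma spherical_harmonic_sum:
  assumes "\<And>m. m \<in> I \<Longrightarrow> spherical_harmonic l (Y m)"
  shows "spherical_harmonic l (\<lambda>x. \<Sum>m\<in>I. c m * Y m x)"
  using assms
proof (induction I rule: infinite_finite_induct)
  case (insert m I)
  then show ?case
    using spherical_harmonic_combination[of l "Y m" "\<lambda>x. \<Sum>m\<in>I. c m * Y m x" "c m" 1] by simp
qed (auto simp: spherical_harmonic_def laplacian_dir_deriv frechet_derivative_const
       intro!: exI[of _ "\<lambda>x. 0"])

lemma spherical_harmonic_continuous: "spherical_harmonic l Y \<Longrightarrow> continuous_on S_unit Y"
  unfolding spherical_harmonic_def using homogeneous_degree_le degree_le_continuous_on
  by (metis (no_types, lifting) continuous_on_cong)

text \<open>
  Transitivity on the sphere. Reflections are more convenient than rotations because they are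
  their own inverses.
\<close>

lemma ex_reflection:
  fixes x y :: "'a::euclidean_space"
  assumes "norm x = 1" "norm y = 1"
  obtains R where "orthogonal_transformation R" "\<And>z. R (R z) = z" "R x = y"
proof (cases "x = y")
  case True
  then show thesis by (intro that[of "\<lambda>z. z"]) auto
next
  case False
  define u where "u = x - y"
  have uu: "u \<bullet> u \<noteq> 0" using False by (simp add: u_def)
  define R where "R = (\<lambda>z. z - (2 * (z \<bullet> u) / (u \<bullet> u)) *\<^sub>R u)"
  have Ru: "R z \<bullet> u = - (z \<bullet> u)" for z using uu by (simp add: R_def inner_simps)
  show thesis
  proof (rule that)
    show RR: "R (R z) = z" for z
      using Ru[of z] by (subst R_def, simp only: Ru) (simp add: R_def)
    have "linear R"
      unfolding R_def by (rule linearI) (auto simp: inner_simps algebra_simps add_divide_distrib)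
    moreover have "R v \<bullet> R w = v \<bullet> w" for v w
    proof -
      have "R v \<bullet> R w = R v \<bullet> w - (2 * (w \<bullet> u) / (u \<bullet> u)) * (R v \<bullet> u)"
        by (subst (2) R_def) (simp add: inner_simps)
      also have "\<dots> = v \<bullet> w" unfolding Ru by (simp add: R_def inner_simps inner_commute)
      finally show ?thesis .
    qed
    ultimately show "orthogonal_transformation R" by (simp add: orthogonal_transformation_def)
    have xx: "x \<bullet> x = 1" "y \<bullet> y = 1" using assms by (simp_all add: dot_square_norm)
    then have "u \<bullet> u = 2 * (x \<bullet> u)" by (simp add: u_def inner_simps inner_commute)
    then show "R x = y" using uu by (simp add: R_def u_def)
  qed
qed

section \<open>The reproducing kernel of the spherical harmonics of one degree\<close>

lemma integral_double_sum:
  fixes f :: "'i \<Rightarrow> 'j \<Rightarrow> 'b \<Rightarrow> real"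
  assumes f: "\<And>i j. i \<in> I \<Longrightarrow> j \<in> J i \<Longrightarrow> integrable N (f i j)"
  shows "integrable N (\<lambda>x. \<Sum>i\<in>I. \<Sum>j\<in>J i. f i j x)"
    and "(LINT x|N. (\<Sum>i\<in>I. \<Sum>j\<in>J i. f i j x)) = (\<Sum>i\<in>I. \<Sum>j\<in>J i. LINT x|N. f i j x)"
proof -
  show "integrable N (\<lambda>x. \<Sum>i\<in>I. \<Sum>j\<in>J i. f i j x)"
    by (intro Bochner_Integration.integrable_sum f)
  have "(LINT x|N. (\<Sum>i\<in>I. \<Sum>j\<in>J i. f i j x)) = (\<Sum>i\<in>I. LINT x|N. (\<Sum>j\<in>J i. f i j x))"
    by (intro Bochner_Integration.integral_sum Bochner_Integration.integrable_sum f)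
  also have "\<dots> = (\<Sum>i\<in>I. \<Sum>j\<in>J i. LINT x|N. f i j x)"
    by (intro sum.cong refl Bochner_Integration.integral_sum f)
  finally show "(LINT x|N. (\<Sum>i\<in>I. \<Sum>j\<in>J i. f i j x)) = (\<Sum>i\<in>I. \<Sum>j\<in>J i. LINT x|N. f i j x)" .
qed

definition zonal :: "(nat \<Rightarrow> nat \<Rightarrow> 'a::euclidean_space \<Rightarrow> real) \<Rightarrow> nat \<Rightarrow> 'a \<Rightarrow> 'a \<Rightarrow> real" where
  "zonal S l x y = (\<Sum>m=1..harm_dim l DIM('a). S l m x * S l m y)"

locale harmonic_basis =
  fixes S :: "nat \<Rightarrow> nat \<Rightarrow> 'a::euclidean_space \<Rightarrow> real"
  assumes dim: "DIM('a) \<ge> 2" and S: "orthonormal_spherical_harmonics S"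
begin

lemma S_harmonic: "m \<in> {1..harm_dim l DIM('a)} \<Longrightarrow> spherical_harmonic l (S l m)"
  using S by (simp add: orthonormal_spherical_harmonics_def)

lemma S_span:
  assumes "spherical_harmonic l Y"
  obtains c where "\<And>x. x \<in> S_unit \<Longrightarrow> Y x = (\<Sum>m\<in>{1..harm_dim l DIM('a)}. c m * S l m x)"
  using S assms unfolding orthonormal_spherical_harmonics_def by metis

lemma S_continuous: "m \<in> {1..harm_dim l DIM('a)} \<Longrightarrow> continuous_on S_unit (S l m)"
  by (rule spherical_harmonic_continuous[OF S_harmonic])

lemma S_mult_integrable:
  "m \<in> {1..harm_dim l DIM('a)} \<Longrightarrow> m' \<in> {1..harm_dim l' DIM('a)} \<Longrightarrow> integrable sphere_measure (\<lambda>x. S l m x * S l' m' x)"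
  by (intro sphere_integrable_continuous continuous_on_mult S_continuous)

lemma S_orthonormal:
  assumes m: "m \<in> {1..harm_dim l DIM('a)}" "m' \<in> {1..harm_dim l' DIM('a)}"
  shows "(LINT x|sphere_measure. S l m x * S l' m' x) = (if l = l' \<and> m = m' then 1 else 0)"
proof (cases "l = l'")
  case True
  then show ?thesis using S m by (simp add: orthonormal_spherical_harmonics_def)
next
  case False
  obtain p where p: "real_polynomial_function p" "\<And>c x. p (c *\<^sub>R x) = c ^ l * p x"
    "\<And>x. laplacian p x = 0" "\<And>x. x \<in> S_unit \<Longrightarrow> S l m x = p x"
    using S_harmonic[OF m(1)] unfolding spherical_harmonic_def by blast
  obtain q where q: "real_polynomial_function q" "\<And>c x. q (c *\<^sub>R x) = c ^ l' * q x"
    "\<And>x. laplacian q x = 0" "\<And>x. x \<in> S_unit \<Longrightarrow> S l' m' x = q x"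
    using S_harmonic[OF m(2)] unfolding spherical_harmonic_def by blast
  have "(LINT x|sphere_measure. S l m x * S l' m' x) = (LINT x|sphere_measure. p x * q x)"
    by (rule Bochner_Integration.integral_cong) (auto simp: p(4) q(4))
  also have "\<dots> = 0"
    by (rule harmonic_orthogonal[OF dim False homogeneous_degree_le[OF p(1,2)] p(2,3) homogeneous_degree_le[OF q(1,2)] q(2,3)])
  finally show ?thesis using False by simp
qed

lemma zonal_reproducing:
  assumes Y: "spherical_harmonic l Y" and x: "x \<in> S_unit"
  shows "(LINT y|sphere_measure. zonal S l x y * Y y) = Y x"
proof -
  obtain c where c: "\<And>x. x \<in> S_unit \<Longrightarrow> Y x = (\<Sum>m\<in>{1..harm_dim l DIM('a)}. c m * S l m x)"
    using S_span[OF Y] by metis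
  have "(LINT y|sphere_measure. zonal S l x y * Y y)
      = (LINT y|sphere_measure. (\<Sum>m\<in>{1..harm_dim l DIM('a)}. \<Sum>k\<in>{1..harm_dim l DIM('a)}. S l m x * c k * (S l m y * S l k y)))"
  proof (rule Bochner_Integration.integral_cong[OF refl])
    fix y :: 'a assume "y \<in> space sphere_measure"
    then have y: "y \<in> S_unit" by simp
    show "zonal S l x y * Y y
        = (\<Sum>m\<in>{1..harm_dim l DIM('a)}. \<Sum>k\<in>{1..harm_dim l DIM('a)}. S l m x * c k * (S l m y * S l k y))"
      unfolding zonal_def c[OF y] sum_product by (intro sum.cong) (auto simp: mult_ac)
  qed
  also have "\<dots> = (\<Sum>m\<in>{1..harm_dim l DIM('a)}. \<Sum>k\<in>{1..harm_dim l DIM('a)}.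
      (LINT y|sphere_measure. S l m x * c k * (S l m y * S l k y)))"
    by (intro integral_double_sum(2) integrable_mult_right S_mult_integrable)
  also have "\<dots> = (\<Sum>m\<in>{1..harm_dim l DIM('a)}. \<Sum>k\<in>{1..harm_dim l DIM('a)}. S l m x * c k * (if m = k then 1 else 0))"
    by (intro sum.cong refl, subst integral_mult_right_zero, subst S_orthonormal) auto
  also have "\<dots> = Y x" using c[OF x] by (simp add: if_distrib sum.delta mult.commute cong: if_cong)
  finally show ?thesis .
qed

text \<open>
  A kernel in the space of harmonics of degree \<open>l\<close> is determined by the reproducing property. As
  this space and the surface measure are invariant, the reflected kernel has this property too.
\<close>

lemma zonal_reflection:
  assumes R: "orthogonal_transformation R" "\<And>z. R (R z) = z" and x: "x \<in> S_unit" and y: "y \<in> S_unit"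
  shows "zonal S l (R x) (R y) = zonal S l x y"
proof -
  define K where "K = (\<lambda>y. 1 * zonal S l (R x) (R y) + (- 1) * zonal S l x y)"
  have nR: "R z \<in> S_unit" if "z \<in> S_unit" for z
    using that orthogonal_transformation_norm[OF R(1)] by simp
  have Z: "spherical_harmonic l (zonal S l z)" for z
    unfolding zonal_def[abs_def] by (intro spherical_harmonic_sum S_harmonic)
  have ZR: "spherical_harmonic l (\<lambda>y. zonal S l (R x) (R y))"
    by (rule spherical_harmonic_orthogonal[OF Z R(1)])
  have "spherical_harmonic l K"
    unfolding K_def by (rule spherical_harmonic_combination[OF ZR Z])
  then obtain c where c: "\<And>y. y \<in> S_unit \<Longrightarrow> K y = (\<Sum>m\<in>{1..harm_dim l DIM('a)}. c m * S l m y)"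
    using S_span by metis
  have "c m = 0" if m: "m \<in> {1..harm_dim l DIM('a)}" for m
  proof -
    have "(LINT y|sphere_measure. K y * S l m y)
        = (LINT y|sphere_measure. (\<Sum>k\<in>{1..harm_dim l DIM('a)}. c k * (S l k y * S l m y)))"
      by (rule Bochner_Integration.integral_cong) (simp_all add: c sum_distrib_right mult.assoc)
    also have "\<dots> = (\<Sum>k\<in>{1..harm_dim l DIM('a)}. c k * (if k = m then 1 else 0))"
      using m by (simp add: S_mult_integrable S_orthonormal cong: sum.cong_simp)
    also have "\<dots> = c m" using m by (simp add: if_distrib sum.delta cong: if_cong)
    finally have cm: "(LINT y|sphere_measure. K y * S l m y) = c m" .
    have i: "integrable sphere_measure (\<lambda>y. zonal S l (R x) (R y) * S l m y)"
      "integrable sphere_measure (\<lambda>y. zonal S l x y * S l m y)"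
      by (intro sphere_integrable_continuous continuous_on_mult S_continuous[OF m]
          spherical_harmonic_continuous[OF ZR] spherical_harmonic_continuous[OF Z])+
    have "(LINT y|sphere_measure. K y * S l m y)
        = (LINT y|sphere_measure. zonal S l (R x) (R y) * S l m y - zonal S l x y * S l m y)"
      by (rule Bochner_Integration.integral_cong) (auto simp: K_def algebra_simps)
    also have "\<dots> = (LINT y|sphere_measure. zonal S l (R x) (R y) * S l m y)
        - (LINT y|sphere_measure. zonal S l x y * S l m y)"
      using i by simp
    also have "(LINT y|sphere_measure. zonal S l x y * S l m y) = S l m x"
      by (rule zonal_reproducing[OF S_harmonic[OF m] x])
    also have "(LINT y|sphere_measure. zonal S l (R x) (R y) * S l m y)
        = (LINT y|sphere_measure. zonal S l (R x) (R y) * S l m (R (R y)))" by (simp add: R(2))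
    also have "\<dots> = (LINT y|sphere_measure. zonal S l (R x) y * S l m (R y))"
      by (rule sphere_integral_orthogonal[OF R(1), of "\<lambda>y. zonal S l (R x) y * S l m (R y)"])
         (intro borel_measurable_times sphere_measurable_continuous spherical_harmonic_continuous[OF Z]
            spherical_harmonic_continuous[OF spherical_harmonic_orthogonal[OF S_harmonic[OF m] R(1)]])
    also have "\<dots> = S l m (R (R x))"
      by (rule zonal_reproducing[OF spherical_harmonic_orthogonal[OF S_harmonic[OF m] R(1)] nR[OF x]])
    finally show ?thesis using cm R(2) by simp
  qed
  then have "K y = 0" using c[OF y] by simp
  then show ?thesis by (simp add: K_def)
qed

text \<open>
  By invariance the diagonal is constant, and its integral is the number of basis elements. Thus
  the degree \<open>l\<close> contributes \<open>A l * harm_dim l d / area\<close> to the variance at every point, which is at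
  most of order \<open>A l * l ^ (d - 2)\<close>. A bound on single harmonics would lose a factor \<open>l ^ (d - 2)\<close>.
\<close>

lemma zonal_diagonal:
  assumes x: "x \<in> S_unit"
  shows "zonal S l x x = real (harm_dim l DIM('a)) / measure (sphere_measure :: 'a measure) S_unit"
proof -
  have const: "zonal S l y y = zonal S l x x" if y: "y \<in> S_unit" for y
  proof -
    obtain R where R: "orthogonal_transformation R" "\<And>z. R (R z) = z" "R x = y"
      using ex_reflection[of x y] x y by auto
    show ?thesis using zonal_reflection[OF R(1,2) x x] R(3) by simp
  qed
  have "(LINT y|sphere_measure. zonal S l y y) = (\<Sum>m\<in>{1..harm_dim l DIM('a)}. 1)"
    unfolding zonal_def by (simp add: S_mult_integrable S_orthonormal cong: sum.cong_simp)
  moreover have "(LINT y|sphere_measure. zonal S l y y)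
      = (LINT y|(sphere_measure :: 'a measure). zonal S l x x)"
    by (rule Bochner_Integration.integral_cong) (auto simp: const)
  ultimately have "measure (sphere_measure :: 'a measure) S_unit * zonal S l x x = real (harm_dim l DIM('a))"
    by simp
  then show ?thesis using sphere_measure_pos[OF dim] by (simp add: field_simps)
qed

end

lemma harm_dim_bound:
  assumes "d \<ge> 2"
  obtains K where "\<And>l. harm_dim l d \<le> K * (l + 1) ^ (d - 2)"
proof (cases "d = 2")
  case True
  have "harm_dim l 2 \<le> 2" for l
  proof (cases l)
    case (Suc k)
    have "2 * l * fact (l - 1) = 2 * fact l" using Suc by simp
    then have "(2 * l * fact (l - 1)) div fact l = 2" by (metis fact_nonzero nonzero_mult_div_cancel_right)
    moreover have "harm_dim l 2 = (2 * l * fact (l - 1)) div fact l" using Suc by (simp add: harm_dim_def)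
    ultimately show ?thesis by simp
  qed (simp add: harm_dim_def)
  then show thesis using that[of 2] True by simp
next
  case False
  define e where "e = d - 3"
  have d: "d = e + 3" using assms False by (simp add: e_def)
  have fact: "fact (l + n) \<le> fact l * ((l + 1) ^ n * fact n)" for l n :: nat
  proof (induction n)
    case (Suc n)
    have "fact (l + Suc n) = (l + Suc n) * fact (l + n)" by simp
    also have "\<dots> \<le> ((l + 1) * Suc n) * (fact l * ((l + 1) ^ n * fact n))"
      by (rule mult_mono[OF _ Suc]) auto
    also have "\<dots> = fact l * ((l + 1) ^ Suc n * fact (Suc n))" by (simp add: algebra_simps)
    finally show ?case .
  qed simp
  have "harm_dim l d \<le> (e + 2) * fact e * (l + 1) ^ (d - 2)" for l
  proof -
    have "(2 * l + d - 2) * fact (l + d - 3) \<le> ((e + 2) * (l + 1)) * (fact l * ((l + 1) ^ e * fact e))"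
      using fact[of l e] by (intro mult_mono) (auto simp: d)
    also have "\<dots> = (e + 2) * fact e * (l + 1) ^ (d - 2) * fact l" by (simp add: d algebra_simps)
    also have "\<dots> \<le> (e + 2) * fact e * (l + 1) ^ (d - 2) * (fact (d - 2) * fact l)"
      by (intro mult_left_mono) auto
    finally have "((2 * l + d - 2) * fact (l + d - 3)) div (fact (d - 2) * fact l)
       \<le> ((e + 2) * fact e * (l + 1) ^ (d - 2) * (fact (d - 2) * fact l)) div (fact (d - 2) * fact l)"
      by (rule div_le_mono)
    then show ?thesis using False by (simp add: harm_dim_def)
  qed
  then show thesis by (rule that)
qed

section \<open>Square integrable and Gaussian random variables\<close>

text \<open>The moment of order \<open>2 * q\<close> of the standard normal distribution.\<close>

definition gauss_const :: "nat \<Rightarrow> real" where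
  "gauss_const q = fact (2 * q) / (2 ^ q * fact q)"

lemma gaussian_even_moment:
  assumes M: "prob_space M" and X: "gaussian_rv M X" and mean: "(LINT \<omega>|M. X \<omega>) = 0"
  shows "(\<integral>\<^sup>+ \<omega>. ennreal (X \<omega> ^ (2 * q)) \<partial>M) = ennreal (gauss_const q * (LINT \<omega>|M. (X \<omega>)\<^sup>2) ^ q)"
proof -
  interpret prob_space M by fact
  obtain \<mu> s where [measurable]: "X \<in> borel_measurable M" and s: "0 \<le> s" and
    D: "distr M borel X = (if s = 0 then return borel \<mu> else density lborel (\<lambda>x. ennreal (normal_density \<mu> s x)))"
    using X unfolding gaussian_rv_def by blast
  have E: "(LINT \<omega>|M. f (X \<omega>)) = (LINT x|distr M borel X. f x)" if "f \<in> borel_measurable borel" for f :: "real \<Rightarrow> real"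
    using that by (simp add: integral_distr)
  have N: "(\<integral>\<^sup>+ \<omega>. ennreal (X \<omega> ^ (2 * q)) \<partial>M) = (\<integral>\<^sup>+ x. ennreal (x ^ (2 * q)) \<partial>distr M borel X)"
    by (simp add: nn_integral_distr)
  show ?thesis
  proof (cases "s = 0")
    case True
    then have D: "distr M borel X = return borel \<mu>" using D by simp
    have "\<mu> = 0" using E[of "\<lambda>x. x"] mean by (simp add: D integral_return)
    moreover have "(LINT \<omega>|M. (X \<omega>)\<^sup>2) = \<mu>\<^sup>2" using E[of "\<lambda>x. x\<^sup>2"] by (simp add: D integral_return)
    moreover have "(\<integral>\<^sup>+ \<omega>. ennreal (X \<omega> ^ (2 * q)) \<partial>M) = ennreal (\<mu> ^ (2 * q))"
      unfolding N D by (simp add: nn_integral_return)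
    ultimately show ?thesis by (cases q) (auto simp: gauss_const_def)
  next
    case False
    then have s: "0 < s" and D: "distr M borel X = density lborel (\<lambda>x. ennreal (normal_density \<mu> s x))"
      using s D by auto
    have E': "(LINT \<omega>|M. f (X \<omega>)) = (LINT x|lborel. normal_density \<mu> s x * f x)"
      if "f \<in> borel_measurable borel" for f :: "real \<Rightarrow> real"
      unfolding E[OF that] D using that by (subst integral_density) auto
    have mu: "\<mu> = 0"
      using E'[of "\<lambda>x. x"] mean normal_moment_nz_1[OF s, of \<mu>] by (simp add: has_bochner_integral_integral_eq)
    have mom: "has_bochner_integral lborel (\<lambda>x. normal_density \<mu> s x * x ^ (2 * k)) (gauss_const k * (s\<^sup>2) ^ k)" for k
      using normal_moment_even[OF s, of \<mu> k] by (simp add: mu gauss_const_def power_divide)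
    have "(LINT \<omega>|M. (X \<omega>)\<^sup>2) = s\<^sup>2"
      using E'[of "\<lambda>x. x\<^sup>2"] has_bochner_integral_integral_eq[OF mom[of 1]] by (simp add: gauss_const_def)
    moreover have "(\<integral>\<^sup>+ \<omega>. ennreal (X \<omega> ^ (2 * q)) \<partial>M) = ennreal (gauss_const q * (s\<^sup>2) ^ q)"
    proof -
      have "(\<integral>\<^sup>+ \<omega>. ennreal (X \<omega> ^ (2 * q)) \<partial>M)
          = (\<integral>\<^sup>+ x. ennreal (normal_density \<mu> s x * x ^ (2 * q)) \<partial>lborel)"
        unfolding N D by (subst nn_integral_density) (auto simp: ennreal_mult')
      also have "\<dots> = ennreal (gauss_const q * (s\<^sup>2) ^ q)"
        using mom[of q] by (subst nn_integral_eq_integral)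
          (auto simp: has_bochner_integral_iff zero_le_even_power)
      finally show ?thesis .
    qed
    ultimately show ?thesis by simp
  qed
qed

definition square_integrable :: "'w measure \<Rightarrow> ('w \<Rightarrow> real) \<Rightarrow> bool" where
  "square_integrable M X \<longleftrightarrow> X \<in> borel_measurable M \<and> integrable M (\<lambda>\<omega>. (X \<omega>)\<^sup>2)"

lemma square_integrable_mult:
  assumes "square_integrable M X" "square_integrable M Y"
  shows "integrable M (\<lambda>\<omega>. X \<omega> * Y \<omega>)"
proof (rule Bochner_Integration.integrable_bound)
  show "integrable M (\<lambda>\<omega>. (X \<omega>)\<^sup>2 + (Y \<omega>)\<^sup>2)"
    using assms by (simp add: square_integrable_def)
  show "(\<lambda>\<omega>. X \<omega> * Y \<omega>) \<in> borel_measurable M"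
    using assms by (intro borel_measurable_times) (auto simp: square_integrable_def)
  show "AE \<omega> in M. norm (X \<omega> * Y \<omega>) \<le> norm ((X \<omega>)\<^sup>2 + (Y \<omega>)\<^sup>2)"
  proof (rule AE_I2)
    fix \<omega>
    have "2 * (\<bar>X \<omega>\<bar> * \<bar>Y \<omega>\<bar>) \<le> (X \<omega>)\<^sup>2 + (Y \<omega>)\<^sup>2"
      using sum_squares_bound[of "\<bar>X \<omega>\<bar>" "\<bar>Y \<omega>\<bar>"] by (simp add: mult.assoc)
    moreover have "0 \<le> \<bar>X \<omega>\<bar> * \<bar>Y \<omega>\<bar>" by simp
    ultimately have "\<bar>X \<omega>\<bar> * \<bar>Y \<omega>\<bar> \<le> (X \<omega>)\<^sup>2 + (Y \<omega>)\<^sup>2" by linarith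
    then show "norm (X \<omega> * Y \<omega>) \<le> norm ((X \<omega>)\<^sup>2 + (Y \<omega>)\<^sup>2)" by (simp add: abs_mult)
  qed
qed

lemma square_integrable_add:
  assumes "square_integrable M X" "square_integrable M Y"
  shows "square_integrable M (\<lambda>\<omega>. X \<omega> + Y \<omega>)"
proof -
  have "integrable M (\<lambda>\<omega>. (X \<omega>)\<^sup>2 + 2 * (X \<omega> * Y \<omega>) + (Y \<omega>)\<^sup>2)"
    using assms square_integrable_mult[OF assms] by (simp add: square_integrable_def)
  moreover have "(\<lambda>\<omega>. X \<omega> + Y \<omega>) \<in> borel_measurable M"
    using assms by (intro borel_measurable_add) (auto simp: square_integrable_def)
  ultimately show ?thesis by (simp add: square_integrable_def power2_sum mult_ac add_ac)
qed

lemma square_integrable_cmult: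
  "square_integrable M X \<Longrightarrow> square_integrable M (\<lambda>\<omega>. c * X \<omega>)"
  unfolding square_integrable_def power_mult_distrib
  by (intro conjI borel_measurable_times borel_measurable_const integrable_mult_right) auto

lemma square_integrable_diff:
  "square_integrable M X \<Longrightarrow> square_integrable M Y \<Longrightarrow> square_integrable M (\<lambda>\<omega>. X \<omega> - Y \<omega>)"
  using square_integrable_add[OF _ square_integrable_cmult[of M Y "-1"], of X] by simp

lemma square_integrable_sum:
  "(\<And>i. i \<in> I \<Longrightarrow> square_integrable M (X i)) \<Longrightarrow> square_integrable M (\<lambda>\<omega>. \<Sum>i\<in>I. X i \<omega>)"
proof (induction I rule: infinite_finite_induct)
  case (insert i I)
  then show ?case using square_integrable_add[of M "X i" "\<lambda>\<omega>. \<Sum>i\<in>I. X i \<omega>"] by simp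
qed (auto simp: square_integrable_def)

lemma integral_square_diff:
  assumes X: "square_integrable M X" and Y: "square_integrable M Y"
  shows "(LINT \<omega>|M. (X \<omega> - Y \<omega>)\<^sup>2)
    = (LINT \<omega>|M. (X \<omega>)\<^sup>2) - 2 * (LINT \<omega>|M. X \<omega> * Y \<omega>) + (LINT \<omega>|M. (Y \<omega>)\<^sup>2)"
proof -
  have "(LINT \<omega>|M. (X \<omega> - Y \<omega>)\<^sup>2) = (LINT \<omega>|M. (X \<omega>)\<^sup>2 - 2 * (X \<omega> * Y \<omega>) + (Y \<omega>)\<^sup>2)"
    by (rule Bochner_Integration.integral_cong) (auto simp: power2_diff)
  also have "\<dots> = (LINT \<omega>|M. (X \<omega>)\<^sup>2) - 2 * (LINT \<omega>|M. X \<omega> * Y \<omega>) + (LINT \<omega>|M. (Y \<omega>)\<^sup>2)"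
    using X Y square_integrable_mult[OF X Y] by (simp add: square_integrable_def)
  finally show ?thesis .
qed

text \<open>Bessel's inequality for a single unit vector.\<close>

lemma square_integral_product_le:
  assumes f: "square_integrable M f" and g: "square_integrable M g" and g1: "(LINT x|M. (g x)\<^sup>2) = 1"
  shows "(LINT x|M. f x * g x)\<^sup>2 \<le> (LINT x|M. (f x)\<^sup>2)"
proof -
  define t where "t = (LINT x|M. f x * g x)"
  have "0 \<le> (LINT x|M. (f x - t * g x)\<^sup>2)" by simp
  also have "\<dots> = (LINT x|M. (f x)\<^sup>2) - 2 * (LINT x|M. f x * (t * g x)) + (LINT x|M. (t * g x)\<^sup>2)"
    by (rule integral_square_diff[OF f square_integrable_cmult[OF g]])
  also have "(LINT x|M. f x * (t * g x)) = t * t"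
    unfolding mult.left_commute[of _ t] by (simp add: t_def)
  also have "(LINT x|M. (t * g x)\<^sup>2) = t * t"
    by (simp add: power_mult_distrib g1) (simp add: power2_eq_square)
  finally show ?thesis by (simp add: t_def power2_eq_square)
qed

text \<open>
  Moment bounds for centered Gaussian variables pass to limits in mean square: along a subsequence
  the limit is pointwise, and Fatou's lemma applies. The factor 2 comes from the crude estimate
  \<open>Y\<^sup>2 \<le> 2 X\<^sup>2 + 2 (X - Y)\<^sup>2\<close>; a constant factor is harmless.
\<close>

lemma even_moment_L2_limit:
  assumes X: "square_integrable M X" and Y: "\<And>n. square_integrable M (Y n)"
    and lim: "(\<lambda>n. LINT \<omega>|M. (X \<omega> - Y n \<omega>)\<^sup>2) \<longlonglongrightarrow> 0"
    and mom: "\<And>n. (\<integral>\<^sup>+ \<omega>. ennreal (Y n \<omega> ^ (2 * q)) \<partial>M) = ennreal (C * (LINT \<omega>|M. (Y n \<omega>)\<^sup>2) ^ q)"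
    and C: "0 \<le> C"
  shows "(\<integral>\<^sup>+ \<omega>. ennreal (X \<omega> ^ (2 * q)) \<partial>M) \<le> ennreal (C * (2 * (LINT \<omega>|M. (X \<omega>)\<^sup>2)) ^ q)"
proof -
  have [measurable]: "X \<in> borel_measurable M" "\<And>n. Y n \<in> borel_measurable M"
    using X Y by (auto simp: square_integrable_def)
  have d2: "integrable M (\<lambda>\<omega>. (X \<omega> - Y n \<omega>)\<^sup>2)" for n
    using square_integrable_diff[OF X Y] by (simp add: square_integrable_def)
  have "\<exists>r::nat\<Rightarrow>nat. strict_mono r \<and> (AE \<omega> in M. (\<lambda>n. (X \<omega> - Y (r n) \<omega>)\<^sup>2) \<longlonglongrightarrow> 0)"
    by (rule tendsto_L1_AE_subseq) (use d2 lim in auto)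
  then obtain r :: "nat \<Rightarrow> nat" where r: "strict_mono r"
    "AE \<omega> in M. (\<lambda>n. (X \<omega> - Y (r n) \<omega>)\<^sup>2) \<longlonglongrightarrow> 0" by blast
  define v where "v = (LINT \<omega>|M. (X \<omega>)\<^sup>2)"
  define e where "e = (\<lambda>n. LINT \<omega>|M. (X \<omega> - Y n \<omega>)\<^sup>2)"
  have Yv: "(LINT \<omega>|M. (Y n \<omega>)\<^sup>2) \<le> 2 * v + 2 * e n" for n
  proof -
    have "(LINT \<omega>|M. (Y n \<omega>)\<^sup>2) \<le> (LINT \<omega>|M. 2 * (X \<omega>)\<^sup>2 + 2 * (X \<omega> - Y n \<omega>)\<^sup>2)"
    proof (rule integral_mono)
      fix \<omega>
      have "0 \<le> (2 * X \<omega> - Y n \<omega>)\<^sup>2" by simp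
      then show "(Y n \<omega>)\<^sup>2 \<le> 2 * (X \<omega>)\<^sup>2 + 2 * (X \<omega> - Y n \<omega>)\<^sup>2"
        by (simp add: power2_eq_square algebra_simps)
    qed (use X Y[of n] d2[of n] in \<open>auto simp: square_integrable_def\<close>)
    then show ?thesis using X d2[of n] by (simp add: v_def e_def square_integrable_def)
  qed
  have "(\<integral>\<^sup>+ \<omega>. ennreal (X \<omega> ^ (2 * q)) \<partial>M)
      \<le> (\<integral>\<^sup>+ \<omega>. liminf (\<lambda>n. ennreal (Y (r n) \<omega> ^ (2 * q))) \<partial>M)"
  proof (rule nn_integral_mono_AE, use r(2) in eventually_elim)
    fix \<omega> assume "(\<lambda>n. (X \<omega> - Y (r n) \<omega>)\<^sup>2) \<longlonglongrightarrow> 0"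
    then have "(\<lambda>n. sqrt ((X \<omega> - Y (r n) \<omega>)\<^sup>2)) \<longlonglongrightarrow> sqrt 0" by (rule tendsto_real_sqrt)
    then have "(\<lambda>n. X \<omega> - Y (r n) \<omega>) \<longlonglongrightarrow> 0" by (simp add: tendsto_rabs_zero_iff)
    from tendsto_diff[OF tendsto_const[of "X \<omega>"] this]
    have "(\<lambda>n. Y (r n) \<omega>) \<longlonglongrightarrow> X \<omega>" by simp
    then have "(\<lambda>n. ennreal (Y (r n) \<omega> ^ (2 * q))) \<longlonglongrightarrow> ennreal (X \<omega> ^ (2 * q))"
      by (intro tendsto_ennrealI tendsto_power)
    then show "ennreal (X \<omega> ^ (2 * q)) \<le> liminf (\<lambda>n. ennreal (Y (r n) \<omega> ^ (2 * q)))"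
      by (metis lim_imp_Liminf order_refl sequentially_bot)
  qed
  also have "\<dots> \<le> liminf (\<lambda>n. \<integral>\<^sup>+ \<omega>. ennreal (Y (r n) \<omega> ^ (2 * q)) \<partial>M)"
    by (rule nn_integral_liminf) measurable
  also have "\<dots> \<le> liminf (\<lambda>n. ennreal (C * (2 * v + 2 * e (r n)) ^ q))"
    unfolding mom using Yv C
    by (intro Liminf_mono always_eventually allI ennreal_leI mult_left_mono power_mono) auto
  also have "(\<lambda>n. ennreal (C * (2 * v + 2 * e (r n)) ^ q)) \<longlonglongrightarrow> ennreal (C * (2 * v + 2 * 0) ^ q)"
    using LIMSEQ_subseq_LIMSEQ[OF lim r(1)]
    by (intro tendsto_ennrealI tendsto_intros) (simp add: o_def e_def)
  then have "liminf (\<lambda>n. ennreal (C * (2 * v + 2 * e (r n)) ^ q)) = ennreal (C * (2 * v) ^ q)"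
    using lim_imp_Liminf[OF sequentially_bot] by simp
  finally show ?thesis by (simp add: v_def)
qed

section \<open>The Karhunen-Loeve expansion\<close>

text \<open>
  Of the coefficients only the covariances are given. Gaussian moment bounds for their linear
  combinations are derived from the Gaussian law of the field.
\<close>

locale karhunen_loeve = harmonic_basis S + prob_space M
  for S :: "nat \<Rightarrow> nat \<Rightarrow> 'a::euclidean_space \<Rightarrow> real" and M :: "'w measure" +
  fixes T :: "'w \<Rightarrow> 'a \<Rightarrow> real" and A :: "nat \<Rightarrow> real" and a :: "nat \<Rightarrow> nat \<Rightarrow> 'w \<Rightarrow> real"
  assumes field: "centered_isotropic_gaussian_field M T"
    and A_nonneg: "0 \<le> A l"
    and a_square: "m \<in> {1..harm_dim l DIM('a)} \<Longrightarrow> square_integrable M (a l m)"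
    and a_cov: "m \<in> {1..harm_dim l DIM('a)} \<Longrightarrow> m' \<in> {1..harm_dim l' DIM('a)} \<Longrightarrow>
      (LINT \<omega>|M. a l m \<omega> * a l' m' \<omega>) = (if l = l' \<and> m = m' then A l else 0)"
    and expansion: "(\<lambda>L. \<integral>\<^sup>+ (\<omega>, x). ennreal ((T \<omega> x -
        (\<Sum>l\<le>L. \<Sum>m=1..harm_dim l DIM('a). a l m \<omega> * S l m x))\<^sup>2) \<partial>(M \<Otimes>\<^sub>M sphere_measure)) \<longlonglongrightarrow> 0"
begin

sublocale product: pair_sigma_finite M "sphere_measure :: 'a measure"
  by (intro pair_sigma_finite.intro sigma_finite_measure_axioms sphere.sigma_finite_measure_axioms)

definition area :: real where
  "area = measure (sphere_measure :: 'a measure) S_unit"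

lemma area_pos: "0 < area"
  unfolding area_def by (rule sphere_measure_pos[OF dim])

lemma emeasure_sphere_area: "emeasure (sphere_measure :: 'a measure) S_unit = ennreal area"
  by (simp add: area_def sphere.emeasure_eq_measure)

lemma T_measurable [measurable]: "(\<lambda>(\<omega>, x). T \<omega> x) \<in> borel_measurable (M \<Otimes>\<^sub>M sphere_measure)"
proof -
  have "sets (M \<Otimes>\<^sub>M (sphere_measure :: 'a measure)) = sets (M \<Otimes>\<^sub>M restrict_space borel S_unit)"
    by (intro sets_pair_measure_cong sets_sphere_measure refl)
  then show ?thesis
    using field unfolding centered_isotropic_gaussian_field_def random_field_def
    by (simp cong: measurable_cong_sets)
qed

lemma T_square: "x \<in> S_unit \<Longrightarrow> square_integrable M (\<lambda>\<omega>. T \<omega> x)"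
  using measurable_Pair1[OF T_measurable, of x] field
  unfolding square_integrable_def centered_isotropic_gaussian_field_def
  by (auto simp: split_beta')

definition cov :: "'a \<Rightarrow> 'a \<Rightarrow> real" where
  "cov x y = (LINT \<omega>|M. T \<omega> x * T \<omega> y)"

lemma cov_orthogonal:
  assumes R: "orthogonal_transformation R" and xy: "x \<in> S_unit" "y \<in> S_unit"
  shows "cov (R x) (R y) = cov x y"
proof -
  obtain \<phi> where \<phi>: "\<And>x y. x \<in> S_unit \<Longrightarrow> y \<in> S_unit \<Longrightarrow> cov x y = \<phi> (geodist x y)"
    using field unfolding centered_isotropic_gaussian_field_def cov_def by blast
  have "R x \<in> S_unit" "R y \<in> S_unit" using xy by (auto simp: orthogonal_transformation_norm[OF R])
  moreover have "geodist (R x) (R y) = geodist x y"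
    using R by (simp add: geodist_def orthogonal_transformation_def)
  ultimately show ?thesis using \<phi> xy by simp
qed

text \<open>By isotropy the variance is the same at all points.\<close>

definition variance0 :: real where
  "variance0 = cov (SOME x. x \<in> S_unit) (SOME x. x \<in> S_unit)"

lemma ex_unit: "\<exists>x :: 'a. x \<in> S_unit"
  using vector_choose_size[of 1] by auto

lemma T_variance: assumes x: "x \<in> S_unit" shows "(LINT \<omega>|M. (T \<omega> x)\<^sup>2) = variance0"
proof -
  define z :: 'a where "z = (SOME x. x \<in> S_unit)"
  have z: "z \<in> S_unit" unfolding z_def by (rule someI_ex[OF ex_unit])
  obtain R where R: "orthogonal_transformation R" "\<And>z. R (R z) = z" "R z = x"
    using ex_reflection[of z x] x z by auto
  have "cov x x = cov z z" using cov_orthogonal[OF R(1) z z] R(3) by simp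
  then show ?thesis by (simp add: variance0_def cov_def z_def power2_eq_square)
qed

lemma product_integrable_sections:
  fixes f :: "'w \<Rightarrow> 'a \<Rightarrow> real"
  assumes f: "case_prod f \<in> borel_measurable (M \<Otimes>\<^sub>M (sphere_measure :: 'a measure))"
    and nonneg: "\<And>\<omega> y. 0 \<le> f \<omega> y"
    and int: "\<And>y. y \<in> S_unit \<Longrightarrow> integrable M (\<lambda>\<omega>. f \<omega> y)"
    and le: "\<And>y. y \<in> S_unit \<Longrightarrow> (LINT \<omega>|M. f \<omega> y) \<le> c"
  shows "integrable (M \<Otimes>\<^sub>M (sphere_measure :: 'a measure)) (case_prod f)"
proof (rule integrableI_bounded[OF f])
  have "(\<integral>\<^sup>+ z. ennreal (norm (case_prod f z)) \<partial>(M \<Otimes>\<^sub>M (sphere_measure :: 'a measure)))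
      = (\<integral>\<^sup>+ y. \<integral>\<^sup>+ \<omega>. ennreal (f \<omega> y) \<partial>M \<partial>sphere_measure)"
    using f nonneg by (subst product.nn_integral_snd[symmetric]) auto
  also have "\<dots> \<le> (\<integral>\<^sup>+ y. ennreal c \<partial>(sphere_measure :: 'a measure))"
  proof (rule nn_integral_mono)
    fix y :: 'a assume "y \<in> space sphere_measure"
    then have y: "y \<in> S_unit" by simp
    have "(\<integral>\<^sup>+ \<omega>. ennreal (f \<omega> y) \<partial>M) = ennreal (LINT \<omega>|M. f \<omega> y)"
      by (rule nn_integral_eq_integral[OF int[OF y]]) (simp add: nonneg)
    then show "(\<integral>\<^sup>+ \<omega>. ennreal (f \<omega> y) \<partial>M) \<le> ennreal c" using le[OF y] by (simp add: ennreal_leI)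
  qed
  also have "\<dots> < \<infinity>" by (simp add: emeasure_sphere_area ennreal_mult_less_top)
  finally show "(\<integral>\<^sup>+ z. ennreal (norm (case_prod f z)) \<partial>(M \<Otimes>\<^sub>M (sphere_measure :: 'a measure))) < \<infinity>" .
qed

lemma S_measurable: "m \<in> {1..harm_dim l DIM('a)} \<Longrightarrow> S l m \<in> borel_measurable sphere_measure"
  by (rule sphere_measurable_continuous[OF S_continuous])

lemma S_square: "m \<in> {1..harm_dim l DIM('a)} \<Longrightarrow> square_integrable sphere_measure (S l m)"
  using S_mult_integrable[of m l m l] S_measurable by (simp add: square_integrable_def power2_eq_square)

lemma T_square_product: "integrable (M \<Otimes>\<^sub>M (sphere_measure :: 'a measure)) (\<lambda>(\<omega>, y). (T \<omega> y)\<^sup>2)"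
  by (rule product_integrable_sections[where c = variance0])
     (use T_square T_variance in \<open>auto simp: square_integrable_def\<close>)

lemma weighted_product_integrable:
  assumes W: "square_integrable M W" and m: "m \<in> {1..harm_dim l DIM('a)}"
  shows "integrable (M \<Otimes>\<^sub>M (sphere_measure :: 'a measure)) (\<lambda>(\<omega>, y). W \<omega> * T \<omega> y * S l m y)"
proof -
  have [measurable]: "W \<in> borel_measurable M" "S l m \<in> borel_measurable sphere_measure"
    using W S_measurable[OF m] by (auto simp: square_integrable_def)
  have W2: "integrable (M \<Otimes>\<^sub>M (sphere_measure :: 'a measure)) (\<lambda>(\<omega>, y). (W \<omega>)\<^sup>2)"
    by (rule product_integrable_sections[where c = "LINT \<omega>|M. (W \<omega>)\<^sup>2"])
       (use W in \<open>auto simp: square_integrable_def\<close>)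
  have "square_integrable (M \<Otimes>\<^sub>M sphere_measure) (\<lambda>(\<omega>, y :: 'a). W \<omega>)"
    "square_integrable (M \<Otimes>\<^sub>M sphere_measure) (\<lambda>(\<omega>, y). T \<omega> y)"
    using W2 T_square_product by (auto simp: square_integrable_def split_beta')
  from square_integrable_mult[OF this]
  have i: "integrable (M \<Otimes>\<^sub>M sphere_measure) (\<lambda>(\<omega>, y). W \<omega> * T \<omega> y)" by (simp add: split_beta')
  obtain B where B: "0 < B" "\<And>x. x \<in> S_unit \<Longrightarrow> \<bar>S l m x\<bar> \<le> B"
    using sphere_continuous_bounded[OF S_continuous[OF m]] by metis
  show ?thesis
  proof (rule Bochner_Integration.integrable_bound[OF integrable_mult_right[OF i, of B]])
    show "(\<lambda>(\<omega>, y). W \<omega> * T \<omega> y * S l m y) \<in> borel_measurable (M \<Otimes>\<^sub>M sphere_measure)" by measurable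
    show "AE z in M \<Otimes>\<^sub>M sphere_measure. norm (case z of (\<omega>, y) \<Rightarrow> W \<omega> * T \<omega> y * S l m y)
        \<le> norm (B * (case z of (\<omega>, y) \<Rightarrow> W \<omega> * T \<omega> y))"
    proof (rule AE_I2)
      fix z assume "z \<in> space (M \<Otimes>\<^sub>M (sphere_measure :: 'a measure))"
      then have "snd z \<in> S_unit" by (auto simp: space_pair_measure)
      then have "\<bar>W (fst z) * T (fst z) (snd z)\<bar> * \<bar>S l m (snd z)\<bar> \<le> \<bar>W (fst z) * T (fst z) (snd z)\<bar> * B"
        using B(2) by (intro mult_left_mono) auto
      then show "norm (case z of (\<omega>, y) \<Rightarrow> W \<omega> * T \<omega> y * S l m y)
        \<le> norm (B * (case z of (\<omega>, y) \<Rightarrow> W \<omega> * T \<omega> y))"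
        using B(1) by (simp add: split_beta' abs_mult mult_ac)
    qed
  qed
qed

definition partial_sum :: "nat \<Rightarrow> 'w \<Rightarrow> 'a \<Rightarrow> real" where
  "partial_sum L \<omega> x = (\<Sum>l\<le>L. \<Sum>m=1..harm_dim l DIM('a). a l m \<omega> * S l m x)"

lemma partial_sum_continuous: "continuous_on S_unit (partial_sum L \<omega>)"
  unfolding partial_sum_def[abs_def] by (intro continuous_on_sum continuous_on_mult_left S_continuous)

lemma partial_sum_measurable [measurable]:
  "(\<lambda>(\<omega>, x). partial_sum L \<omega> x) \<in> borel_measurable (M \<Otimes>\<^sub>M sphere_measure)"
proof -
  have "(\<lambda>z. a l m (fst z) * S l m (snd z)) \<in> borel_measurable (M \<Otimes>\<^sub>M sphere_measure)"
    if m: "m \<in> {1..harm_dim l DIM('a)}" for l m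
    using a_square[OF m] measurable_compose[OF measurable_fst, of "a l m" M borel sphere_measure]
      measurable_compose[OF measurable_snd S_measurable[OF m], of M]
    by (intro borel_measurable_times) (auto simp: square_integrable_def)
  then show ?thesis unfolding partial_sum_def split_beta' by (intro borel_measurable_sum) auto
qed

lemma coefficient_partial_sum:
  assumes m: "m \<in> {1..harm_dim l DIM('a)}" and l: "l \<le> L"
  shows "(LINT y|sphere_measure. partial_sum L \<omega> y * S l m y) = a l m \<omega>"
proof -
  have int: "integrable sphere_measure (\<lambda>y. a l' m' \<omega> * (S l' m' y * S l m y))"
    if "m' \<in> {1..harm_dim l' DIM('a)}" for l' m'
    by (intro integrable_mult_right S_mult_integrable that m)
  have "(LINT y|sphere_measure. partial_sum L \<omega> y * S l m y)
      = (LINT y|sphere_measure. (\<Sum>l'\<le>L. \<Sum>m'=1..harm_dim l' DIM('a). a l' m' \<omega> * (S l' m' y * S l m y)))"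
    by (simp add: partial_sum_def sum_distrib_right mult.assoc)
  also have "\<dots> = (\<Sum>l'\<le>L. \<Sum>m'=1..harm_dim l' DIM('a). LINT y|sphere_measure. a l' m' \<omega> * (S l' m' y * S l m y))"
    by (rule integral_double_sum(2)[OF int])
  also have "\<dots> = (\<Sum>l'\<le>L. \<Sum>m'=1..harm_dim l' DIM('a). a l' m' \<omega> * (if l' = l \<and> m' = m then 1 else 0))"
    using m by (intro sum.cong refl, subst integral_mult_right_zero, subst S_orthonormal) auto
  also have "\<dots> = (\<Sum>l'\<le>L. if l' = l then a l m \<omega> else 0)"
  proof (rule sum.cong[OF refl])
    fix l'
    show "(\<Sum>m'=1..harm_dim l' DIM('a). a l' m' \<omega> * (if l' = l \<and> m' = m then 1 else 0))
      = (if l' = l then a l m \<omega> else 0)"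
    proof (cases "l' = l")
      case True
      then have "(\<Sum>m'=1..harm_dim l' DIM('a). a l' m' \<omega> * (if l' = l \<and> m' = m then 1 else 0))
        = (\<Sum>m'=1..harm_dim l DIM('a). if m' = m then a l m \<omega> else 0)" by (intro sum.cong) auto
      then show ?thesis using m True by simp
    qed simp
  qed
  also have "\<dots> = a l m \<omega>" using l by simp
  finally show ?thesis .
qed

text \<open>
  The mean square error of the expansion dominates that of each coefficient, by orthonormality and
  Bessel's inequality.
\<close>

lemma coefficient_AE:
  assumes m: "m \<in> {1..harm_dim l DIM('a)}"
  shows "AE \<omega> in M. (LINT y|sphere_measure. T \<omega> y * S l m y) = a l m \<omega>"
proof -
  have [measurable]: "S l m \<in> borel_measurable sphere_measure" "a l m \<in> borel_measurable M"
    using S_measurable[OF m] a_square[OF m] by (auto simp: square_integrable_def)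
  define e where "e = (\<lambda>\<omega>. (LINT y|sphere_measure. T \<omega> y * S l m y) - a l m \<omega>)"
  have [measurable]: "e \<in> borel_measurable M" unfolding e_def by measurable
  have T2: "AE \<omega> in M. integrable sphere_measure (\<lambda>y. (T \<omega> y)\<^sup>2)"
    using product.AE_integrable_fst[OF T_square_product] by simp
  have "(\<integral>\<^sup>+ \<omega>. ennreal ((e \<omega>)\<^sup>2) \<partial>M)
      \<le> (\<integral>\<^sup>+ (\<omega>, x). ennreal ((T \<omega> x - partial_sum L \<omega> x)\<^sup>2) \<partial>(M \<Otimes>\<^sub>M sphere_measure))" if L: "l \<le> L" for L
  proof -
    have "(\<integral>\<^sup>+ \<omega>. ennreal ((e \<omega>)\<^sup>2) \<partial>M)
      \<le> (\<integral>\<^sup>+ \<omega>. \<integral>\<^sup>+ x. ennreal ((T \<omega> x - partial_sum L \<omega> x)\<^sup>2) \<partial>sphere_measure \<partial>M)"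
    proof (rule nn_integral_mono_AE, use T2 AE_space in eventually_elim)
      fix \<omega> assume T2: "integrable sphere_measure (\<lambda>y. (T \<omega> y)\<^sup>2)" and \<omega>: "\<omega> \<in> space M"
      have "T \<omega> \<in> borel_measurable sphere_measure"
        using measurable_Pair2[OF T_measurable \<omega>] by simp
      with T2 have sT: "square_integrable sphere_measure (T \<omega>)" by (simp add: square_integrable_def)
      have sP: "square_integrable sphere_measure (partial_sum L \<omega>)"
        unfolding square_integrable_def
        by (intro conjI sphere_measurable_continuous sphere_integrable_continuous
            continuous_on_power partial_sum_continuous)
      have sD: "square_integrable sphere_measure (\<lambda>y. T \<omega> y - partial_sum L \<omega> y)"
        by (rule square_integrable_diff[OF sT sP])
      have "e \<omega> = (LINT y|sphere_measure. (T \<omega> y - partial_sum L \<omega> y) * S l m y)"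
        using square_integrable_mult[OF sT S_square[OF m]] square_integrable_mult[OF sP S_square[OF m]]
        by (simp add: e_def left_diff_distrib coefficient_partial_sum[OF m L])
      also have "\<dots>\<^sup>2 \<le> (LINT y|sphere_measure. (T \<omega> y - partial_sum L \<omega> y)\<^sup>2)"
        using S_orthonormal[OF m m] by (intro square_integral_product_le[OF sD S_square[OF m]])
          (simp add: power2_eq_square)
      finally have "ennreal ((e \<omega>)\<^sup>2) \<le> ennreal (LINT y|sphere_measure. (T \<omega> y - partial_sum L \<omega> y)\<^sup>2)"
        by (rule ennreal_leI)
      also have "\<dots> = (\<integral>\<^sup>+ x. ennreal ((T \<omega> x - partial_sum L \<omega> x)\<^sup>2) \<partial>sphere_measure)"
        using sD by (subst nn_integral_eq_integral) (auto simp: square_integrable_def)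
      finally show "ennreal ((e \<omega>)\<^sup>2) \<le> (\<integral>\<^sup>+ x. ennreal ((T \<omega> x - partial_sum L \<omega> x)\<^sup>2) \<partial>sphere_measure)" .
    qed
    also have "\<dots> = (\<integral>\<^sup>+ (\<omega>, x). ennreal ((T \<omega> x - partial_sum L \<omega> x)\<^sup>2) \<partial>(M \<Otimes>\<^sub>M sphere_measure))"
      by (subst sphere.nn_integral_fst[symmetric]) auto
    finally show ?thesis .
  qed
  then have "(\<integral>\<^sup>+ \<omega>. ennreal ((e \<omega>)\<^sup>2) \<partial>M) \<le> 0"
    using expansion unfolding partial_sum_def
    by (intro tendsto_lowerbound[OF expansion] eventually_sequentiallyI[of l]) auto
  then have "AE \<omega> in M. e \<omega> = 0" by (simp add: nn_integral_0_iff_AE)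
  then show ?thesis by eventually_elim (simp add: e_def)
qed

text \<open>Fubini's theorem, for the coefficient written as an integral of the field against \<open>S l m\<close>.\<close>

lemma pairing:
  assumes W: "square_integrable M W" and m: "m \<in> {1..harm_dim l DIM('a)}"
  shows "integrable sphere_measure (\<lambda>y. (LINT \<omega>|M. W \<omega> * T \<omega> y) * S l m y)"
    and "(LINT y|sphere_measure. (LINT \<omega>|M. W \<omega> * T \<omega> y) * S l m y) = (LINT \<omega>|M. W \<omega> * a l m \<omega>)"
proof -
  note i = weighted_product_integrable[OF W m]
  have [measurable]: "W \<in> borel_measurable M" "S l m \<in> borel_measurable sphere_measure" "a l m \<in> borel_measurable M"
    using W S_measurable[OF m] a_square[OF m] by (auto simp: square_integrable_def)
  show "integrable sphere_measure (\<lambda>y. (LINT \<omega>|M. W \<omega> * T \<omega> y) * S l m y)"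
    using product.integrable_snd[OF i] by simp
  have "(LINT y|sphere_measure. (LINT \<omega>|M. W \<omega> * T \<omega> y) * S l m y)
      = (LINT y|sphere_measure. LINT \<omega>|M. W \<omega> * T \<omega> y * S l m y)" by simp
  also have "\<dots> = (LINT \<omega>|M. LINT y|sphere_measure. W \<omega> * T \<omega> y * S l m y)"
    by (rule product.Fubini_integral[OF i])
  also have "\<dots> = (LINT \<omega>|M. W \<omega> * (LINT y|sphere_measure. T \<omega> y * S l m y))"
    by (simp add: mult.assoc)
  also have "\<dots> = (LINT \<omega>|M. W \<omega> * a l m \<omega>)"
    using coefficient_AE[OF m] by (intro integral_cong_AE) auto
  finally show "(LINT y|sphere_measure. (LINT \<omega>|M. W \<omega> * T \<omega> y) * S l m y) = (LINT \<omega>|M. W \<omega> * a l m \<omega>)" .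
qed

end

context karhunen_loeve
begin

definition band :: "nat set \<Rightarrow> 'w \<Rightarrow> 'a \<Rightarrow> real" where
  "band D \<omega> x = (\<Sum>l\<in>D. \<Sum>m=1..harm_dim l DIM('a). a l m \<omega> * S l m x)"

lemma partial_sum_band: "partial_sum L = band {..L}"
  by (intro ext) (simp add: partial_sum_def band_def)

lemma band_square: "square_integrable M (\<lambda>\<omega>. band D \<omega> x)"
  unfolding band_def mult.commute[of "a _ _ _"]
  by (intro square_integrable_sum square_integrable_cmult a_square)

lemma band_pairing:
  assumes W: "square_integrable M W"
  shows "(LINT \<omega>|M. W \<omega> * band D \<omega> x)
      = (\<Sum>l\<in>D. \<Sum>m=1..harm_dim l DIM('a). S l m x * (LINT \<omega>|M. W \<omega> * a l m \<omega>))"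
proof -
  have int: "integrable M (\<lambda>\<omega>. S l m x * (W \<omega> * a l m \<omega>))" if "m \<in> {1..harm_dim l DIM('a)}" for l m
    by (intro integrable_mult_right square_integrable_mult W a_square that)
  have "(LINT \<omega>|M. W \<omega> * band D \<omega> x)
      = (LINT \<omega>|M. (\<Sum>l\<in>D. \<Sum>m=1..harm_dim l DIM('a). S l m x * (W \<omega> * a l m \<omega>)))"
    by (simp add: band_def sum_distrib_left mult_ac)
  also have "\<dots> = (\<Sum>l\<in>D. \<Sum>m=1..harm_dim l DIM('a). LINT \<omega>|M. S l m x * (W \<omega> * a l m \<omega>))"
    by (rule integral_double_sum(2)[OF int])
  finally show ?thesis by simp
qed

lemma band_variance:
  assumes D: "finite D" and x: "x \<in> S_unit"
  shows "(LINT \<omega>|M. (band D \<omega> x)\<^sup>2) = (\<Sum>l\<in>D. A l * real (harm_dim l DIM('a)) / area)"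
proof -
  have "(LINT \<omega>|M. band D \<omega> x * a l m \<omega>) = A l * S l m x" if l: "l \<in> D" and m: "m \<in> {1..harm_dim l DIM('a)}" for l m
  proof -
    have "(LINT \<omega>|M. band D \<omega> x * a l m \<omega>)
        = (\<Sum>k\<in>D. \<Sum>n=1..harm_dim k DIM('a). S k n x * (if k = l \<and> n = m then A k else 0))"
      using band_pairing[OF a_square[OF m], of D x] a_cov m
      by (simp add: mult.commute[of "band _ _ _"]) (intro sum.cong refl, auto)
    also have "\<dots> = (\<Sum>k\<in>D. if k = l then A l * S l m x else 0)"
    proof (rule sum.cong[OF refl])
      fix k
      have "(\<Sum>n=1..harm_dim k DIM('a). S k n x * (if k = l \<and> n = m then A k else 0))
        = (\<Sum>n=1..harm_dim k DIM('a). if n = m then (if k = l then A l * S l m x else 0) else 0)"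
        by (intro sum.cong) auto
      then show "(\<Sum>n=1..harm_dim k DIM('a). S k n x * (if k = l \<and> n = m then A k else 0))
        = (if k = l then A l * S l m x else 0)" using m by auto
    qed
    also have "\<dots> = A l * S l m x" using l D by simp
    finally show ?thesis .
  qed
  then have "(LINT \<omega>|M. band D \<omega> x * band D \<omega> x)
      = (\<Sum>l\<in>D. \<Sum>m=1..harm_dim l DIM('a). S l m x * (A l * S l m x))"
    unfolding band_pairing[OF band_square] by (intro sum.cong refl arg_cong2[of _ _ _ _ "(*)"]) auto
  also have "\<dots> = (\<Sum>l\<in>D. A l * zonal S l x x)"
    by (simp add: zonal_def sum_distrib_left mult_ac)
  finally show ?thesis by (simp add: zonal_diagonal[OF x] area_def power2_eq_square)
qed

text \<open>
  Both sides are integrals of the covariance against the zonal kernel, and a reflection that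
  exchanges \<open>x\<close> and \<open>y\<close> preserves the covariance, the kernel and the surface measure.
\<close>

lemma cross_covariance_invariant:
  assumes x: "x \<in> S_unit" and y: "y \<in> S_unit"
  shows "(LINT \<omega>|M. T \<omega> x * band {l} \<omega> x) = (LINT \<omega>|M. T \<omega> y * band {l} \<omega> y)"
proof -
  have cross: "(LINT \<omega>|M. T \<omega> z * band {l} \<omega> z) = (LINT u|sphere_measure. cov z u * zonal S l z u)"
    and int: "integrable sphere_measure (\<lambda>u. cov z u * zonal S l z u)"
    if z: "z \<in> S_unit" for z
  proof -
    have i: "integrable sphere_measure (\<lambda>u. S l m z * (cov z u * S l m u))"
      if "m \<in> {1..harm_dim l DIM('a)}" for m
      using pairing(1)[OF T_square[OF z] that] by (simp add: cov_def)
    have eq: "(\<lambda>u. cov z u * zonal S l z u) = (\<lambda>u. \<Sum>m=1..harm_dim l DIM('a). S l m z * (cov z u * S l m u))"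
      by (simp add: zonal_def sum_distrib_left mult_ac)
    show "integrable sphere_measure (\<lambda>u. cov z u * zonal S l z u)"
      unfolding eq by (rule Bochner_Integration.integrable_sum[OF i])
    have "(LINT u|sphere_measure. cov z u * zonal S l z u)
        = (\<Sum>m=1..harm_dim l DIM('a). S l m z * (LINT u|sphere_measure. cov z u * S l m u))"
      unfolding eq by (subst Bochner_Integration.integral_sum[OF i]) simp_all
    also have "\<dots> = (\<Sum>m=1..harm_dim l DIM('a). S l m z * (LINT \<omega>|M. T \<omega> z * a l m \<omega>))"
      using pairing(2)[OF T_square[OF z]] by (intro sum.cong refl) (simp add: cov_def)
    finally show "(LINT \<omega>|M. T \<omega> z * band {l} \<omega> z) = (LINT u|sphere_measure. cov z u * zonal S l z u)"
      by (simp add: band_pairing[OF T_square[OF z]])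
  qed
  obtain R where R: "orthogonal_transformation R" "\<And>z. R (R z) = z" "R x = y"
    using ex_reflection[of x y] x y by auto
  have "(LINT u|sphere_measure. cov y u * zonal S l y u)
      = (LINT u|sphere_measure. cov (R x) (R u) * zonal S l (R x) (R u))"
    using sphere_integral_orthogonal[OF R(1) borel_measurable_integrable[OF int[OF y]]] by (simp add: R(3))
  also have "\<dots> = (LINT u|sphere_measure. cov x u * zonal S l x u)"
    by (rule Bochner_Integration.integral_cong)
       (use x in \<open>auto simp: cov_orthogonal[OF R(1)] zonal_reflection[OF R(1,2)]\<close>)
  finally show ?thesis by (simp add: cross[OF x] cross[OF y])
qed

lemma band_error_invariant:
  assumes D: "finite D" and x: "x \<in> S_unit" and y: "y \<in> S_unit"
  shows "(LINT \<omega>|M. (T \<omega> x - band D \<omega> x)\<^sup>2) = (LINT \<omega>|M. (T \<omega> y - band D \<omega> y)\<^sup>2)"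
proof -
  have cross: "(LINT \<omega>|M. T \<omega> z * band D \<omega> z) = (\<Sum>l\<in>D. LINT \<omega>|M. T \<omega> z * band {l} \<omega> z)"
    if z: "z \<in> S_unit" for z
    using band_pairing[OF T_square[OF z]] by simp
  have "(LINT \<omega>|M. T \<omega> x * band D \<omega> x) = (LINT \<omega>|M. T \<omega> y * band D \<omega> y)"
    unfolding cross[OF x] cross[OF y] using cross_covariance_invariant[OF x y] by simp
  then show ?thesis
    unfolding integral_square_diff[OF T_square[OF x] band_square]
      integral_square_diff[OF T_square[OF y] band_square]
    by (simp add: T_variance[OF x] T_variance[OF y] band_variance[OF D x] band_variance[OF D y])
qed

text \<open>
  By isotropy the mean square error is the same at all points, and so it is bounded by its average
  over the sphere, which tends to 0.
\<close>

lemma expansion_pointwise: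
  assumes x: "x \<in> S_unit"
  shows "(\<lambda>L. LINT \<omega>|M. (T \<omega> x - partial_sum L \<omega> x)\<^sup>2) \<longlonglongrightarrow> 0"
proof -
  define e where "e = (\<lambda>L. LINT \<omega>|M. (T \<omega> x - partial_sum L \<omega> x)\<^sup>2)"
  have e0: "0 \<le> e L" for L by (simp add: e_def)
  have "(\<integral>\<^sup>+ (\<omega>, y). ennreal ((T \<omega> y - partial_sum L \<omega> y)\<^sup>2) \<partial>(M \<Otimes>\<^sub>M sphere_measure))
      = ennreal (e L * area)" for L
  proof -
    have "(\<integral>\<^sup>+ (\<omega>, y). ennreal ((T \<omega> y - partial_sum L \<omega> y)\<^sup>2) \<partial>(M \<Otimes>\<^sub>M sphere_measure))
        = (\<integral>\<^sup>+ y. \<integral>\<^sup>+ \<omega>. ennreal ((T \<omega> y - partial_sum L \<omega> y)\<^sup>2) \<partial>M \<partial>sphere_measure)"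
      by (subst product.nn_integral_snd[symmetric]) auto
    also have "\<dots> = (\<integral>\<^sup>+ y. ennreal (e L) \<partial>(sphere_measure :: 'a measure))"
    proof (rule nn_integral_cong)
      fix y :: 'a assume "y \<in> space sphere_measure"
      then have y: "y \<in> S_unit" by simp
      have "(\<integral>\<^sup>+ \<omega>. ennreal ((T \<omega> y - partial_sum L \<omega> y)\<^sup>2) \<partial>M)
          = ennreal (LINT \<omega>|M. (T \<omega> y - partial_sum L \<omega> y)\<^sup>2)"
        using square_integrable_diff[OF T_square[OF y] band_square, of "{..L}" y]
        by (intro nn_integral_eq_integral) (auto simp: square_integrable_def partial_sum_band)
      then show "(\<integral>\<^sup>+ \<omega>. ennreal ((T \<omega> y - partial_sum L \<omega> y)\<^sup>2) \<partial>M) = ennreal (e L)"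
        using band_error_invariant[OF _ x y, of "{..L}"] by (simp add: e_def partial_sum_band)
    qed
    also have "\<dots> = ennreal (e L * area)"
      using e0 area_pos by (simp add: emeasure_sphere_area ennreal_mult)
    finally show ?thesis .
  qed
  then have "(\<lambda>L. ennreal (e L * area)) \<longlonglongrightarrow> ennreal 0"
    using expansion by (simp add: partial_sum_def)
  then have "(\<lambda>L. e L * area) \<longlonglongrightarrow> 0"
    using e0 area_pos by (subst (asm) tendsto_ennreal_iff) auto
  from tendsto_divide[OF this tendsto_const[of area]] show ?thesis
    using area_pos by (simp add: e_def)
qed

section \<open>Gaussian moments of the bands\<close>

text \<open>These are the variables that are known to be Gaussian.\<close>

definition field_span :: "('w \<Rightarrow> real) \<Rightarrow> bool" where
  "field_span Y \<longleftrightarrow> (\<exists>I c. finite I \<and> I \<subseteq> S_unit \<and> Y = (\<lambda>\<omega>. \<Sum>x\<in>I. c x * T \<omega> x))"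

lemma field_span_zero: "field_span (\<lambda>\<omega>. 0)"
  unfolding field_span_def by (intro exI[of _ "{}"]) simp

lemma field_span_add_point:
  assumes "field_span Y" "y \<in> S_unit"
  shows "field_span (\<lambda>\<omega>. Y \<omega> + k * T \<omega> y)"
proof -
  obtain I c where I: "finite I" "I \<subseteq> S_unit" and Y: "Y = (\<lambda>\<omega>. \<Sum>x\<in>I. c x * T \<omega> x)"
    using assms(1) unfolding field_span_def by blast
  define c' where "c' = (\<lambda>x. (if x \<in> I then c x else 0) + (if x = y then k else 0))"
  have "Y \<omega> + k * T \<omega> y = (\<Sum>x\<in>insert y I. c' x * T \<omega> x)" for \<omega>
  proof -
    have "(\<Sum>x\<in>insert y I. c' x * T \<omega> x)
        = (\<Sum>x\<in>insert y I. (if x \<in> I then c x * T \<omega> x else 0)) + (\<Sum>x\<in>insert y I. if x = y then k * T \<omega> y else 0)"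
      unfolding sum.distrib[symmetric] by (rule sum.cong) (auto simp: c'_def algebra_simps)
    also have "(\<Sum>x\<in>insert y I. (if x \<in> I then c x * T \<omega> x else 0)) = Y \<omega>"
      unfolding Y using I(1) by (intro sum.mono_neutral_cong_right) auto
    finally show ?thesis using I(1) by simp
  qed
  then have "(\<lambda>\<omega>. Y \<omega> + k * T \<omega> y) = (\<lambda>\<omega>. \<Sum>x\<in>insert y I. c' x * T \<omega> x)" by blast
  then show ?thesis
    unfolding field_span_def using I assms(2) by (intro exI[of _ "insert y I"] exI[of _ c']) auto
qed

lemma field_span_cmult:
  assumes "field_span Y"
  shows "field_span (\<lambda>\<omega>. k * Y \<omega>)"
proof -
  obtain I c where I: "finite I" "I \<subseteq> S_unit" and Y: "Y = (\<lambda>\<omega>. \<Sum>x\<in>I. c x * T \<omega> x)"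
    using assms(1) unfolding field_span_def by blast
  then show ?thesis
    unfolding field_span_def
    by (intro exI[of _ I] exI[of _ "\<lambda>x. k * c x"]) (simp add: sum_distrib_left mult.assoc)
qed

lemma field_span_square: "field_span Y \<Longrightarrow> square_integrable M Y"
  unfolding field_span_def using T_square
  by (auto intro!: square_integrable_sum square_integrable_cmult)

lemma field_span_moment:
  assumes Y: "field_span Y"
  shows "(\<integral>\<^sup>+ \<omega>. ennreal (Y \<omega> ^ (2 * q)) \<partial>M) = ennreal (gauss_const q * (LINT \<omega>|M. (Y \<omega>)\<^sup>2) ^ q)"
proof -
  obtain I c where I: "finite I" "I \<subseteq> S_unit" and Yc: "Y = (\<lambda>\<omega>. \<Sum>x\<in>I. c x * T \<omega> x)"
    using Y unfolding field_span_def by blast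
  have T: "integrable M (\<lambda>\<omega>. c x * T \<omega> x)" "(LINT \<omega>|M. T \<omega> x) = 0" if "x \<in> I" for x
  proof -
    have x: "x \<in> S_unit" using that I by auto
    have "square_integrable M (\<lambda>_. 1)" by (simp add: square_integrable_def)
    from square_integrable_mult[OF T_square[OF x] this] show "integrable M (\<lambda>\<omega>. c x * T \<omega> x)" by simp
    show "(LINT \<omega>|M. T \<omega> x) = 0" using field x unfolding centered_isotropic_gaussian_field_def by blast
  qed
  have "(LINT \<omega>|M. Y \<omega>) = (\<Sum>x\<in>I. LINT \<omega>|M. c x * T \<omega> x)"
    unfolding Yc by (rule Bochner_Integration.integral_sum[OF T(1)])
  also have "\<dots> = 0" using T(2) by simp
  finally have "(LINT \<omega>|M. Y \<omega>) = 0" .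
  moreover have "gaussian_rv M Y"
    using field I unfolding centered_isotropic_gaussian_field_def gaussian_field_def Yc by blast
  ultimately show ?thesis by (intro gaussian_even_moment prob_space_axioms)
qed

text \<open>
  A band at \<open>x\<close> equals the average of \<open>area * K(y) * T(y)\<close> over the sphere, where \<open>K\<close> is a sum of
  zonal kernels. The points of an empirical average \<open>Y / n\<close> approximating it can be chosen one by
  one: in each step some choice of the new point increases the square error of \<open>Y\<close> at most as
  much as a random choice does on average, which is at most by a constant because the cross term
  averages out.
\<close>

lemma band_greedy_approximation:
  assumes D: "finite D" and x: "x \<in> S_unit"
  obtains C where "\<And>n. \<exists>Y. field_span Y \<and> (LINT \<omega>|M. (real n * band D \<omega> x - Y \<omega>)\<^sup>2) \<le> real n * C"
proof -
  define X where "X = (\<lambda>\<omega>. band D \<omega> x)"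
  define K where "K = (\<lambda>y. \<Sum>l\<in>D. \<Sum>m=1..harm_dim l DIM('a). S l m x * S l m y)"
  have Kc: "continuous_on S_unit K"
    unfolding K_def by (intro continuous_on_sum continuous_on_mult_left S_continuous)
  have K2: "integrable sphere_measure (\<lambda>y. (K y)\<^sup>2)"
    by (intro sphere_integrable_continuous continuous_on_power Kc)
  have X: "square_integrable M X" unfolding X_def by (rule band_square)
  have pair: "integrable sphere_measure (\<lambda>y. K y * (LINT \<omega>|M. W \<omega> * T \<omega> y))"
      "(LINT y|sphere_measure. K y * (LINT \<omega>|M. W \<omega> * T \<omega> y)) = (LINT \<omega>|M. W \<omega> * X \<omega>)"
    if W: "square_integrable M W" for W
  proof -
    have i: "integrable sphere_measure (\<lambda>y. S l m x * ((LINT \<omega>|M. W \<omega> * T \<omega> y) * S l m y))"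
      if "m \<in> {1..harm_dim l DIM('a)}" for l m
      by (intro integrable_mult_right pairing(1) W that)
    have eq: "(\<lambda>y. K y * (LINT \<omega>|M. W \<omega> * T \<omega> y))
      = (\<lambda>y. \<Sum>l\<in>D. \<Sum>m=1..harm_dim l DIM('a). S l m x * ((LINT \<omega>|M. W \<omega> * T \<omega> y) * S l m y))"
      by (simp add: K_def sum_distrib_right sum_distrib_left mult_ac)
    show "integrable sphere_measure (\<lambda>y. K y * (LINT \<omega>|M. W \<omega> * T \<omega> y))"
      unfolding eq by (rule integral_double_sum(1)[OF i])
    have "(LINT y|sphere_measure. K y * (LINT \<omega>|M. W \<omega> * T \<omega> y))
      = (\<Sum>l\<in>D. \<Sum>m=1..harm_dim l DIM('a). LINT y|sphere_measure. S l m x * ((LINT \<omega>|M. W \<omega> * T \<omega> y) * S l m y))"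
      unfolding eq by (rule integral_double_sum(2)[OF i])
    also have "\<dots> = (\<Sum>l\<in>D. \<Sum>m=1..harm_dim l DIM('a). S l m x * (LINT \<omega>|M. W \<omega> * a l m \<omega>))"
      using pairing(2)[OF W] by (intro sum.cong refl) simp
    finally show "(LINT y|sphere_measure. K y * (LINT \<omega>|M. W \<omega> * T \<omega> y)) = (LINT \<omega>|M. W \<omega> * X \<omega>)"
      by (simp add: X_def band_pairing[OF W])
  qed
  define C where "C = area * variance0 * (LINT y|sphere_measure. (K y)\<^sup>2)"
  have "\<exists>Y. field_span Y \<and> (LINT \<omega>|M. (real n * X \<omega> - Y \<omega>)\<^sup>2) \<le> real n * C" for n
  proof (induction n)
    case 0
    then show ?case using field_span_zero by (intro exI[of _ "\<lambda>\<omega>. 0"]) simp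
  next
    case (Suc n)
    then obtain Y where Y: "field_span Y" "(LINT \<omega>|M. (real n * X \<omega> - Y \<omega>)\<^sup>2) \<le> real n * C" by blast
    define V where "V = (\<lambda>\<omega>. real (Suc n) * X \<omega> - Y \<omega>)"
    have V: "square_integrable M V"
      unfolding V_def by (intro square_integrable_diff square_integrable_cmult X field_span_square Y)
    \<comment> \<open>the square error after adding the point \<open>y\<close>; its average over \<open>y\<close> is at most \<open>Suc n * C\<close>\<close>
    define h where "h = (\<lambda>y. (LINT \<omega>|M. (V \<omega>)\<^sup>2) - 2 * area * (K y * (LINT \<omega>|M. V \<omega> * T \<omega> y))
        + area\<^sup>2 * variance0 * (K y)\<^sup>2)"
    have h: "(LINT \<omega>|M. (V \<omega> - area * K y * T \<omega> y)\<^sup>2) = h y" if y: "y \<in> S_unit" for y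
      unfolding integral_square_diff[OF V square_integrable_cmult[OF T_square[OF y], of "area * K y"]]
      by (simp add: h_def T_variance[OF y] power_mult_distrib mult.left_commute[of "V _"] mult.assoc)
    have int_h: "integrable sphere_measure h"
      unfolding h_def using pair(1)[OF V] K2 by simp
    have "(LINT y|sphere_measure. h y)
        = area * (LINT \<omega>|M. (V \<omega>)\<^sup>2) - 2 * area * (LINT \<omega>|M. V \<omega> * X \<omega>) + area * C"
      unfolding h_def using pair[OF V] K2
      by (simp add: C_def area_def[symmetric] power2_eq_square)
    also have "\<dots> = area * ((LINT \<omega>|M. (V \<omega> - X \<omega>)\<^sup>2) - (LINT \<omega>|M. (X \<omega>)\<^sup>2) + C)"
      by (simp add: integral_square_diff[OF V X] algebra_simps)
    also have "\<dots> \<le> area * (real (Suc n) * C)"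
    proof (rule mult_left_mono)
      have "V \<omega> - X \<omega> = real n * X \<omega> - Y \<omega>" for \<omega> by (simp add: V_def algebra_simps)
      then have "(LINT \<omega>|M. (V \<omega> - X \<omega>)\<^sup>2) \<le> real n * C" using Y(2) by simp
      moreover have "0 \<le> (LINT \<omega>|M. (X \<omega>)\<^sup>2)" by simp
      moreover have "real (Suc n) * C = real n * C + C" by (simp add: distrib_right)
      ultimately show "(LINT \<omega>|M. (V \<omega> - X \<omega>)\<^sup>2) - (LINT \<omega>|M. (X \<omega>)\<^sup>2) + C \<le> real (Suc n) * C"
        by linarith
    qed (use area_pos in simp)
    finally have int_le: "(LINT y|sphere_measure. h y) \<le> area * (real (Suc n) * C)" .
    have "\<exists>y\<in>S_unit. h y \<le> real (Suc n) * C"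
    proof (rule ccontr)
      assume "\<not> (\<exists>y\<in>S_unit. h y \<le> real (Suc n) * C)"
      then have "(LINT y|(sphere_measure :: 'a measure). real (Suc n) * C) < (LINT y|sphere_measure. h y)"
        using int_h area_pos by (intro sphere.integral_less_AE_space) (auto simp: emeasure_sphere_area not_le)
      then show False using int_le by (simp add: area_def)
    qed
    then obtain y where y: "y \<in> S_unit" "h y \<le> real (Suc n) * C" by blast
    have "(LINT \<omega>|M. (real (Suc n) * X \<omega> - (Y \<omega> + area * K y * T \<omega> y))\<^sup>2) = h y"
      unfolding h[OF y(1), symmetric] V_def by (simp add: algebra_simps)
    then show ?case
      using y(2) field_span_add_point[OF Y(1) y(1), of "area * K y"] by auto
  qed
  then show thesis using that unfolding X_def by blast
qed

text \<open>
  By the greedy approximation a band is a limit in mean square of Gaussian variables, with an error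
  of order \<open>1 / n\<close>.
\<close>

lemma band_moment:
  assumes D: "finite D" and x: "x \<in> S_unit"
  shows "(\<integral>\<^sup>+ \<omega>. ennreal (band D \<omega> x ^ (2 * q)) \<partial>M)
    \<le> ennreal (gauss_const q * (2 * (LINT \<omega>|M. (band D \<omega> x)\<^sup>2)) ^ q)"
proof -
  obtain C where "\<And>n. \<exists>Y. field_span Y \<and> (LINT \<omega>|M. (real n * band D \<omega> x - Y \<omega>)\<^sup>2) \<le> real n * C"
    using band_greedy_approximation[OF D x] by metis
  then obtain Y where Y: "\<And>n. field_span (Y n)"
    "\<And>n. (LINT \<omega>|M. (real n * band D \<omega> x - Y n \<omega>)\<^sup>2) \<le> real n * C"
    by metis
  define Z where "Z = (\<lambda>n \<omega>. (1 / real (Suc n)) * Y (Suc n) \<omega>)"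
  have Z: "field_span (Z n)" for n unfolding Z_def by (intro field_span_cmult Y)
  have err: "(LINT \<omega>|M. (band D \<omega> x - Z n \<omega>)\<^sup>2) \<le> C / real (Suc n)" for n
  proof -
    have "band D \<omega> x - Z n \<omega> = (1 / real (Suc n)) * (real (Suc n) * band D \<omega> x - Y (Suc n) \<omega>)" for \<omega>
      unfolding Z_def right_diff_distrib by simp
    then have "(LINT \<omega>|M. (band D \<omega> x - Z n \<omega>)\<^sup>2)
        = (1 / real (Suc n))\<^sup>2 * (LINT \<omega>|M. (real (Suc n) * band D \<omega> x - Y (Suc n) \<omega>)\<^sup>2)"
      by (simp only: power_mult_distrib integral_mult_right_zero)
    also have "\<dots> \<le> (1 / real (Suc n))\<^sup>2 * (real (Suc n) * C)"
      by (intro mult_left_mono Y) simp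
    also have "\<dots> = C / real (Suc n)" by (simp add: power2_eq_square)
    finally show ?thesis .
  qed
  have lim: "(\<lambda>n. LINT \<omega>|M. (band D \<omega> x - Z n \<omega>)\<^sup>2) \<longlonglongrightarrow> 0"
  proof (rule tendsto_sandwich[of "\<lambda>_. 0"])
    show "(\<lambda>n. C / real (Suc n)) \<longlonglongrightarrow> 0"
      using tendsto_mult_right_zero[OF LIMSEQ_inverse_real_of_nat, of C] by (simp add: divide_inverse)
  qed (use err in auto)
  show ?thesis
    by (rule even_moment_L2_limit[OF band_square field_span_square[OF Z] lim field_span_moment[OF Z]])
       (simp add: gauss_const_def)
qed

end

section \<open>Dyadic blocks of the expansion\<close>

text \<open>The shift by one makes room for degree 0, so that the blocks exhaust all degrees.\<close>

definition block :: "nat \<Rightarrow> nat set" where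
  "block j = {2 ^ j - 1..<2 ^ Suc j - 1}"

lemma sum_blocks: "(\<Sum>j<J. \<Sum>l\<in>block j. g l) = (\<Sum>l<2 ^ J - 1. g l :: real)"
proof (induction J)
  case (Suc J)
  have "(\<Sum>l\<in>{0..<2 ^ J - 1}. g l) + (\<Sum>l\<in>{2 ^ J - 1..<2 ^ Suc J - 1}. g l) = (\<Sum>l\<in>{0..<2 ^ Suc J - 1}. g l)"
    by (rule sum.atLeastLessThan_concat) auto
  then show ?case using Suc by (simp add: block_def atLeast0LessThan)
qed simp

locale karhunen_loeve_smooth = karhunen_loeve S M T A a
  for S :: "nat \<Rightarrow> nat \<Rightarrow> 'a::euclidean_space \<Rightarrow> real" and M :: "'w measure"
    and T :: "'w \<Rightarrow> 'a \<Rightarrow> real" and A :: "nat \<Rightarrow> real" and a :: "nat \<Rightarrow> nat \<Rightarrow> 'w \<Rightarrow> real" +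
  fixes \<beta> :: real
  assumes beta: "\<beta> > 0"
    and summ: "summable (\<lambda>l. A l * real l powr (real DIM('a) - 2 + \<beta>))"
begin

text \<open>A harmonic is arbitrary off the sphere; this polynomial agrees with it on the sphere.\<close>

definition harm_poly :: "nat \<Rightarrow> nat \<Rightarrow> 'a \<Rightarrow> real" where
  "harm_poly l m = (SOME p. degree_le l p \<and> (\<forall>x\<in>S_unit. S l m x = p x))"

lemma harm_poly:
  assumes "m \<in> {1..harm_dim l DIM('a)}"
  shows "degree_le l (harm_poly l m)" and "x \<in> S_unit \<Longrightarrow> harm_poly l m x = S l m x"
proof -
  have "\<exists>p. degree_le l p \<and> (\<forall>x\<in>S_unit. S l m x = p x)"
    using S_harmonic[OF assms] homogeneous_degree_le unfolding spherical_harmonic_def by metis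
  then have "degree_le l (harm_poly l m) \<and> (\<forall>x\<in>S_unit. S l m x = harm_poly l m x)"
    unfolding harm_poly_def by (rule someI_ex)
  then show "degree_le l (harm_poly l m)" "x \<in> S_unit \<Longrightarrow> harm_poly l m x = S l m x" by auto
qed

definition block_poly :: "nat \<Rightarrow> 'w \<Rightarrow> 'a \<Rightarrow> real" where
  "block_poly j \<omega> x = (\<Sum>l\<in>block j. \<Sum>m=1..harm_dim l DIM('a). a l m \<omega> * harm_poly l m x)"

lemma block_poly_band: "x \<in> S_unit \<Longrightarrow> block_poly j \<omega> x = band (block j) \<omega> x"
  unfolding block_poly_def band_def by (intro sum.cong refl) (simp add: harm_poly(2))

lemma degree_le_block_poly: "degree_le (2 ^ Suc j) (block_poly j \<omega>)"
  unfolding block_poly_def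
proof (intro degree_le_sum degree_le_cmult)
  fix l m assume l: "l \<in> block j" and m: "m \<in> {1..harm_dim l DIM('a)}"
  have "l \<le> 2 ^ Suc j" using l by (auto simp: block_def)
  then show "degree_le (2 ^ Suc j) (harm_poly l m)" by (rule degree_le_mono[OF harm_poly(1)[OF m]])
qed

lemma block_poly_measurable [measurable]:
  "(\<lambda>(\<omega>, x). block_poly j \<omega> x) \<in> borel_measurable (M \<Otimes>\<^sub>M sphere_measure)"
proof -
  have "(\<lambda>z. a l m (fst z) * harm_poly l m (snd z)) \<in> borel_measurable (M \<Otimes>\<^sub>M sphere_measure)"
    if m: "m \<in> {1..harm_dim l DIM('a)}" for l m
    using a_square[OF m] measurable_compose[OF measurable_fst, of "a l m" M borel sphere_measure]
      measurable_compose[OF measurable_snd sphere_measurable_continuous[OF degree_le_continuous_on[OF harm_poly(1)[OF m]]], of M]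
    by (intro borel_measurable_times) (auto simp: square_integrable_def)
  then show ?thesis unfolding block_poly_def split_beta' by (intro borel_measurable_sum) auto
qed

lemma partial_sum_blocks:
  assumes x: "x \<in> S_unit"
  shows "partial_sum (2 ^ Suc J - 2) \<omega> x = (\<Sum>j<Suc J. block_poly j \<omega> x)"
proof -
  obtain n where "2 ^ J = Suc n" using gr0_implies_Suc[of "2 ^ J"] by auto
  then have "{..2 ^ Suc J - 2} = {..<2 ^ Suc J - 1 :: nat}" by auto
  then show ?thesis
    unfolding block_poly_band[OF x] band_def sum_blocks partial_sum_def by simp
qed

text \<open>
  In block \<open>j\<close> the degrees are of order \<open>2 ^ j\<close> and \<open>harm_dim l d\<close> is of order \<open>l ^ (d - 2)\<close>. So the
  variance \<open>\<Sum>l. A l * harm_dim l d / area\<close> is at most of order \<open>2 ^ (- \<beta> j)\<close> times the sum of all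
  \<open>A l * l powr (d - 2 + \<beta>)\<close>.
\<close>

lemma block_variance:
  obtains s where "0 \<le> s" "\<And>j x. x \<in> S_unit \<Longrightarrow>
    (LINT \<omega>|M. (band (block j) \<omega> x)\<^sup>2) \<le> s * 2 powr (- (\<beta> * real j))"
proof -
  let ?d = "DIM('a)" and ?f = "\<lambda>l. A l * real l powr (real DIM('a) - 2 + \<beta>)"
  obtain K where K: "\<And>l. harm_dim l ?d \<le> K * (l + 1) ^ (?d - 2)"
    using harm_dim_bound[OF dim] by metis
  define c where "c = real K * 2 ^ (?d - 2) * 2 powr \<beta> / area"
  have c0: "0 \<le> c" using area_pos by (simp add: c_def)
  have f0: "0 \<le> ?f l" for l using A_nonneg by simp
  define v where "v = A 0 * real (harm_dim 0 ?d) / area"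
  have v0: "0 \<le> v" using A_nonneg area_pos by (simp add: v_def)
  have F0: "0 \<le> suminf ?f" by (rule suminf_nonneg[OF summ f0])
  have "(LINT \<omega>|M. (band (block j) \<omega> x)\<^sup>2) \<le> (v + c * suminf ?f) * 2 powr (- (\<beta> * real j))"
    if x: "x \<in> S_unit" for j x
  proof (cases j)
    case 0
    have "block 0 = {0}" by (auto simp: block_def)
    then show ?thesis using band_variance[OF _ x, of "{0}"] c0 F0 by (simp add: 0 v_def)
  next
    case (Suc i)
    have summand: "A l * real (harm_dim l ?d) / area \<le> c * 2 powr (- (\<beta> * real j)) * ?f l"
      if l: "l \<in> block j" for l
    proof -
      have li: "2 ^ i \<le> l" using l one_le_power[of "2::nat" i] by (auto simp: block_def Suc)
      then have l1: "1 \<le> l" using one_le_power[of "2::nat" i] by linarith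
      have "real (harm_dim l ?d) \<le> real K * real (l + 1) ^ (?d - 2)"
        using K[of l] by (metis of_nat_le_iff of_nat_mult of_nat_power)
      also have "\<dots> \<le> real K * (2 * real l) ^ (?d - 2)"
        using l1 by (intro mult_left_mono power_mono) auto
      also have "\<dots> = real K * 2 ^ (?d - 2) * real l powr (real ?d - 2)"
        using l1 dim by (simp add: power_mult_distrib powr_realpow[symmetric] of_nat_diff)
      also have "real l powr (real ?d - 2) = real l powr (real ?d - 2 + \<beta>) * real l powr (- \<beta>)"
        using l1 by (simp add: powr_add[symmetric])
      also have "real K * 2 ^ (?d - 2) * (real l powr (real ?d - 2 + \<beta>) * real l powr (- \<beta>))
          \<le> real K * 2 ^ (?d - 2) * (real l powr (real ?d - 2 + \<beta>) * (2 powr \<beta> * 2 powr (- (\<beta> * real j))))"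
      proof (intro mult_left_mono)
        have "real l powr (- \<beta>) \<le> (2 ^ i) powr (- \<beta>)"
        proof (rule powr_mono2')
          show "2 ^ i \<le> real l" using li by (metis of_nat_le_iff of_nat_numeral of_nat_power)
        qed (use beta in auto)
        also have "\<dots> = 2 powr \<beta> * 2 powr (- (\<beta> * real j))"
          by (simp add: powr_realpow[symmetric] powr_powr powr_add[symmetric] Suc algebra_simps)
        finally show "real l powr (- \<beta>) \<le> 2 powr \<beta> * 2 powr (- (\<beta> * real j))" .
      qed auto
      finally have h: "real (harm_dim l ?d)
          \<le> real K * 2 ^ (?d - 2) * (real l powr (real ?d - 2 + \<beta>) * (2 powr \<beta> * 2 powr (- (\<beta> * real j))))" .
      have "A l * real (harm_dim l ?d) / area
          \<le> A l * (real K * 2 ^ (?d - 2) * (real l powr (real ?d - 2 + \<beta>) * (2 powr \<beta> * 2 powr (- (\<beta> * real j))))) / area"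
        using area_pos A_nonneg by (intro divide_right_mono mult_left_mono h) auto
      also have "\<dots> = c * 2 powr (- (\<beta> * real j)) * ?f l" by (simp add: c_def)
      finally show ?thesis .
    qed
    have fin: "finite (block j)" by (simp add: block_def)
    have "(LINT \<omega>|M. (band (block j) \<omega> x)\<^sup>2) \<le> (\<Sum>l\<in>block j. c * 2 powr (- (\<beta> * real j)) * ?f l)"
      unfolding band_variance[OF fin x] by (rule sum_mono[OF summand])
    also have "\<dots> = c * 2 powr (- (\<beta> * real j)) * (\<Sum>l\<in>block j. ?f l)"
      by (simp add: sum_distrib_left)
    also have "\<dots> \<le> c * 2 powr (- (\<beta> * real j)) * suminf ?f"
      using c0 f0 by (intro mult_left_mono sum_le_suminf[OF summ fin]) auto
    also have "\<dots> \<le> (v + c * suminf ?f) * 2 powr (- (\<beta> * real j))"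
      using v0 by (simp add: algebra_simps)
    finally show ?thesis .
  qed
  then show thesis using v0 c0 F0 that[of "v + c * suminf ?f"] by simp
qed

text \<open>
  The rates exhaust \<open>\<gamma> < \<beta> / 2\<close>. For a rate \<open>\<gamma>\<close>, Nikolskii's inequality loses the factor
  \<open>2 ^ (d j)\<close> in the power \<open>2 q\<close>, and the weights absorb this loss together with the factor
  \<open>2 ^ (2 q \<gamma> j)\<close>. The expected value of term \<open>j\<close> is then of order \<open>2 ^ ((2 q \<gamma> + d - \<beta> q) j)\<close>, which is
  \<open>2 ^ (- d j)\<close> for \<open>\<gamma> = \<beta> / 2 - 1 / (n + 1)\<close> and \<open>q = d (n + 1)\<close>.
\<close>

definition decay_rate :: "nat \<Rightarrow> real" where
  "decay_rate n = \<beta> / 2 - 1 / real (Suc n)"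

definition moment :: "nat \<Rightarrow> nat" where
  "moment n = DIM('a) * Suc n"

definition weight :: "nat \<Rightarrow> nat \<Rightarrow> real" where
  "weight n j = 2 powr ((2 * real (moment n) * decay_rate n + real DIM('a)) * real j)"

definition block_norms :: "nat \<Rightarrow> 'w \<Rightarrow> ennreal" where
  "block_norms n \<omega> = (\<Sum>j. ennreal (weight n j) *
      (\<integral>\<^sup>+ y. ennreal (block_poly j \<omega> y ^ (2 * moment n)) \<partial>sphere_measure))"

lemma block_norms_measurable [measurable]: "block_norms n \<in> borel_measurable M"
  unfolding block_norms_def[abs_def] by measurable

lemma block_norms_integral_finite: "(\<integral>\<^sup>+ \<omega>. block_norms n \<omega> \<partial>M) < \<infinity>"
proof -
  let ?q = "moment n" and ?d = "DIM('a)"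
  obtain s where s: "0 \<le> s" "\<And>j x. x \<in> S_unit \<Longrightarrow>
    (LINT \<omega>|M. (band (block j) \<omega> x)\<^sup>2) \<le> s * 2 powr (- (\<beta> * real j))"
    using block_variance by metis
  define C where "C = gauss_const ?q * (2 * s) ^ ?q * area"
  have g0: "0 \<le> gauss_const ?q" by (simp add: gauss_const_def)
  have C0: "0 \<le> C" using g0 s(1) area_pos by (simp add: C_def)
  have mom: "(\<integral>\<^sup>+ \<omega>. \<integral>\<^sup>+ y. ennreal (block_poly j \<omega> y ^ (2 * ?q)) \<partial>sphere_measure \<partial>M)
      \<le> ennreal (C * 2 powr (- (\<beta> * real ?q) * real j))" for j
  proof -
    define b where "b = gauss_const ?q * (2 * (s * 2 powr (- (\<beta> * real j)))) ^ ?q"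
    have b0: "0 \<le> b" using g0 s(1) by (simp add: b_def)
    have "(\<integral>\<^sup>+ \<omega>. \<integral>\<^sup>+ y. ennreal (block_poly j \<omega> y ^ (2 * ?q)) \<partial>sphere_measure \<partial>M)
        = (\<integral>\<^sup>+ y. \<integral>\<^sup>+ \<omega>. ennreal (block_poly j \<omega> y ^ (2 * ?q)) \<partial>M \<partial>sphere_measure)"
      by (rule product.Fubini'[symmetric]) measurable
    also have "\<dots> \<le> (\<integral>\<^sup>+ y. ennreal b \<partial>(sphere_measure :: 'a measure))"
    proof (rule nn_integral_mono)
      fix y :: 'a assume "y \<in> space sphere_measure"
      then have y: "y \<in> S_unit" by simp
      have "(\<integral>\<^sup>+ \<omega>. ennreal (block_poly j \<omega> y ^ (2 * ?q)) \<partial>M)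
          \<le> ennreal (gauss_const ?q * (2 * (LINT \<omega>|M. (band (block j) \<omega> y)\<^sup>2)) ^ ?q)"
        unfolding block_poly_band[OF y] by (rule band_moment[OF _ y]) (simp add: block_def)
      also have "\<dots> \<le> ennreal b"
        unfolding b_def using s(2)[OF y] g0
        by (intro ennreal_leI mult_left_mono power_mono) auto
      finally show "(\<integral>\<^sup>+ \<omega>. ennreal (block_poly j \<omega> y ^ (2 * ?q)) \<partial>M) \<le> ennreal b" .
    qed
    also have "\<dots> = ennreal (b * area)"
      using b0 area_pos by (simp add: emeasure_sphere_area ennreal_mult)
    also have "b * area = C * 2 powr (- (\<beta> * real ?q) * real j)"
    proof -
      have "(2 powr (- (\<beta> * real j))) ^ ?q = 2 powr (- (\<beta> * real ?q) * real j)"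
        by (simp add: powr_realpow[symmetric] powr_powr mult_ac)
      then show ?thesis by (simp add: b_def C_def power_mult_distrib)
    qed
    finally show ?thesis .
  qed
  have exponent: "2 * real ?q * decay_rate n + real ?d - \<beta> * real ?q = - real ?d"
    by (simp add: decay_rate_def moment_def field_simps)
  have "(\<integral>\<^sup>+ \<omega>. block_norms n \<omega> \<partial>M)
      = (\<Sum>j. ennreal (weight n j) * (\<integral>\<^sup>+ \<omega>. \<integral>\<^sup>+ y. ennreal (block_poly j \<omega> y ^ (2 * ?q)) \<partial>sphere_measure \<partial>M))"
    unfolding block_norms_def by (subst nn_integral_suminf) (auto simp: nn_integral_cmult)
  also have "\<dots> \<le> (\<Sum>j. ennreal (C * 2 powr (- real ?d * real j)))"
  proof (rule suminf_le)
    fix j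
    have "ennreal (weight n j) * (\<integral>\<^sup>+ \<omega>. \<integral>\<^sup>+ y. ennreal (block_poly j \<omega> y ^ (2 * ?q)) \<partial>sphere_measure \<partial>M)
        \<le> ennreal (weight n j) * ennreal (C * 2 powr (- (\<beta> * real ?q) * real j))"
      by (rule mult_left_mono[OF mom]) simp
    also have "\<dots> = ennreal (weight n j * (C * 2 powr (- (\<beta> * real ?q) * real j)))"
      using C0 by (simp add: ennreal_mult weight_def)
    also have "weight n j * (C * 2 powr (- (\<beta> * real ?q) * real j))
        = C * 2 powr ((2 * real ?q * decay_rate n + real ?d - \<beta> * real ?q) * real j)"
      by (simp add: weight_def powr_add[symmetric] algebra_simps)
    finally show "ennreal (weight n j) * (\<integral>\<^sup>+ \<omega>. \<integral>\<^sup>+ y. ennreal (block_poly j \<omega> y ^ (2 * ?q)) \<partial>sphere_measure \<partial>M)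
        \<le> ennreal (C * 2 powr (- real ?d * real j))" unfolding exponent .
  qed auto
  also have "\<dots> < \<infinity>"
  proof -
    have "2 powr (- real ?d * real j) = (2 powr (- real ?d)) ^ j" for j
      by (simp add: powr_realpow[symmetric] powr_powr)
    moreover have "2 powr (- real ?d) < (1::real)" by (simp add: powr_less_one)
    ultimately have "summable (\<lambda>j. C * 2 powr (- real ?d * real j))"
      by (simp add: summable_geometric summable_mult)
    then show ?thesis using C0 by (simp add: suminf_ennreal2 less_top[symmetric])
  qed
  finally show ?thesis .
qed

definition good :: "'w set" where
  "good = {\<omega> \<in> space M. \<forall>n. block_norms n \<omega> < \<infinity>}"

lemma good_sets [measurable]: "good \<in> sets M"
  unfolding good_def by measurable

lemma AE_good: "AE \<omega> in M. \<omega> \<in> good"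
proof -
  have "AE \<omega> in M. block_norms n \<omega> < \<infinity>" for n
    using nn_integral_noteq_infinite[OF block_norms_measurable] block_norms_integral_finite[of n]
    by (auto simp: less_top)
  then have "AE \<omega> in M. \<forall>n. block_norms n \<omega> < \<infinity>" by (simp add: AE_all_countable)
  with AE_space show ?thesis by eventually_elim (simp add: good_def)
qed

text \<open>
  A finite weighted sum of norms bounds each of its terms, and Nikolskii's inequality turns the
  bound on the integral of the power \<open>2 q\<close> into a bound on the maximum.
\<close>

lemma block_poly_decay:
  assumes \<omega>: "\<omega> \<in> good" and \<gamma>: "\<gamma> < \<beta> / 2"
  shows "\<exists>C. \<forall>j x. norm x = 1 \<longrightarrow> \<bar>block_poly j \<omega> x\<bar> \<le> C * 2 powr (- (\<gamma> * real j))"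
proof -
  let ?d = "DIM('a)"
  obtain n where n: "inverse (real (Suc n)) < \<beta> / 2 - \<gamma>"
    using reals_Archimedean[of "\<beta> / 2 - \<gamma>"] \<gamma> by auto
  let ?q = "moment n" and ?\<gamma> = "decay_rate n"
  have \<gamma>n: "\<gamma> \<le> ?\<gamma>" using n by (simp add: decay_rate_def inverse_eq_divide)
  have "block_norms n \<omega> \<noteq> \<top>" using \<omega> by (simp add: good_def less_top)
  then obtain w where w: "0 \<le> w" "block_norms n \<omega> = ennreal w"
    by (metis ennreal_cases)
  obtain c where c: "c > 0"
    "\<And>N (f :: 'a \<Rightarrow> real) p x. degree_le N f \<Longrightarrow> N \<ge> 1 \<Longrightarrow> norm x = 1 \<Longrightarrow>
       ennreal (c * \<bar>f x\<bar> ^ p)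
         \<le> ennreal (2 ^ p * real N ^ ?d) * (\<integral>\<^sup>+ y. ennreal (\<bar>f y\<bar> ^ p) \<partial>sphere_measure)"
    using nikolskii[OF dim] by metis
  define B where "B = 2 ^ (2 * ?q) * 2 ^ ?d * w / c"
  have B0: "0 \<le> B" using w(1) c(1) by (simp add: B_def)
  have "\<bar>block_poly j \<omega> x\<bar> \<le> (1 + B) * 2 powr (- (\<gamma> * real j))" if x: "norm x = 1" for j x
  proof -
    define I where "I = (\<integral>\<^sup>+ y. ennreal (block_poly j \<omega> y ^ (2 * ?q)) \<partial>sphere_measure)"
    define r where "r = 2 powr (- (?\<gamma> * real j))"
    have r0: "0 < r" by (simp add: r_def)
    have wj: "0 < weight n j" by (simp add: weight_def)
    have "ennreal (weight n j) * I \<le> block_norms n \<omega>"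
      unfolding block_norms_def I_def by (rule sum_le_suminf[of _ "{j}", simplified]) auto
    then have "ennreal (weight n j) * I \<le> ennreal w" using w by simp
    then have "ennreal (1 / weight n j) * (ennreal (weight n j) * I) \<le> ennreal (1 / weight n j) * ennreal w"
      by (rule mult_left_mono) simp
    then have I: "I \<le> ennreal (w / weight n j)"
      using wj w(1) by (simp add: mult.assoc[symmetric] ennreal_mult[symmetric])
    have "ennreal (c * \<bar>block_poly j \<omega> x\<bar> ^ (2 * ?q)) \<le> ennreal (2 ^ (2 * ?q) * real (2 ^ Suc j) ^ ?d) * I"
      using c(2)[OF degree_le_block_poly _ x, of j \<omega> "2 * ?q"] by (simp add: I_def power_even_abs)
    also have "\<dots> \<le> ennreal (2 ^ (2 * ?q) * real (2 ^ Suc j) ^ ?d) * ennreal (w / weight n j)"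
      by (rule mult_left_mono[OF I]) simp
    also have "\<dots> = ennreal (2 ^ (2 * ?q) * real (2 ^ Suc j) ^ ?d * (w / weight n j))"
      using w(1) wj by (simp add: ennreal_mult[symmetric])
    finally have "c * \<bar>block_poly j \<omega> x\<bar> ^ (2 * ?q) \<le> 2 ^ (2 * ?q) * real (2 ^ Suc j) ^ ?d * (w / weight n j)"
      using w(1) wj by (subst (asm) ennreal_le_iff) auto
    also have "\<dots> = 2 ^ (2 * ?q) * w * (real (2 ^ Suc j) ^ ?d / weight n j)" by simp
    also have "real (2 ^ Suc j) ^ ?d / weight n j = 2 ^ ?d * r ^ (2 * ?q)"
    proof -
      have "real (2 ^ Suc j) ^ ?d = 2 ^ ?d * 2 powr (real ?d * real j)"
        by (simp add: power_mult_distrib powr_realpow[symmetric] powr_powr mult.commute power_mult[symmetric])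
      moreover have "weight n j = 2 powr (2 * real ?q * ?\<gamma> * real j) * 2 powr (real ?d * real j)"
        by (simp add: weight_def powr_add[symmetric] algebra_simps)
      moreover have "r ^ (2 * ?q) = 1 / 2 powr (2 * real ?q * ?\<gamma> * real j)"
      proof -
        have "r ^ (2 * ?q) = 2 powr (- (2 * real ?q * ?\<gamma> * real j))"
          by (simp add: r_def powr_power algebra_simps)
        then show ?thesis by (simp only: powr_minus_divide)
      qed
      ultimately show ?thesis by simp
    qed
    finally have "\<bar>block_poly j \<omega> x\<bar> ^ (2 * ?q) \<le> 2 ^ (2 * ?q) * w * (2 ^ ?d * r ^ (2 * ?q)) / c"
      by (subst pos_le_divide_eq[OF c(1)]) (simp only: mult.commute[of c])
    then have "\<bar>block_poly j \<omega> x\<bar> ^ (2 * ?q) \<le> B * r ^ (2 * ?q)" by (simp add: B_def mult_ac)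
    then have pw: "(\<bar>block_poly j \<omega> x\<bar> / r) ^ (2 * ?q) \<le> B"
      unfolding power_divide by (subst pos_divide_le_eq) (use r0 in simp_all)
    \<comment> \<open>a number is at most 1 or at most its power, so no root of \<open>B\<close> is needed\<close>
    have "\<bar>block_poly j \<omega> x\<bar> / r \<le> 1 + B"
    proof (cases "\<bar>block_poly j \<omega> x\<bar> / r \<le> 1")
      case False
      have "1 \<le> 2 * ?q" by (simp add: moment_def Suc_le_eq)
      then have "(\<bar>block_poly j \<omega> x\<bar> / r) ^ 1 \<le> (\<bar>block_poly j \<omega> x\<bar> / r) ^ (2 * ?q)"
        using False by (intro power_increasing) auto
      then show ?thesis using pw by simp
    qed (use B0 in simp)
    then have "\<bar>block_poly j \<omega> x\<bar> \<le> (1 + B) * r" using r0 by (simp add: pos_divide_le_eq)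
    also have "\<dots> \<le> (1 + B) * 2 powr (- (\<gamma> * real j))"
      unfolding r_def using \<gamma>n B0 by (intro mult_left_mono powr_mono) (auto intro: mult_right_mono)
    finally show ?thesis .
  qed
  then show ?thesis by blast
qed

text \<open>Every sample path has to be regular, so on the exceptional null set the blocks are replaced by 0.\<close>

definition good_block :: "'w \<Rightarrow> nat \<Rightarrow> 'a \<Rightarrow> real" where
  "good_block \<omega> j x = (if \<omega> \<in> good then block_poly j \<omega> x else 0)"

definition modification :: "'w \<Rightarrow> 'a \<Rightarrow> real" where
  "modification \<omega> x = (\<Sum>j. good_block \<omega> j x)"

lemma good_block_dyadic: "dyadic_series (good_block \<omega>) (\<beta> / 2)"
proof
  fix j
  show "degree_le (2 ^ Suc j) (good_block \<omega> j)"
    using degree_le_block_poly[of j \<omega>] degree_le_const[of "2 ^ Suc j" 0]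
    unfolding good_block_def[abs_def] by (cases "\<omega> \<in> good") auto
next
  fix \<gamma> assume "\<gamma> < \<beta> / 2"
  then show "\<exists>C. \<forall>j x. norm x = 1 \<longrightarrow> \<bar>good_block \<omega> j x\<bar> \<le> C * 2 powr (- (\<gamma> * real j))"
    using block_poly_decay[of \<omega> \<gamma>] by (cases "\<omega> \<in> good") (auto simp: good_block_def intro!: exI[of _ 0])
qed

lemma modification_measurable: "random_field M modification"
proof -
  have [measurable]: "(\<lambda>(\<omega>, x). good_block \<omega> j x) \<in> borel_measurable (M \<Otimes>\<^sub>M (sphere_measure :: 'a measure))" for j
    unfolding good_block_def by measurable
  have "(\<lambda>(\<omega>, x). modification \<omega> x) \<in> borel_measurable (M \<Otimes>\<^sub>M (sphere_measure :: 'a measure))"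
    unfolding modification_def by measurable
  moreover have "sets (M \<Otimes>\<^sub>M (sphere_measure :: 'a measure)) = sets (M \<Otimes>\<^sub>M restrict_space borel S_unit)"
    by (intro sets_pair_measure_cong sets_sphere_measure refl)
  ultimately show ?thesis unfolding random_field_def by (simp cong: measurable_cong_sets)
qed

text \<open>
  At a fixed point the expansion converges to the field in mean square, hence almost surely along
  a subsequence, while along dyadic cut-offs it converges to the modification on the good set.
\<close>

lemma modification_AE:
  assumes x: "x \<in> S_unit"
  shows "AE \<omega> in M. modification \<omega> x = T \<omega> x"
proof -
  define P where "P = (\<lambda>J \<omega>. partial_sum (2 ^ Suc J - 2) \<omega> x)"
  have sub: "strict_mono (\<lambda>J. 2 ^ Suc J - 2 :: nat)"
  proof (rule strict_monoI_Suc)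
    fix J :: nat
    obtain n where "2 ^ J = Suc n" using gr0_implies_Suc[of "2 ^ J"] by auto
    then show "2 ^ Suc J - 2 < (2 ^ Suc (Suc J) - 2 :: nat)" by simp
  qed
  have "\<exists>r::nat\<Rightarrow>nat. strict_mono r \<and> (AE \<omega> in M. (\<lambda>J. (T \<omega> x - P (r J) \<omega>)\<^sup>2) \<longlonglongrightarrow> 0)"
  proof (rule tendsto_L1_AE_subseq)
    show "integrable M (\<lambda>\<omega>. (T \<omega> x - P J \<omega>)\<^sup>2)" for J
      using square_integrable_diff[OF T_square[OF x] band_square]
      unfolding P_def partial_sum_band square_integrable_def by blast
    show "(\<lambda>J. LINT \<omega>|M. norm ((T \<omega> x - P J \<omega>)\<^sup>2)) \<longlonglongrightarrow> 0"
      using LIMSEQ_subseq_LIMSEQ[OF expansion_pointwise[OF x] sub] by (simp add: o_def P_def)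
  qed
  then obtain r :: "nat \<Rightarrow> nat" where r: "strict_mono r"
    "AE \<omega> in M. (\<lambda>J. (T \<omega> x - P (r J) \<omega>)\<^sup>2) \<longlonglongrightarrow> 0" by blast
  from r(2) AE_good show ?thesis
  proof eventually_elim
    fix \<omega> assume lim: "(\<lambda>J. (T \<omega> x - P (r J) \<omega>)\<^sup>2) \<longlonglongrightarrow> 0" and \<omega>: "\<omega> \<in> good"
    interpret dyadic_series "good_block \<omega>" "\<beta> / 2" by (rule good_block_dyadic)
    have nx: "norm x = 1" using x by simp
    then have "x \<noteq> 0" "sgn x = x" by (auto simp: sgn_div_norm)
    then have "good_block \<omega> j x = deriv_term [] j x" for j by (simp add: deriv_term_def)
    then have "(\<lambda>j. good_block \<omega> j x) sums modification \<omega> x"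
      using deriv_series_sums[of "[]" x] beta \<open>x \<noteq> 0\<close> by (simp add: modification_def sums_iff)
    then have "(\<lambda>J. \<Sum>j<Suc J. good_block \<omega> j x) \<longlonglongrightarrow> modification \<omega> x"
      unfolding sums_def by (rule LIMSEQ_Suc)
    then have "(\<lambda>J. P J \<omega>) \<longlonglongrightarrow> modification \<omega> x"
      using \<omega> by (simp only: P_def partial_sum_blocks[OF x] good_block_def if_True)
    from LIMSEQ_subseq_LIMSEQ[OF this r(1)]
    have "(\<lambda>J. (T \<omega> x - P (r J) \<omega>)\<^sup>2) \<longlonglongrightarrow> (T \<omega> x - modification \<omega> x)\<^sup>2"
      by (intro tendsto_intros) (simp add: o_def)
    then have "(T \<omega> x - modification \<omega> x)\<^sup>2 = 0" using lim LIMSEQ_unique by blast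
    then show "modification \<omega> x = T \<omega> x" by simp
  qed
qed

lemma modification_is_modification: "is_modification M T modification"
  unfolding is_modification_def
proof (intro conjI ballI modification_measurable)
  fix x :: 'a assume x: "x \<in> S_unit"
  have "sets (M \<Otimes>\<^sub>M (sphere_measure :: 'a measure)) = sets (M \<Otimes>\<^sub>M restrict_space borel S_unit)"
    by (intro sets_pair_measure_cong sets_sphere_measure refl)
  then have "(\<lambda>(\<omega>, x). modification \<omega> x) \<in> borel_measurable (M \<Otimes>\<^sub>M (sphere_measure :: 'a measure))"
    using modification_measurable unfolding random_field_def by (simp cong: measurable_cong_sets)
  from measurable_Pair1[OF this, of x] x
  have [measurable]: "(\<lambda>\<omega>. modification \<omega> x) \<in> borel_measurable M" by simp
  have [measurable]: "(\<lambda>\<omega>. T \<omega> x) \<in> borel_measurable M"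
    using T_square[OF x] by (simp add: square_integrable_def)
  have "{\<omega> \<in> space M. modification \<omega> x = T \<omega> x} \<in> sets M" by measurable
  then show "\<P>(\<omega> in M. modification \<omega> x = T \<omega> x) = 1"
    using modification_AE[OF x] by (simp add: prob_Collect_eq_1)
qed

end

theorem theorem4p7:
  fixes M :: "'w measure"
    and T :: "'w \<Rightarrow> 'a::euclidean_space \<Rightarrow> real"
    and S :: "nat \<Rightarrow> nat \<Rightarrow> 'a \<Rightarrow> real"
    and A :: "nat \<Rightarrow> real"
    and \<beta> :: real
  assumes dim: "DIM('a) \<ge> 2"
    and prob: "prob_space M"
    and harmonics: "orthonormal_spherical_harmonics S"
    and field: "centered_isotropic_gaussian_field M T"
    and spectrum: "angular_power_spectrum M T S A"
    and beta: "\<beta> > 0"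
    and summ: "summable (\<lambda>l. A l * real l powr (real DIM('a) - 2 + \<beta>))"
  shows "\<exists>T'. is_modification M T T' \<and>
    (\<forall>\<gamma>. 0 \<le> \<gamma> \<and> \<gamma> < \<beta> / 2 \<longrightarrow> (\<forall>\<omega>\<in>space M. T' \<omega> \<in> Hoelder_space \<gamma>)) \<and>
    (let k = nat (\<lceil>\<beta> / 2\<rceil> - 1) in
       (\<forall>\<omega>\<in>space M. Ck_sphere k (T' \<omega>)) \<and>
       (\<forall>\<gamma>. real k < \<gamma> \<and> \<gamma> < \<beta> / 2 \<longrightarrow>
          (\<forall>\<omega>\<in>space M. derivs_Hoelder k (\<gamma> - real k) (T' \<omega>))))"
proof -
  obtain a where a:
    "\<forall>l. \<forall>m\<in>{1..harm_dim l DIM('a)}.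
       a l m \<in> borel_measurable M \<and> integrable M (\<lambda>\<omega>. (a l m \<omega>)\<^sup>2) \<and> (LINT \<omega>|M. a l m \<omega>) = 0"
    "\<forall>l l'. \<forall>m\<in>{1..harm_dim l DIM('a)}. \<forall>m'\<in>{1..harm_dim l' DIM('a)}.
       (LINT \<omega>|M. a l m \<omega> * a l' m' \<omega>) = (if l = l' \<and> m = m' then A l else 0)"
    "(\<lambda>L. \<integral>\<^sup>+ (\<omega>, x). ennreal ((T \<omega> x -
        (\<Sum>l\<le>L. \<Sum>m=1..harm_dim l DIM('a). a l m \<omega> * S l m x))\<^sup>2) \<partial>(M \<Otimes>\<^sub>M sphere_measure)) \<longlonglongrightarrow> 0"
    using spectrum unfolding angular_power_spectrum_def by blast
  interpret prob_space M by fact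
  interpret karhunen_loeve_smooth S M T A a \<beta>
  proof
    show "0 \<le> A l" for l using spectrum by (simp add: angular_power_spectrum_def)
    show "square_integrable M (a l m)" if "m \<in> {1..harm_dim l DIM('a)}" for l m
      using a(1) that unfolding square_integrable_def by blast
    show "(LINT \<omega>|M. a l m \<omega> * a l' m' \<omega>) = (if l = l' \<and> m = m' then A l else 0)"
      if "m \<in> {1..harm_dim l DIM('a)}" "m' \<in> {1..harm_dim l' DIM('a)}" for l m l' m'
      using a(2) that by blast
  qed (fact dim harmonics field a(3) beta summ)+
  define k where "k = nat (\<lceil>\<beta> / 2\<rceil> - 1)"
  have "0 < \<lceil>\<beta> / 2\<rceil>" using beta by simp
  then have "real k = of_int \<lceil>\<beta> / 2\<rceil> - 1" by (simp add: k_def)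
  then have k: "real k < \<beta> / 2" "\<beta> / 2 \<le> real k + 1" by linarith+
  have sum: "modification \<omega> x = (\<Sum>j. good_block \<omega> j x)" for \<omega> x by (simp add: modification_def)
  have "modification \<omega> \<in> Hoelder_space \<gamma>" if "0 \<le> \<gamma>" "\<gamma> < \<beta> / 2" for \<omega> \<gamma>
    by (rule dyadic_series.Hoelder_space_series[OF good_block_dyadic sum dim that])
  moreover have "Ck_sphere k (modification \<omega>)" for \<omega>
    by (rule dyadic_series.Ck_sphere_series[OF good_block_dyadic sum k(1)])
  moreover have "derivs_Hoelder k (\<gamma> - real k) (modification \<omega>)"
    if "real k < \<gamma>" "\<gamma> < \<beta> / 2" for \<omega> \<gamma>
    by (rule dyadic_series.derivs_Hoelder_series[OF good_block_dyadic sum dim]) (use that k in auto)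
  ultimately show ?thesis
    unfolding Let_def k_def[symmetric] using modification_is_modification by blast
qed

end
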